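(* Let $\mathfrak g$ be a complex Lie superalgebra equipped with an even, symmetric, $\mathfrak g$-invariant bilinear form $h$. Then $\mathcal V[\mathfrak g,h]_{univ}$ is a raviolo vertex algebra over $\mathbf C[\kappa]$ with spin grading and super grading that is strongly generated over $\mathbf C[\kappa]$ by the fields $\mu_a(z)$.
   Context: Conventions. Spaces are over $\mathbf C$ and $\mathbf Z$-graded (cohomological degree), possibly with an additional $\mathbf Z/2$ super grading; $|\cdot|$ denotes the total parity (cohomological degree plus super parity) in Koszul signs, $[x,y]=xy-(-1)^{|x||y|}yx$. $\mathcal K$: graded commutative algebra with degree 0 part $\mathbf C[\![z]\!]$ and degree 1 part the span (finite combinations) of symbols $\Omega_z^m$, $m\ge0$, with $z^n\Omega_z^m=\Omega_z^{m-n}$ ($n\le m$), $z^n\Omega_z^m=0$ ($n>m$), $\Omega_z^n\Omega_z^m=0$; $\mathcal K_{dist}$ is the graded vector space defined in the same way but with infinite sums of the $\Omega_z^m$ allowed; $\mathcal K_{dist}^{z,w}$ is the two-variable analogue (all infinite combinations of $z^mw^n$, $z^m\Omega_w^n$, $\Omega_z^mw^n$, $\Omega_z^m\Omega_w^n$, with $\Omega_z,\Omega_w$ anticommuting). $\partial_zz^n=nz^{n-1}$, $\partial_z\Omega_z^m=-(m+1)\Omega_z^{m+1}$. $\mathrm{End}(\mathcal V)\otimes\mathcal K_{dist}$ denotes $\mathrm{End}(\mathcal V)$-valued infinite series. Raviolo vertex algebras over a graded commutative unital $\mathbf C$-algebra $S$. For a graded $S$-module $\mathcal V$, a raviolo field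 over $S$ is $A(z)=\sum_{m<0}z^{-m-1}A_m+\sum_{m\ge0}\Omega_z^mA_m$ with $A_m\in\mathrm{End}_S(\mathcal V)$ and, for each $v\in\mathcal V$, $A_mv=0$ for $m\gg0$; homogeneous of degree $r$ if $A_m$ has degree $r$ for $m<0$ and $r-1$ for $m\ge0$. $A,B$ are mutually local if for some $N\ge0$: $(z-w)^{N+1}[A(z),B(w)]=0$ and $\big(\Omega_z^m-\sum_{n=0}^N(w-z)^n\binom{m+n}{n}\Omega_w^{m+n}\big)[A(z),B(w)]=0$ for all $m\ge0$, in $\mathrm{End}_S(\mathcal V)\otimes\mathcal K_{dist}^{z,w}$. A raviolo vertex algebra over $S$ is a graded $S$-module $\mathcal V$ with $|0\rangle\in\mathcal V^0$, a degree 0 $S$-module morphism $\partial:\mathcal V\to\mathcal V$, and a degree 0 $S$-module morphism $Y(-,z):\mathcal V\to\mathrm{End}_S(\mathcal V)\otimes\mathcal K_{dist}$, $Y(a,z)=\sum_{m<0}z^{-m-1}a_{(m)}+\sum_{m\ge0}\Omega_z^ma_{(m)}$, such that each $Y(a,z)$ is a raviolo field over $S$; $[\partial,Y(a,z)]=\partial_zY(a,z)$; $\partial|0\rangle=0$, $Y(|0\rangle,z)=\mathrm{id}$, $Y(a,z)|0\rangle\in\mathcal V[\![z]\!]$ with value $a$ at $z=0$; all $Y(a,z),Y(b,w)$ are mutually local. Spin grading: extra grading with $|0\rangle$ of spin 0, $\partial$ raising spin by 1, $a_{(n)}$ raising spin by $s-n-1$ for $a$ of spin $s$. Super grading: extra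 $\mathbf Z/2$-grading with $|0\rangle,\partial,Y$ even. Strongly generated over $S$ by $\{b^i\}$ (or their fields): $\mathcal V$ is spanned as an $S$-module by $b^{i_1}_{(j_1)}\cdots b^{i_l}_{(j_l)}|0\rangle$ with all $j_k<0$. The algebra. Let $\{T_a\}$ be a homogeneous basis of $\mathfrak g$, $[T_a,T_b]=f_{ab}^cT_c$, $h_{ab}=h(T_a,T_b)$. $\widehat{\mathfrak g}_h$ is the central extension of $\mathfrak g\otimes\mathcal K$ (variable $u$) by a central element $\kappa$ of cohomological degree $+1$, spin 0, fermionic (super-even): with $J_{a,n}=T_a\otimes u^n$ (degree 0, spin $-n$, super parity that of $T_a$), $\mu_{a,n}=T_a\otimes\Omega_u^n$ (degree 1, spin $n+1$, super parity that of $T_a$), $n\ge0$, the brackets are $[J_{a,m},J_{b,n}]=f_{ab}^cJ_{c,m+n}$, $[\mu_{a,m},\mu_{b,n}]=0$, and $[J_{a,m},\mu_{b,n}]=f_{ab}^c\mu_{c,n-m}$ if $n\ge m$, $=m\,h_{ab}\kappa$ if $n+1=m$, $=0$ if $n+1<m$ (remaining brackets by graded skew-symmetry; extended to power series in $u$). $\widehat{\mathfrak g}_{\ge0}=\mathfrak g[\![u]\!]\oplus\mathbf C\kappa$; $\mathbf C[\kappa]=\mathbf C\oplus\mathbf C\kappa$, $\kappa$ of degree 1 with $\kappa^2=0$, on which $\mathfrak g[\![u]\!]$ acts by 0 and $\kappa$ by multiplication. $\mathcal V[\mathfrak g,h]_{univ}=U\widehat{\mathfrak g}_h\otimes_{U\widehat{\mathfrak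 g}_{\ge0}}\mathbf C[\kappa]$, with $|0\rangle=1\otimes1$, $\partial$ induced by the derivation $\partial\mu_{a,n}=(n+1)\mu_{a,n+1}$, $\partial J_{a,n}=-nJ_{a,n-1}$, $\partial\kappa=0$ (and $\partial|0\rangle=0$), $\kappa\in\mathbf C[\kappa]$ acting as the central element, and the generating fields $$\mu_a(z)=Y(\mu_{a,0}|0\rangle,z)=\sum_{n\ge0}\big(z^n\mu_{a,n}+\Omega_z^nJ_{a,n}\big).$$ *)

theory Defs
  imports Complex_Main "HOL-Library.Poly_Mapping" "HOL-Library.Z2"
begin

section \<open>Complex vector spaces, gradings, Koszul signs\<close>

class complex_space = ab_group_add +
  fixes scaleC :: "complex \<Rightarrow> 'a \<Rightarrow> 'a"  (infixr "*\<^sub>C" 75)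
  assumes scaleC_add_right: "c *\<^sub>C (x + y) = c *\<^sub>C x + c *\<^sub>C y"
    and scaleC_add_left: "(c + d) *\<^sub>C x = c *\<^sub>C x + d *\<^sub>C x"
    and scaleC_scaleC: "c *\<^sub>C (d *\<^sub>C x) = (c * d) *\<^sub>C x"
    and scaleC_one: "1 *\<^sub>C x = x"

global_interpretation cvs: vector_space "scaleC :: complex \<Rightarrow> 'a \<Rightarrow> 'a::complex_space"
  by unfold_locales (fact scaleC_add_right scaleC_add_left scaleC_scaleC scaleC_one)+

class complex_algebra = complex_space + ring + monoid_mult +
  assumes scaleC_mult_left: "(c *\<^sub>C x) * y = c *\<^sub>C (x * y)"
    and scaleC_mult_right: "x * (c *\<^sub>C y) = c *\<^sub>C (x * y)"

instantiation complex :: complex_space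
begin
definition scaleC_complex :: "complex \<Rightarrow> complex \<Rightarrow> complex" where
  "scaleC_complex c x = c * x"
instance by standard (simp_all add: scaleC_complex_def algebra_simps)
end

instantiation poly_mapping :: (type, complex_space) complex_space
begin
definition scaleC_poly_mapping :: "complex \<Rightarrow> ('a \<Rightarrow>\<^sub>0 'b) \<Rightarrow> ('a \<Rightarrow>\<^sub>0 'b)" where
  "scaleC_poly_mapping c f = Poly_Mapping.map (scaleC c) f"
lemma lookup_scaleC [simp]: "Poly_Mapping.lookup (c *\<^sub>C f) k = c *\<^sub>C Poly_Mapping.lookup f k"
  by (simp add: scaleC_poly_mapping_def Poly_Mapping.map.rep_eq when_def cvs.scale_zero_right)
instance
  by standard
    (simp_all add: poly_mapping_eq_iff fun_eq_iff lookup_add scaleC_add_right scaleC_add_left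
      scaleC_scaleC scaleC_one)
end

text \<open>Direct sum decomposition: every vector is uniquely a finite sum of homogeneous components.\<close>

definition is_grading :: "('i \<Rightarrow> 'a::complex_space set) \<Rightarrow> bool" where
  "is_grading G \<longleftrightarrow>
     (\<forall>i. cvs.subspace (G i)) \<and>
     (\<forall>v. \<exists>!c :: 'i \<Rightarrow>\<^sub>0 'a. (\<forall>i. Poly_Mapping.lookup c i \<in> G i) \<and> (\<Sum>i\<in>Poly_Mapping.keys c. Poly_Mapping.lookup c i) = v)"

text \<open>\<open>koszul p q\<close> is the sign \<open>(-1)\<^sup>p\<^sup>q\<close>; \<open>total_parity\<close> is cohomological degree plus super parity.\<close>

definition koszul :: "bit \<Rightarrow> bit \<Rightarrow> complex" where
  "koszul p q = (if p = 1 \<and> q = 1 then -1 else 1)"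

definition total_parity :: "int \<Rightarrow> bit \<Rightarrow> bit" where
  "total_parity d p = of_int d + p"


section \<open>Lie superalgebras with an invariant form\<close>

class lie_superalgebra = complex_space +
  fixes homog :: "bit \<Rightarrow> 'a set"
    and bracket :: "'a \<Rightarrow> 'a \<Rightarrow> 'a"
  assumes homog_zero: "0 \<in> homog p"
    and homog_add: "x \<in> homog p \<Longrightarrow> y \<in> homog p \<Longrightarrow> x + y \<in> homog p"
    and homog_scale: "x \<in> homog p \<Longrightarrow> c *\<^sub>C x \<in> homog p"
    and homog_disjoint: "x \<in> homog 0 \<Longrightarrow> x \<in> homog 1 \<Longrightarrow> x = 0"
    and homog_total: "\<exists>y\<in>homog 0. \<exists>z\<in>homog 1. x = y + z"
    and bracket_add_left: "bracket (x + y) z = bracket x z + bracket y z"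
    and bracket_add_right: "bracket x (y + z) = bracket x y + bracket x z"
    and bracket_scale_left: "bracket (c *\<^sub>C x) y = c *\<^sub>C bracket x y"
    and bracket_scale_right: "bracket x (c *\<^sub>C y) = c *\<^sub>C bracket x y"
    and bracket_homog: "x \<in> homog p \<Longrightarrow> y \<in> homog q \<Longrightarrow> bracket x y \<in> homog (p + q)"
    and bracket_skew: "x \<in> homog p \<Longrightarrow> y \<in> homog q \<Longrightarrow>
      bracket x y = - (koszul p q *\<^sub>C bracket y x)"
    and bracket_jacobi: "x \<in> homog p \<Longrightarrow> y \<in> homog q \<Longrightarrow> z \<in> homog r \<Longrightarrow>
      bracket x (bracket y z) = bracket (bracket x y) z + koszul p q *\<^sub>C bracket y (bracket x z)"

text \<open>Symmetry of the form is understood in the super sense: \<open>h\<close> is skew on the odd part.\<close>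

class lie_superalgebra_form = lie_superalgebra +
  fixes form :: "'a \<Rightarrow> 'a \<Rightarrow> complex"
  assumes form_add_left: "form (x + y) z = form x z + form y z"
    and form_add_right: "form x (y + z) = form x y + form x z"
    and form_scale_left: "form (c *\<^sub>C x) y = c * form x y"
    and form_scale_right: "form x (c *\<^sub>C y) = c * form x y"
    and form_even: "x \<in> homog p \<Longrightarrow> y \<in> homog q \<Longrightarrow> p \<noteq> q \<Longrightarrow> form x y = 0"
    and form_symmetric: "x \<in> homog p \<Longrightarrow> y \<in> homog q \<Longrightarrow> form x y = koszul p q * form y x"
    and form_invariant: "form (bracket x y) z = form x (bracket y z)"

definition parity_part :: "bit \<Rightarrow> 'a::lie_superalgebra \<Rightarrow> 'a" where
  "parity_part p x = (THE y. y \<in> homog p \<and> x - y \<in> homog (p + 1))"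

definition homogeneous_basis :: "'a::lie_superalgebra set \<Rightarrow> bool" where
  "homogeneous_basis T \<longleftrightarrow>
     cvs.independent T \<and> cvs.span T = UNIV \<and> (\<forall>x\<in>T. \<exists>p. x \<in> homog p)"


section \<open>The affine raviolo algebra\<close>

text \<open>\<open>Affine x y k\<close> is the element \<open>\<Sum>n x\<^sub>n u\<^sup>n + \<Sum>n y\<^sub>n \<Omega>\<^sub>u\<^sup>n + k \<kappa>\<close>, where the first sum is
  an arbitrary power series and the second one is finite.\<close>

context
  notes [[typedef_overloaded]]
begin

datatype 'g affine = Affine (cur: "nat \<Rightarrow> 'g") (mom: "nat \<Rightarrow>\<^sub>0 'g") (cen: complex)

end

instantiation affine :: (complex_space) complex_space
begin
definition "0 = Affine (\<lambda>n. 0) 0 0"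
definition "X + Y = Affine (\<lambda>n. cur X n + cur Y n) (mom X + mom Y) (cen X + cen Y)"
definition "- X = Affine (\<lambda>n. - cur X n) (- mom X) (- cen X)"
definition "X - Y = Affine (\<lambda>n. cur X n - cur Y n) (mom X - mom Y) (cen X - cen Y)"
definition "c *\<^sub>C X = Affine (\<lambda>n. c *\<^sub>C cur X n) (c *\<^sub>C mom X) (c * cen X)"
instance
  by standard
    (simp_all add: zero_affine_def plus_affine_def uminus_affine_def minus_affine_def
      scaleC_affine_def algebra_simps scaleC_add_right scaleC_add_left scaleC_scaleC scaleC_one)
end

text \<open>The two components of \<open>[\<Sum>m x\<^sub>m u\<^sup>m, \<Sum>n y\<^sub>n \<Omega>\<^sub>u\<^sup>n]\<close>.\<close>

definition cur_mom :: "(nat \<Rightarrow> 'g::lie_superalgebra) \<Rightarrow> (nat \<Rightarrow>\<^sub>0 'g) \<Rightarrow> (nat \<Rightarrow>\<^sub>0 'g)" where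
  "cur_mom x y = (\<Sum>n\<in>Poly_Mapping.keys y. \<Sum>m\<le>n. Poly_Mapping.single (n - m) (bracket (x m) (Poly_Mapping.lookup y n)))"

definition cur_mom_central :: "(nat \<Rightarrow> 'g::lie_superalgebra_form) \<Rightarrow> (nat \<Rightarrow>\<^sub>0 'g) \<Rightarrow> complex" where
  "cur_mom_central x y = (\<Sum>n\<in>Poly_Mapping.keys y. of_nat (n + 1) * form (x (n + 1)) (Poly_Mapping.lookup y n))"

text \<open>The components of \<open>[\<Sum>n y\<^sub>n \<Omega>\<^sub>u\<^sup>n, \<Sum>m x\<^sub>m u\<^sup>m]\<close> are then fixed by graded skew-symmetry, which is
  applied to parity-homogeneous parts; \<open>y\<^sub>n \<Omega>\<^sub>u\<^sup>n\<close> has total parity one more than that of \<open>y\<^sub>n\<close>.\<close>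

definition mom_cur :: "(nat \<Rightarrow>\<^sub>0 'g::lie_superalgebra) \<Rightarrow> (nat \<Rightarrow> 'g) \<Rightarrow> (nat \<Rightarrow>\<^sub>0 'g)" where
  "mom_cur y x = - (\<Sum>p\<in>{0, 1}. \<Sum>q\<in>{0, 1}. koszul (p + 1) q *\<^sub>C
     cur_mom (\<lambda>m. parity_part q (x m)) (Poly_Mapping.map (parity_part p) y))"

definition mom_cur_central :: "(nat \<Rightarrow>\<^sub>0 'g::lie_superalgebra_form) \<Rightarrow> (nat \<Rightarrow> 'g) \<Rightarrow> complex" where
  "mom_cur_central y x = - (\<Sum>p\<in>{0, 1}. \<Sum>q\<in>{0, 1}. koszul (p + 1) q *
     cur_mom_central (\<lambda>m. parity_part q (x m)) (Poly_Mapping.map (parity_part p) y))"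

lemma homog_uminus: "(x::'g::lie_superalgebra) \<in> homog p \<Longrightarrow> - x \<in> homog p"
  using homog_scale[of x p "-1"] by simp

lemma homog_diff: "(x::'g::lie_superalgebra) \<in> homog p \<Longrightarrow> y \<in> homog p \<Longrightarrow> x - y \<in> homog p"
  using homog_add[of x p "- y"] homog_uminus[of y p] by simp

lemma homog_sum: "(\<And>i. i \<in> A \<Longrightarrow> f i \<in> homog p) \<Longrightarrow> sum f A \<in> homog p"
  for f :: "'i \<Rightarrow> 'g::lie_superalgebra"
  by (induction A rule: infinite_finite_induct) (auto intro: homog_zero homog_add)

lemma parity_part_unique:
  fixes x :: "'g::lie_superalgebra"
  assumes "y \<in> homog p" "x - y \<in> homog (p + 1)"
  shows "parity_part p x = y"
  unfolding parity_part_def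
proof (rule the_equality)
  fix z assume z: "z \<in> homog p \<and> x - z \<in> homog (p + 1)"
  have a: "z - y \<in> homog p" using z assms homog_diff by blast
  have "z - y = (x - y) - (x - z)" by simp
  hence b: "z - y \<in> homog (p + 1)" using z assms homog_diff by metis
  from a b have "z - y = 0" using homog_disjoint[of "z - y"] by (cases p) (simp_all del: right_minus_eq eq_iff_diff_eq_0)
  thus "z = y" by simp
qed (use assms in auto)

lemma parity_part_props:
  fixes x :: "'g::lie_superalgebra"
  shows "parity_part p x \<in> homog p" "x - parity_part p x \<in> homog (p + 1)"
proof -
  obtain y z where yz: "y \<in> homog 0" "z \<in> homog 1" "x = y + z" using homog_total by blast
  have "\<exists>w. w \<in> homog p \<and> x - w \<in> homog (p + 1)"
    using yz by (cases p) (force intro: exI[of _ y] exI[of _ z])+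
  then obtain w where w: "w \<in> homog p" "x - w \<in> homog (p + 1)" by blast
  with parity_part_unique[OF w] show "parity_part p x \<in> homog p" "x - parity_part p x \<in> homog (p + 1)"
    by auto
qed

lemma parity_part_add: "parity_part p (x + y) = parity_part p x + parity_part p (y::'g::lie_superalgebra)"
proof (rule parity_part_unique)
  have "x + y - (parity_part p x + parity_part p y) = (x - parity_part p x) + (y - parity_part p y)" by simp
  thus "x + y - (parity_part p x + parity_part p y) \<in> homog (p + 1)"
    by (metis homog_add parity_part_props(2))
qed (simp add: homog_add parity_part_props)

lemma parity_part_scale: "parity_part p (c *\<^sub>C x) = c *\<^sub>C parity_part p (x::'g::lie_superalgebra)"
proof (rule parity_part_unique)
  show "c *\<^sub>C x - c *\<^sub>C parity_part p x \<in> homog (p + 1)"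
    by (metis homog_scale parity_part_props(2) cvs.scale_right_diff_distrib)
qed (simp add: homog_scale parity_part_props)

lemma parity_part_homog: "(x::'g::lie_superalgebra) \<in> homog q \<Longrightarrow> parity_part p x = (if p = q then x else 0)"
  by (rule parity_part_unique) (cases p; cases q; auto simp: homog_zero)+

lemma parity_part_zero [simp]: "parity_part p (0::'g::lie_superalgebra) = 0"
  using parity_part_homog[OF homog_zero[of p], of p] by simp

lemma parity_part_sum: "parity_part 0 x + parity_part 1 x = (x::'g::lie_superalgebra)"
proof -
  have "x - parity_part 0 x = parity_part 1 x"
    by (rule sym, rule parity_part_unique) (use parity_part_props[where p = 0 and x = x] in auto)
  thus ?thesis by (metis add.commute diff_add_cancel)
qed

lemma bracket_zero_right [simp]: "bracket x (0::'g::lie_superalgebra) = 0"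
  using bracket_scale_right[of x 0 0] by simp
lemma bracket_zero_left [simp]: "bracket (0::'g::lie_superalgebra) x = 0"
  using bracket_scale_left[of 0 0 x] by simp
lemma form_zero_right [simp]: "form x (0::'g::lie_superalgebra_form) = 0"
  using form_scale_right[of x 0 0] by simp
lemma bracket_sum_left: "bracket (sum f A) (x::'g::lie_superalgebra) = (\<Sum>i\<in>A. bracket (f i) x)"
  by (induction A rule: infinite_finite_induct) (auto simp: bracket_add_left)
lemma bracket_sum_right: "bracket (x::'g::lie_superalgebra) (sum f A) = (\<Sum>i\<in>A. bracket x (f i))"
  by (induction A rule: infinite_finite_induct) (auto simp: bracket_add_right)
lemma form_zero_left [simp]: "form (0::'g::lie_superalgebra_form) x = 0"
  using form_scale_left[of 0 0 x] by simp
lemma form_sum_left: "form (sum f A) (x::'g::lie_superalgebra_form) = (\<Sum>i\<in>A. form (f i) x)"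
  by (induction A rule: infinite_finite_induct) (auto simp: form_add_left)

lemma cur_mom_superset:
  assumes "finite A" "Poly_Mapping.keys y \<subseteq> A"
  shows "cur_mom x y = (\<Sum>n\<in>A. \<Sum>m\<le>n. Poly_Mapping.single (n - m) (bracket (x m) (Poly_Mapping.lookup y n)))"
  unfolding cur_mom_def
  by (rule sum.mono_neutral_left) (use assms in \<open>auto simp: in_keys_iff\<close>)

lemma cur_mom_central_superset:
  assumes "finite A" "Poly_Mapping.keys y \<subseteq> A"
  shows "cur_mom_central x y = (\<Sum>n\<in>A. of_nat (n + 1) * form (x (n + 1)) (Poly_Mapping.lookup y n))"
  unfolding cur_mom_central_def
  by (rule sum.mono_neutral_left) (use assms in \<open>auto simp: in_keys_iff\<close>)

lemma cur_mom_add_right: "cur_mom x (y + z) = cur_mom x y + cur_mom x z"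
proof -
  let ?A = "Poly_Mapping.keys y \<union> Poly_Mapping.keys z"
  have "Poly_Mapping.keys (y + z) \<subseteq> ?A" by (rule Poly_Mapping.keys_add)
  thus ?thesis
    by (simp add: cur_mom_superset[of ?A] lookup_add bracket_add_right single_add sum.distrib)
qed

lemma cur_mom_central_add_right: "cur_mom_central x (y + z) = cur_mom_central x y + cur_mom_central x z"
proof -
  let ?A = "Poly_Mapping.keys y \<union> Poly_Mapping.keys z"
  have "Poly_Mapping.keys (y + z) \<subseteq> ?A" by (rule Poly_Mapping.keys_add)
  thus ?thesis
    by (simp add: cur_mom_central_superset[of ?A] lookup_add form_add_right algebra_simps sum.distrib)
qed

lemma cur_mom_add_left: "cur_mom (\<lambda>n. x n + y n) z = cur_mom x z + cur_mom y z"
  by (simp add: cur_mom_def bracket_add_left single_add sum.distrib)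

lemma cur_mom_central_add_left: "cur_mom_central (\<lambda>n. x n + y n) z = cur_mom_central x z + cur_mom_central y z"
  by (simp add: cur_mom_central_def form_add_left algebra_simps sum.distrib)

lemma single_scaleC: "Poly_Mapping.single k (c *\<^sub>C x) = c *\<^sub>C Poly_Mapping.single k (x::'g::complex_space)"
  by (simp add: poly_mapping_eq_iff fun_eq_iff lookup_single when_def)

lemma keys_scaleC: "Poly_Mapping.keys (c *\<^sub>C y) \<subseteq> Poly_Mapping.keys (y::'k \<Rightarrow>\<^sub>0 'g::complex_space)"
  by (auto simp: in_keys_iff)

lemma cur_mom_scale_right: "cur_mom x (c *\<^sub>C y) = c *\<^sub>C cur_mom x y"
  by (subst cur_mom_superset[OF finite_keys keys_scaleC])
    (simp add: bracket_scale_right single_scaleC cur_mom_def cvs.scale_sum_right)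

lemma cur_mom_scale_left: "cur_mom (\<lambda>n. c *\<^sub>C x n) y = c *\<^sub>C cur_mom x y"
  by (simp add: bracket_scale_left single_scaleC cur_mom_def cvs.scale_sum_right)

lemma cur_mom_central_scale_right: "cur_mom_central x (c *\<^sub>C y) = c * cur_mom_central x y"
  by (subst cur_mom_central_superset[OF finite_keys keys_scaleC])
    (simp add: form_scale_right cur_mom_central_def sum_distrib_left mult_ac)

lemma cur_mom_central_scale_left: "cur_mom_central (\<lambda>n. c *\<^sub>C x n) y = c * cur_mom_central x y"
  by (simp add: form_scale_left cur_mom_central_def sum_distrib_left mult_ac)

lemma lookup_cur_mom:
  assumes "finite A" "Poly_Mapping.keys y \<subseteq> A"
  shows "Poly_Mapping.lookup (cur_mom x y) k =
    (\<Sum>n\<in>A. if k \<le> n then bracket (x (n - k)) (Poly_Mapping.lookup y n) else 0)"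
proof -
  have "(\<Sum>m\<le>n. Poly_Mapping.lookup (Poly_Mapping.single (n - m) (bracket (x m) (Poly_Mapping.lookup y n))) k)
      = (if k \<le> n then bracket (x (n - k)) (Poly_Mapping.lookup y n) else 0)" for n
  proof -
    have "(\<Sum>m\<le>n. Poly_Mapping.lookup (Poly_Mapping.single (n - m) (bracket (x m) (Poly_Mapping.lookup y n))) k)
      = (\<Sum>m\<le>n. if m = n - k \<and> k \<le> n then bracket (x m) (Poly_Mapping.lookup y n) else 0)"
      by (rule sum.cong) (auto simp: lookup_single when_def)
    thus ?thesis by (auto simp: sum.delta)
  qed
  thus ?thesis by (simp add: cur_mom_superset[OF assms] lookup_sum)
qed

lemma cur_mom_single: "cur_mom x (Poly_Mapping.single n c) =
   (\<Sum>m\<le>n. Poly_Mapping.single (n - m) (bracket (x m) c))"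
  by (subst cur_mom_superset[of "{n}"]) (auto simp: lookup_single)

lemma cur_mom_central_single: "cur_mom_central x (Poly_Mapping.single n c) =
   of_nat (n + 1) * form (x (n + 1)) c"
  by (subst cur_mom_central_superset[of "{n}"]) (auto simp: lookup_single)

lemma cur_mom_zero_right [simp]: "cur_mom x 0 = 0" by (simp add: cur_mom_def)
lemma cur_mom_central_zero_right [simp]: "cur_mom_central x 0 = 0" by (simp add: cur_mom_central_def)
lemma cur_mom_zero_left [simp]: "cur_mom (\<lambda>n. 0) y = 0" by (simp add: cur_mom_def)
lemma cur_mom_central_zero_left [simp]: "cur_mom_central (\<lambda>n. 0) y = 0" by (simp add: cur_mom_central_def)

lemma cur_mom_sum_right: "cur_mom x (sum f A) = (\<Sum>i\<in>A. cur_mom x (f i))"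
  by (induction A rule: infinite_finite_induct) (auto simp: cur_mom_add_right)
lemma cur_mom_central_sum_right: "cur_mom_central x (sum f A) = (\<Sum>i\<in>A. cur_mom_central x (f i))"
  by (induction A rule: infinite_finite_induct) (auto simp: cur_mom_central_add_right)

lemma homog_poly_mapping_induct [consumes 1]:
  fixes P :: "(nat \<Rightarrow>\<^sub>0 'g::lie_superalgebra) \<Rightarrow> bool"
  assumes "\<And>n. Poly_Mapping.lookup y n \<in> homog r"
    and "P 0" "\<And>k x. x \<in> homog r \<Longrightarrow> P (Poly_Mapping.single k x)" "\<And>y z. P y \<Longrightarrow> P z \<Longrightarrow> P (y + z)"
  shows "P y"
proof -
  have s: "finite A \<Longrightarrow> P (\<Sum>k\<in>A. Poly_Mapping.single k (Poly_Mapping.lookup y k))" for A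
    by (induction A rule: finite_induct) (use assms in auto)
  have "y = (\<Sum>k\<in>Poly_Mapping.keys y. Poly_Mapping.single k (Poly_Mapping.lookup y k))"
    by (auto simp: poly_mapping_eq_iff fun_eq_iff lookup_sum lookup_single when_def in_keys_iff sum.delta)
  with s[OF finite_keys[of y]] show ?thesis by simp
qed

lemma homog_current:
  assumes "\<And>n. x n \<in> homog p" "\<And>n. y n \<in> homog q"
  shows "(\<Sum>i\<le>k. bracket (x i) (y (k - i))) \<in> homog (p + q)"
  using assms by (intro homog_sum bracket_homog)

lemma homog_cur_mom:
  assumes "\<And>n. x n \<in> homog p" "\<And>n. Poly_Mapping.lookup y n \<in> homog q"
  shows "Poly_Mapping.lookup (cur_mom x y) k \<in> homog (p + q)"
  unfolding lookup_cur_mom[OF finite_keys order_refl]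
  by (intro homog_sum) (metis assms bracket_homog homog_zero)

lemma cur_mom_jacobi:
  fixes x y :: "nat \<Rightarrow> 'g::lie_superalgebra"
  assumes x: "\<And>n. x n \<in> homog p" and y: "\<And>n. y n \<in> homog q" and z: "\<And>n. Poly_Mapping.lookup z n \<in> homog r"
  shows "cur_mom x (cur_mom y z) =
    cur_mom (\<lambda>k. \<Sum>i\<le>k. bracket (x i) (y (k - i))) z + koszul p q *\<^sub>C cur_mom y (cur_mom x z)"
  using z
proof (induction z rule: homog_poly_mapping_induct)
  case (2 n c)
  note c = 2
  let ?f = "\<lambda>i j. Poly_Mapping.single (n - (i + j)) (bracket (x i) (bracket (y j) c))"
  let ?g = "\<lambda>i j. Poly_Mapping.single (n - (i + j)) (bracket (y j) (bracket (x i) c))"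
  let ?h = "\<lambda>i j. Poly_Mapping.single (n - (i + j)) (bracket (bracket (x i) (y j)) c)"
  have 1: "cur_mom x (cur_mom y (Poly_Mapping.single n c)) = (\<Sum>k\<le>n. \<Sum>i\<le>k. ?f i (k - i))"
  proof -
    have "cur_mom x (cur_mom y (Poly_Mapping.single n c)) = (\<Sum>j\<le>n. \<Sum>i\<le>n - j. ?f i j)"
      by (simp add: cur_mom_single cur_mom_sum_right add.commute)
    also have "\<dots> = (\<Sum>(j,i)\<in>{(j,i). j + i \<le> n}. ?f i j)"
      by (subst sum.Sigma) (auto intro!: sum.cong)
    also have "\<dots> = (\<Sum>(i,j)\<in>{(i,j). i + j \<le> n}. ?f i j)"
      by (rule sum.reindex_bij_witness[of _ prod.swap prod.swap]) auto
    also have "\<dots> = (\<Sum>k\<le>n. \<Sum>i\<le>k. ?f i (k - i))" by (rule sum.triangle_reindex_eq)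
    finally show ?thesis .
  qed
  have 2: "cur_mom y (cur_mom x (Poly_Mapping.single n c)) = (\<Sum>k\<le>n. \<Sum>i\<le>k. ?g i (k - i))"
  proof -
    have "cur_mom y (cur_mom x (Poly_Mapping.single n c)) = (\<Sum>i\<le>n. \<Sum>j\<le>n - i. ?g i j)"
      by (simp add: cur_mom_single cur_mom_sum_right)
    also have "\<dots> = (\<Sum>(i,j)\<in>{(i,j). i + j \<le> n}. ?g i j)"
      by (subst sum.Sigma) (auto intro!: sum.cong)
    also have "\<dots> = (\<Sum>k\<le>n. \<Sum>i\<le>k. ?g i (k - i))" by (rule sum.triangle_reindex_eq)
    finally show ?thesis .
  qed
  have 3: "cur_mom (\<lambda>k. \<Sum>i\<le>k. bracket (x i) (y (k - i))) (Poly_Mapping.single n c) = (\<Sum>k\<le>n. \<Sum>i\<le>k. ?h i (k - i))"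
  proof -
    have ss: "Poly_Mapping.single k (sum f A) = (\<Sum>i\<in>A. Poly_Mapping.single k (f i))" for k and f :: "nat \<Rightarrow> 'g" and A
      by (induction A rule: infinite_finite_induct) (auto simp: single_add)
    show ?thesis by (simp add: cur_mom_single bracket_sum_left ss)
  qed
  show ?case unfolding 1 2 3 cvs.scale_sum_right
    by (simp flip: sum.distrib single_add single_scaleC add: bracket_jacobi[OF x y c])
next
  case (3 u v) thus ?case by (simp add: cur_mom_add_right scaleC_add_right algebra_simps)
qed simp

lemma cur_mom_central_cocycle:
  fixes x y :: "nat \<Rightarrow> 'g::lie_superalgebra_form"
  assumes x: "\<And>n. x n \<in> homog p" and y: "\<And>n. y n \<in> homog q" and z: "\<And>n. Poly_Mapping.lookup z n \<in> homog r"
  shows "cur_mom_central x (cur_mom y z) =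
    cur_mom_central (\<lambda>k. \<Sum>i\<le>k. bracket (x i) (y (k - i))) z + koszul p q * cur_mom_central y (cur_mom x z)"
  using z
proof (induction z rule: homog_poly_mapping_induct)
  case (2 n c)
  let ?h = "\<lambda>i. form (bracket (x i) (y (n + 1 - i))) c"
  have 1: "cur_mom_central x (cur_mom y (Poly_Mapping.single n c)) = (\<Sum>i\<le>n + 1. of_nat i * ?h i)"
  proof -
    have "cur_mom_central x (cur_mom y (Poly_Mapping.single n c))
        = (\<Sum>m\<le>n. of_nat (n - m + 1) * form (bracket (x (n - m + 1)) (y m)) c)"
      by (simp add: cur_mom_single cur_mom_central_single cur_mom_central_sum_right form_invariant)
    also have "\<dots> = (\<Sum>i\<in>{1..n+1}. of_nat i * ?h i)"
      by (rule sum.reindex_bij_witness[of _ "\<lambda>i. n + 1 - i" "\<lambda>m. n - m + 1"]) auto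
    also have "\<dots> = (\<Sum>i\<le>n + 1. of_nat i * ?h i)"
      by (rule sum.mono_neutral_left) (auto simp: not_le)
    finally show ?thesis .
  qed
  have 2: "koszul p q * cur_mom_central y (cur_mom x (Poly_Mapping.single n c)) = - (\<Sum>i\<le>n + 1. of_nat (n + 1 - i) * ?h i)"
  proof -
    have e: "koszul p q * form (bracket (y j) (x i)) c = - form (bracket (x i) (y j)) c" for i j
    proof -
      have "bracket (x i) (y j) = (- koszul p q) *\<^sub>C bracket (y j) (x i)"
        using bracket_skew[OF x y] by simp
      thus ?thesis using form_scale_left[of "- koszul p q" "bracket (y j) (x i)" c] by simp
    qed
    have "koszul p q * cur_mom_central y (cur_mom x (Poly_Mapping.single n c))
        = (\<Sum>i\<le>n. of_nat (n - i + 1) * (koszul p q * form (bracket (y (n - i + 1)) (x i)) c))"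
      by (simp add: cur_mom_single cur_mom_central_single cur_mom_central_sum_right form_invariant sum_distrib_left mult_ac)
    also have "\<dots> = (\<Sum>i\<le>n. of_nat (n - i + 1) * - form (bracket (x i) (y (n - i + 1))) c)"
      by (simp only: e)
    also have "\<dots> = (\<Sum>i\<le>n. of_nat (n + 1 - i) * - ?h i)"
      by (rule sum.cong) (auto simp: Suc_diff_le)
    also have "\<dots> = (\<Sum>i\<le>n + 1. of_nat (n + 1 - i) * - ?h i)"
      by simp
    finally show ?thesis by (simp add: sum_negf)
  qed
  have 3: "cur_mom_central (\<lambda>k. \<Sum>i\<le>k. bracket (x i) (y (k - i))) (Poly_Mapping.single n c)
     = (\<Sum>i\<le>n + 1. of_nat (n + 1) * ?h i)"
    by (simp add: cur_mom_central_single form_sum_left sum_distrib_left del: of_nat_add of_nat_Suc sum.atMost_Suc)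
  have "(\<Sum>i\<le>n + 1. of_nat i * ?h i) + (\<Sum>i\<le>n + 1. of_nat (n + 1 - i) * ?h i) = (\<Sum>i\<le>n + 1. of_nat (n + 1) * ?h i)"
    unfolding sum.distrib[symmetric]
    by (rule sum.cong) (auto simp: of_nat_diff algebra_simps)
  thus ?case unfolding 1 2 3 by (simp add: algebra_simps)
next
  case (3 u v) thus ?case by (simp add: cur_mom_central_add_right cur_mom_add_right algebra_simps)
qed simp

lemma mom_cur_homog:
  assumes "\<And>n. Poly_Mapping.lookup y n \<in> homog p" "\<And>n. x n \<in> homog q"
  shows "mom_cur y x = - (koszul (p + 1) q *\<^sub>C cur_mom x y)"
    "mom_cur_central y x = - (koszul (p + 1) q * cur_mom_central x y)"
proof -
  have 1: "Poly_Mapping.map (parity_part p') y = (if p' = p then y else 0)" for p'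
    by (simp add: poly_mapping_eq_iff fun_eq_iff Poly_Mapping.map.rep_eq when_def parity_part_homog[OF assms(1)])
  have 2: "(\<lambda>n. parity_part q' (x n)) = (if q' = q then x else (\<lambda>n. 0))" for q'
    by (auto simp: fun_eq_iff parity_part_homog[OF assms(2)])
  show "mom_cur y x = - (koszul (p + 1) q *\<^sub>C cur_mom x y)"
    "mom_cur_central y x = - (koszul (p + 1) q * cur_mom_central x y)"
    unfolding mom_cur_def mom_cur_central_def 1 2
    by (cases p; cases q; simp)+
qed

lemma map_parity_part_add: "Poly_Mapping.map (parity_part p) (y + z) = Poly_Mapping.map (parity_part p) y + Poly_Mapping.map (parity_part p) z"
  by (simp add: poly_mapping_eq_iff fun_eq_iff Poly_Mapping.map.rep_eq when_def lookup_add parity_part_add)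
     (metis add_cancel_left_left add_cancel_left_right parity_part_zero parity_part_add)

lemma map_parity_part_scale: "Poly_Mapping.map (parity_part p) (c *\<^sub>C y) = c *\<^sub>C Poly_Mapping.map (parity_part p) y"
  by (simp add: poly_mapping_eq_iff fun_eq_iff Poly_Mapping.map.rep_eq when_def parity_part_scale)

lemma mom_cur_add_left: "mom_cur (y + z) x = mom_cur y x + mom_cur z x"
  by (simp add: mom_cur_def map_parity_part_add cur_mom_add_right scaleC_add_right)
lemma mom_cur_add_right: "mom_cur y (\<lambda>n. x n + z n) = mom_cur y x + mom_cur y z"
  by (simp add: mom_cur_def parity_part_add cur_mom_add_left scaleC_add_right)
lemma mom_cur_scale_left: "mom_cur (c *\<^sub>C y) x = c *\<^sub>C mom_cur y x"
  by (simp add: mom_cur_def map_parity_part_scale cur_mom_scale_right scaleC_add_right scaleC_scaleC mult.commute cvs.scale_right_diff_distrib)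
lemma mom_cur_scale_right: "mom_cur y (\<lambda>n. c *\<^sub>C x n) = c *\<^sub>C mom_cur y x"
  by (simp add: mom_cur_def parity_part_scale cur_mom_scale_left scaleC_add_right scaleC_scaleC mult.commute cvs.scale_right_diff_distrib)
lemma mom_cur_central_add_left: "mom_cur_central (y + z) x = mom_cur_central y x + mom_cur_central z x"
  by (simp add: mom_cur_central_def map_parity_part_add cur_mom_central_add_right algebra_simps)
lemma mom_cur_central_add_right: "mom_cur_central y (\<lambda>n. x n + z n) = mom_cur_central y x + mom_cur_central y z"
  by (simp add: mom_cur_central_def parity_part_add cur_mom_central_add_left algebra_simps)
lemma mom_cur_central_scale_left: "mom_cur_central (c *\<^sub>C y) x = c * mom_cur_central y x"
  by (simp add: mom_cur_central_def map_parity_part_scale cur_mom_central_scale_right algebra_simps)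
lemma mom_cur_central_scale_right: "mom_cur_central y (\<lambda>n. c *\<^sub>C x n) = c * mom_cur_central y x"
  by (simp add: mom_cur_central_def parity_part_scale cur_mom_central_scale_left algebra_simps)

lemma mom_cur_zero_left [simp]: "mom_cur 0 x = 0" "mom_cur_central 0 x = 0"
  using mom_cur_scale_left[of 0 0 x] mom_cur_central_scale_left[of 0 0 x] by simp_all

lemma mom_cur_zero_right [simp]: "mom_cur y (\<lambda>n. 0) = 0" "mom_cur_central y (\<lambda>n. 0) = 0"
  using mom_cur_scale_right[of y 0 "\<lambda>n. 0"] mom_cur_central_scale_right[of y 0 "\<lambda>n. 0"] by simp_all

instantiation affine :: (lie_superalgebra_form) lie_superalgebra
begin

text \<open>The total parity: \<open>x u\<^sup>n\<close> has that of \<open>x\<close>, \<open>y \<Omega>\<^sub>u\<^sup>n\<close> the opposite of that of \<open>y\<close>, and \<open>\<kappa>\<close> is odd.\<close>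

definition homog_affine :: "bit \<Rightarrow> 'a affine set" where
  "homog p = {X. (\<forall>n. cur X n \<in> homog p) \<and> (\<forall>n. Poly_Mapping.lookup (mom X) n \<in> homog (p + 1)) \<and>
     (cen X \<noteq> 0 \<longrightarrow> p = 1)}"

definition bracket_affine :: "'a affine \<Rightarrow> 'a affine \<Rightarrow> 'a affine" where
  "bracket X Y = Affine
     (\<lambda>k. \<Sum>i\<le>k. bracket (cur X i) (cur Y (k - i)))
     (cur_mom (cur X) (mom Y) + mom_cur (mom X) (cur Y))
     (cur_mom_central (cur X) (mom Y) + mom_cur_central (mom X) (cur Y))"

lemma bracket_affine_homog:
  fixes X Y :: "'a affine"
  assumes X: "X \<in> homog p" and Y: "Y \<in> homog q"
  shows "bracket X Y = Affine (\<lambda>k. \<Sum>i\<le>k. bracket (cur X i) (cur Y (k - i)))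
     (cur_mom (cur X) (mom Y) - koszul p q *\<^sub>C cur_mom (cur Y) (mom X))
     (cur_mom_central (cur X) (mom Y) - koszul p q * cur_mom_central (cur Y) (mom X))"
proof -
  have "\<And>n. Poly_Mapping.lookup (mom X) n \<in> homog (p + 1)" "\<And>n. cur Y n \<in> homog q"
    using X Y by (auto simp: homog_affine_def)
  from mom_cur_homog[OF this] show ?thesis
    unfolding bracket_affine_def by (cases p; simp)
qed

instance
proof
  fix p q r :: bit and x y z :: "'a affine" and c :: complex
  show "0 \<in> (homog p :: 'a affine set)"
    by (simp add: homog_affine_def zero_affine_def homog_zero)
  show "x \<in> homog p \<Longrightarrow> y \<in> homog p \<Longrightarrow> x + y \<in> homog p"
    by (auto simp: homog_affine_def plus_affine_def homog_add lookup_add)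
  show "x \<in> homog p \<Longrightarrow> c *\<^sub>C x \<in> homog p"
    by (auto simp: homog_affine_def scaleC_affine_def homog_scale)
  show "x \<in> homog 0 \<Longrightarrow> x \<in> homog 1 \<Longrightarrow> x = 0"
    by (cases x) (auto simp: homog_affine_def zero_affine_def poly_mapping_eq_iff fun_eq_iff homog_disjoint)
  show "\<exists>y\<in>homog 0. \<exists>z\<in>homog 1. x = y + z"
  proof (intro bexI)
    let ?f = "\<lambda>p k. Affine (\<lambda>n. parity_part p (cur x n)) (Poly_Mapping.map (parity_part (p + 1)) (mom x)) k"
    have *: "Poly_Mapping.lookup (Poly_Mapping.map (parity_part p) y) n = parity_part p (Poly_Mapping.lookup y n)"
      for p and y :: "nat \<Rightarrow>\<^sub>0 'a" and n by (simp add: Poly_Mapping.map.rep_eq when_def)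
    show "x = ?f 0 0 + ?f 1 (cen x)"
      by (cases x) (simp add: plus_affine_def poly_mapping_eq_iff fun_eq_iff lookup_add * parity_part_sum add.commute[of "parity_part 1 _"])
    show "?f 0 0 \<in> homog 0" "?f 1 (cen x) \<in> homog 1"
      by (simp_all add: homog_affine_def * parity_part_props)
  qed
  show "bracket (x + y) z = bracket x z + bracket y z"
    by (simp add: bracket_affine_def plus_affine_def bracket_add_left sum.distrib cur_mom_add_left
        cur_mom_central_add_left mom_cur_add_left mom_cur_central_add_left)
  show "bracket x (y + z) = bracket x y + bracket x z"
    by (simp add: bracket_affine_def plus_affine_def bracket_add_right sum.distrib cur_mom_add_right
        cur_mom_central_add_right mom_cur_add_right mom_cur_central_add_right)
  show "bracket (c *\<^sub>C x) y = c *\<^sub>C bracket x y"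
    by (simp add: bracket_affine_def scaleC_affine_def bracket_scale_left cvs.scale_sum_right cur_mom_scale_left
        cur_mom_central_scale_left mom_cur_scale_left mom_cur_central_scale_left scaleC_add_right distrib_left)
  show "bracket x (c *\<^sub>C y) = c *\<^sub>C bracket x y"
    by (simp add: bracket_affine_def scaleC_affine_def bracket_scale_right cvs.scale_sum_right cur_mom_scale_right
        cur_mom_central_scale_right mom_cur_scale_right mom_cur_central_scale_right scaleC_add_right distrib_left)
  {
    fix x y :: "'a affine" and p q assume x: "x \<in> homog p" and y: "y \<in> homog q"
    note 1 = x[unfolded homog_affine_def] and 2 = y[unfolded homog_affine_def]
    have a: "cur_mom_central u v = 0" if "\<And>n. u n \<in> homog p" "\<And>n. Poly_Mapping.lookup v n \<in> homog q" "p \<noteq> q"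
      for u v and p q :: bit
      unfolding cur_mom_central_def by (rule sum.neutral) (use form_even[OF that] in auto)
    have b: "(p + 1) + q = p + q + 1" "p + (q + 1) = p + q + 1" "q + (p + 1) = p + q + 1" by (cases p; cases q; simp)+
    have c1: "Poly_Mapping.lookup (cur_mom (cur x) (mom y)) k \<in> homog (p + q + 1)" for k
      using homog_cur_mom[of "cur x" p "mom y" "q + 1" k] 1 2 b by auto
    have c2: "Poly_Mapping.lookup (cur_mom (cur y) (mom x)) k \<in> homog (p + q + 1)" for k
      using homog_cur_mom[of "cur y" q "mom x" "p + 1" k] 1 2 b by auto
    have c3: "(\<Sum>i\<le>k. bracket (cur x i) (cur y (k - i))) \<in> homog (p + q)" for k
      using homog_current[of "cur x" p "cur y" q k] 1 2 by auto
    have c4: "cur_mom_central (cur x) (mom y) = 0 \<and> cur_mom_central (cur y) (mom x) = 0" if "p + q = 0"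
      using a[of "cur x" p "mom y" "q + 1"] a[of "cur y" q "mom x" "p + 1"] 1 2 that
      by (cases p; cases q; auto)
    show "bracket x y \<in> homog (p + q)"
      unfolding bracket_affine_homog[OF x y] homog_affine_def
    proof (intro CollectI conjI allI impI, simp_all only: affine.sel lookup_minus lookup_scaleC)
      assume "cur_mom_central (cur x) (mom y) - koszul p q * cur_mom_central (cur y) (mom x) \<noteq> 0"
      with c4 show "p + q = 1" by (metis bit_not_one_iff diff_zero mult_zero_right)
    qed (intro homog_diff homog_scale c1 c2 c3)+
  } note homog_bracket = this
  {
    assume x: "x \<in> homog p" and y: "y \<in> homog q"
    have k: "koszul q p = koszul p q" "koszul p q * koszul p q = 1" by (auto simp: koszul_def)
    have s: "bracket (cur x i) (cur y j) = - (koszul p q *\<^sub>C bracket (cur y j) (cur x i))" for i j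
      by (rule bracket_skew) (use x y in \<open>auto simp: homog_affine_def\<close>)
    have "(\<Sum>i\<le>n. bracket (cur x i) (cur y (n - i))) = - (koszul p q *\<^sub>C (\<Sum>i\<le>n. bracket (cur y i) (cur x (n - i))))" for n
      unfolding s cvs.scale_sum_right sum_negf[symmetric]
      by (rule sum.reindex_bij_witness[of _ "\<lambda>i. n - i" "\<lambda>i. n - i"]) auto
    thus "bracket x y = - (koszul p q *\<^sub>C bracket y x)"
      unfolding bracket_affine_homog[OF x y] bracket_affine_homog[OF y x]
      by (simp add: uminus_affine_def scaleC_affine_def k cvs.scale_right_diff_distrib scaleC_scaleC scaleC_one algebra_simps)
  }
  {
    assume x: "x \<in> homog p" and y: "y \<in> homog q" and z: "z \<in> homog r"
    note H = x[unfolded homog_affine_def] y[unfolded homog_affine_def] z[unfolded homog_affine_def]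
    have cu: "cur (bracket u v) = (\<lambda>k. \<Sum>i\<le>k. bracket (cur u i) (cur v (k - i)))" for u v :: "'a affine"
      by (simp add: bracket_affine_def)
    have me: "mom (bracket u v) = cur_mom (cur u) (mom v) - koszul p q *\<^sub>C cur_mom (cur v) (mom u)"
      "cen (bracket u v) = cur_mom_central (cur u) (mom v) - koszul p q * cur_mom_central (cur v) (mom u)"
      if "u \<in> homog p" "v \<in> homog q" for u v :: "'a affine" and p q
      by (simp_all add: bracket_affine_homog[OF that])
    have dr: "cur_mom u (v - w) = cur_mom u v - cur_mom u w" "cur_mom_central u (v - w) = cur_mom_central u v - cur_mom_central u w"
      for u :: "nat \<Rightarrow> 'a" and v w
      using cur_mom_add_right[of u "v - w" w] cur_mom_central_add_right[of u "v - w" w] by (auto simp: algebra_simps)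
    have A: "cur_mom (cur (bracket u v)) (mom w) = cur_mom (cur u) (cur_mom (cur v) (mom w)) - koszul p q *\<^sub>C cur_mom (cur v) (cur_mom (cur u) (mom w))"
      if "u \<in> homog p" "v \<in> homog q" "w \<in> homog r" for u v w :: "'a affine" and p q r
      using cur_mom_jacobi[of "cur u" p "cur v" q "mom w" "r + 1"] that
      by (simp add: homog_affine_def cu)
    have B: "cur_mom_central (cur (bracket u v)) (mom w) = cur_mom_central (cur u) (cur_mom (cur v) (mom w)) - koszul p q * cur_mom_central (cur v) (cur_mom (cur u) (mom w))"
      if "u \<in> homog p" "v \<in> homog q" "w \<in> homog r" for u v w :: "'a affine" and p q r
      using cur_mom_central_cocycle[of "cur u" p "cur v" q "mom w" "r + 1"] that
      by (simp add: homog_affine_def cu)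
    have C: "cur (bracket x (bracket y z)) n = cur (bracket (bracket x y) z + koszul p q *\<^sub>C bracket y (bracket x z)) n" for n
    proof -
      have "(\<Sum>i\<le>n. bracket (cur x i) (\<Sum>j\<le>n - i. bracket (cur y j) (cur z (n - i - j))))
         = (\<Sum>i\<le>n. \<Sum>j\<le>n - i. bracket (bracket (cur x i) (cur y j)) (cur z (n - (i + j))) + koszul p q *\<^sub>C bracket (cur y j) (bracket (cur x i) (cur z (n - (i + j)))))"
        by (intro sum.cong refl) (use H in \<open>auto simp: bracket_sum_right intro!: sum.cong bracket_jacobi\<close>)
      also have "\<dots> = (\<Sum>i\<le>n. \<Sum>j\<le>n - i. bracket (bracket (cur x i) (cur y j)) (cur z (n - (i + j))))
         + koszul p q *\<^sub>C (\<Sum>i\<le>n. \<Sum>j\<le>n - i. bracket (cur y j) (bracket (cur x i) (cur z (n - (i + j)))))"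
        by (simp add: sum.distrib cvs.scale_sum_right)
      also have "(\<Sum>i\<le>n. \<Sum>j\<le>n - i. bracket (bracket (cur x i) (cur y j)) (cur z (n - (i + j))))
         = (\<Sum>(i,j)\<in>{(i,j). i + j \<le> n}. bracket (bracket (cur x i) (cur y j)) (cur z (n - (i + j))))"
        by (subst sum.Sigma) (auto intro!: sum.cong)
      also have "\<dots> = (\<Sum>k\<le>n. \<Sum>i\<le>k. bracket (bracket (cur x i) (cur y (k - i))) (cur z (n - k)))"
        by (subst sum.triangle_reindex_eq) (auto intro!: sum.cong)
      also have "\<dots> = (\<Sum>k\<le>n. bracket (\<Sum>i\<le>k. bracket (cur x i) (cur y (k - i))) (cur z (n - k)))"
        by (simp add: bracket_sum_left)
      also have "(\<Sum>i\<le>n. \<Sum>j\<le>n - i. bracket (cur y j) (bracket (cur x i) (cur z (n - (i + j)))))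
         = (\<Sum>j\<le>n. \<Sum>i\<le>n - j. bracket (cur y j) (bracket (cur x i) (cur z (n - (i + j)))))"
      proof -
        have "(\<Sum>i\<le>n. \<Sum>j\<le>n - i. bracket (cur y j) (bracket (cur x i) (cur z (n - (i + j)))))
          = (\<Sum>(i,j)\<in>{(i,j). i + j \<le> n}. bracket (cur y j) (bracket (cur x i) (cur z (n - (i + j)))))"
          by (subst sum.Sigma) (auto intro!: sum.cong)
        also have "\<dots> = (\<Sum>(j,i)\<in>{(j,i). j + i \<le> n}. bracket (cur y j) (bracket (cur x i) (cur z (n - (i + j)))))"
          by (rule sum.reindex_bij_witness[of _ prod.swap prod.swap]) auto
        also have "\<dots> = (\<Sum>j\<le>n. \<Sum>i\<le>n - j. bracket (cur y j) (bracket (cur x i) (cur z (n - (i + j)))))"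
          by (subst sum.Sigma) (auto intro!: sum.cong)
        finally show ?thesis .
      qed
      finally show ?thesis
        by (simp add: cu plus_affine_def scaleC_affine_def bracket_sum_right add.commute)
    qed
    have bh: "bracket x y \<in> homog (p + q)" "bracket y z \<in> homog (q + r)" "bracket x z \<in> homog (p + r)"
      using homog_bracket x y z by auto
    have D: "mom (bracket x (bracket y z)) = mom (bracket (bracket x y) z + koszul p q *\<^sub>C bracket y (bracket x z))"
      by (simp only: plus_affine_def scaleC_affine_def affine.sel me[OF x bh(2)] me[OF bh(1) z] me[OF y bh(3)]
          me[OF x y] me[OF y z] me[OF x z] A[OF x y z] A[OF y z x] A[OF x z y] dr cur_mom_scale_right)
        (cases p; cases q; cases r; simp add: koszul_def scaleC_one)
    have E: "cen (bracket x (bracket y z)) = cen (bracket (bracket x y) z + koszul p q *\<^sub>C bracket y (bracket x z))"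
      by (simp only: plus_affine_def scaleC_affine_def affine.sel me[OF x bh(2)] me[OF bh(1) z] me[OF y bh(3)]
          me[OF x y] me[OF y z] me[OF x z] B[OF x y z] B[OF y z x] B[OF x z y] dr cur_mom_central_scale_right)
        (cases p; cases q; cases r; simp add: koszul_def)
    show "bracket x (bracket y z) = bracket (bracket x y) z + koszul p q *\<^sub>C bracket y (bracket x z)"
      using C D E by (intro affine.expand) auto
  }
qed

end

definition current :: "'g::lie_superalgebra_form \<Rightarrow> nat \<Rightarrow> 'g affine" where
  "current x n = Affine (\<lambda>k. if k = n then x else 0) 0 0"

definition momentum :: "'g::lie_superalgebra_form \<Rightarrow> nat \<Rightarrow> 'g affine" where
  "momentum x n = Affine (\<lambda>k. 0) (Poly_Mapping.single n x) 0"

definition kappa :: "'g::lie_superalgebra_form affine" where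
  "kappa = Affine (\<lambda>k. 0) 0 1"

lemma bracket_current_current: "bracket (current x m) (current y n) = current (bracket x y) (m + n)"
proof -
  have "(\<Sum>i\<le>k. bracket (if i = m then x else 0) (if k - i = n then y else 0))
      = (if k = m + n then bracket x y else 0)" for k
  proof -
    have "(\<Sum>i\<le>k. bracket (if i = m then x else 0) (if k - i = n then y else 0))
        = (\<Sum>i\<le>k. if i = m then (if k = m + n then bracket x y else 0) else 0)"
      by (rule sum.cong) auto
    thus ?thesis by (auto simp: sum.delta)
  qed
  thus ?thesis
    by (simp add: bracket_affine_def current_def)
qed

lemma bracket_current_momentum:
  "bracket (current x m) (momentum y n) =
     (if m \<le> n then momentum (bracket x y) (n - m)
      else if m = n + 1 then (of_nat m * form x y) *\<^sub>C kappa else 0)"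
proof -
  have "(\<Sum>k\<le>n. Poly_Mapping.single (n - k) (bracket (if k = m then x else 0) y))
      = (if m \<le> n then Poly_Mapping.single (n - m) (bracket x y) else 0)"
  proof -
    have "(\<Sum>k\<le>n. Poly_Mapping.single (n - k) (bracket (if k = m then x else 0) y))
        = (\<Sum>k\<le>n. if k = m then Poly_Mapping.single (n - m) (bracket x y) else 0)"
      by (rule sum.cong) auto
    thus ?thesis by (auto simp: sum.delta)
  qed
  thus ?thesis
    by (auto simp: bracket_affine_def current_def momentum_def kappa_def zero_affine_def scaleC_affine_def
        cur_mom_single cur_mom_central_single)
qed

lemma bracket_momentum_momentum: "bracket (momentum x m) (momentum y n) = 0"
  by (simp add: bracket_affine_def momentum_def zero_affine_def)

lemma bracket_kappa: "bracket kappa X = 0" "bracket X kappa = 0"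
  by (simp_all add: bracket_affine_def kappa_def zero_affine_def)

definition affine_deriv :: "'g::lie_superalgebra_form affine \<Rightarrow> 'g affine" where
  "affine_deriv X = Affine
     (\<lambda>n. - (of_nat (n + 1) *\<^sub>C cur X (n + 1)))
     (\<Sum>n\<in>Poly_Mapping.keys (mom X).
        Poly_Mapping.single (n + 1) (of_nat (n + 1) *\<^sub>C Poly_Mapping.lookup (mom X) n))
     0"


section \<open>Universal enveloping algebras\<close>

text \<open>The free associative algebra on a set is the monoid algebra of its free monoid.\<close>

datatype 'l word = Word (letters: "'l list")

instantiation word :: (type) monoid_add
begin
definition "0 = Word []"
definition "v + w = Word (letters v @ letters w)"
instance by standard (auto simp: zero_word_def plus_word_def)
end

definition free_gen :: "'l \<Rightarrow> ('l word \<Rightarrow>\<^sub>0 complex)" where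
  "free_gen x = Poly_Mapping.single (Word [x]) 1"

lemma scaleC_free: "c *\<^sub>C f = Poly_Mapping.single 0 c * f" for f :: "'l word \<Rightarrow>\<^sub>0 complex"
  unfolding mult_map_scale_conv_mult[symmetric] scaleC_poly_mapping_def
  by (rule arg_cong[where f = "\<lambda>g. Poly_Mapping.map g f"]) (simp add: fun_eq_iff scaleC_complex_def)

lemma free_scaleC: "a * (c *\<^sub>C b) = c *\<^sub>C (a * b)" for a b :: "'l word \<Rightarrow>\<^sub>0 complex"
proof -
  have "a = (\<Sum>k\<in>Poly_Mapping.keys a. Poly_Mapping.single k (Poly_Mapping.lookup a k))"
    by (auto simp: poly_mapping_eq_iff fun_eq_iff lookup_sum lookup_single when_def in_keys_iff sum.delta)
  moreover have "(\<Sum>k\<in>A. Poly_Mapping.single k (f k)) * Poly_Mapping.single 0 c =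
      Poly_Mapping.single 0 c * (\<Sum>k\<in>A. Poly_Mapping.single k (f k))" for A and f :: "'l word \<Rightarrow> complex"
    by (simp add: sum_distrib_left sum_distrib_right mult_single mult.commute)
  ultimately have "a * Poly_Mapping.single 0 c = Poly_Mapping.single 0 c * a"
    by metis
  hence "a * Poly_Mapping.single 0 c * b = Poly_Mapping.single 0 c * a * b"
    by simp
  thus ?thesis by (simp add: scaleC_free mult.assoc)
qed

inductive_set uea_ideal :: "('l::lie_superalgebra word \<Rightarrow>\<^sub>0 complex) set" where
  add: "free_gen (x + y) - free_gen x - free_gen y \<in> uea_ideal"
| scale: "free_gen (c *\<^sub>C x) - c *\<^sub>C free_gen x \<in> uea_ideal"
| bracket: "x \<in> homog p \<Longrightarrow> y \<in> homog q \<Longrightarrow>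
    free_gen x * free_gen y - koszul p q *\<^sub>C (free_gen y * free_gen x) - free_gen (bracket x y)
      \<in> uea_ideal"
| plus: "a \<in> uea_ideal \<Longrightarrow> b \<in> uea_ideal \<Longrightarrow> a + b \<in> uea_ideal"
| mult: "a \<in> uea_ideal \<Longrightarrow> u * a * v \<in> uea_ideal"

lemma uea_ideal_mult_left: "a \<in> uea_ideal \<Longrightarrow> u * a \<in> uea_ideal"
  using uea_ideal.mult[of a u 1] by simp

lemma uea_ideal_mult_right: "a \<in> uea_ideal \<Longrightarrow> a * v \<in> uea_ideal"
  using uea_ideal.mult[of a 1 v] by simp

lemma uea_ideal_zero: "0 \<in> uea_ideal"
  using uea_ideal_mult_left[OF uea_ideal.add, of 0] by simp

lemma uea_ideal_uminus: "a \<in> uea_ideal \<Longrightarrow> - a \<in> uea_ideal"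
  using uea_ideal_mult_left[of a "- 1"] by simp

lemma uea_ideal_scale: "a \<in> uea_ideal \<Longrightarrow> c *\<^sub>C a \<in> uea_ideal"
  by (simp add: scaleC_free uea_ideal_mult_left)

definition uea_eq :: "('l::lie_superalgebra word \<Rightarrow>\<^sub>0 complex) \<Rightarrow> ('l word \<Rightarrow>\<^sub>0 complex) \<Rightarrow> bool" where
  "uea_eq a b \<longleftrightarrow> a - b \<in> uea_ideal"

lemma uea_eq_equivp: "equivp uea_eq"
proof (rule equivpI)
  show "reflp uea_eq" by (simp add: reflp_def uea_eq_def uea_ideal_zero)
  show "symp uea_eq"
    unfolding symp_def uea_eq_def using uea_ideal_uminus by fastforce
  show "transp uea_eq"
    unfolding transp_def uea_eq_def
  proof (intro allI impI)
    fix a b c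
    assume "a - b \<in> uea_ideal" "b - c \<in> uea_ideal"
    hence "(a - b) + (b - c) \<in> uea_ideal" by (rule uea_ideal.plus)
    thus "a - c \<in> uea_ideal" by simp
  qed
qed

quotient_type (overloaded) 'l uea = "'l::lie_superalgebra word \<Rightarrow>\<^sub>0 complex" / uea_eq
  by (rule uea_eq_equivp)

instantiation uea :: (lie_superalgebra) complex_algebra
begin

lift_definition zero_uea :: "'a uea" is 0 .
lift_definition one_uea :: "'a uea" is 1 .
lift_definition plus_uea :: "'a uea \<Rightarrow> 'a uea \<Rightarrow> 'a uea" is "(+)"
proof -
  fix a a' b b' :: "'a word \<Rightarrow>\<^sub>0 complex"
  assume "uea_eq a a'" "uea_eq b b'"
  hence "(a - a') + (b - b') \<in> uea_ideal" unfolding uea_eq_def by (rule uea_ideal.plus)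
  thus "uea_eq (a + b) (a' + b')" by (simp add: uea_eq_def algebra_simps)
qed
lift_definition uminus_uea :: "'a uea \<Rightarrow> 'a uea" is uminus
proof -
  fix a a' :: "'a word \<Rightarrow>\<^sub>0 complex"
  assume "uea_eq a a'"
  hence "- (a - a') \<in> uea_ideal" unfolding uea_eq_def by (rule uea_ideal_uminus)
  thus "uea_eq (- a) (- a')" by (simp add: uea_eq_def)
qed
lift_definition minus_uea :: "'a uea \<Rightarrow> 'a uea \<Rightarrow> 'a uea" is "(-)"
proof -
  fix a a' b b' :: "'a word \<Rightarrow>\<^sub>0 complex"
  assume "uea_eq a a'" "uea_eq b b'"
  hence "(a - a') + - (b - b') \<in> uea_ideal" unfolding uea_eq_def by (intro uea_ideal.plus uea_ideal_uminus)
  thus "uea_eq (a - b) (a' - b')" by (simp add: uea_eq_def algebra_simps)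
qed
lift_definition times_uea :: "'a uea \<Rightarrow> 'a uea \<Rightarrow> 'a uea" is "(*)"
proof -
  fix a a' b b' :: "'a word \<Rightarrow>\<^sub>0 complex"
  assume "uea_eq a a'" "uea_eq b b'"
  hence "(a - a') * b + a' * (b - b') \<in> uea_ideal"
    unfolding uea_eq_def by (intro uea_ideal.plus uea_ideal_mult_left uea_ideal_mult_right)
  thus "uea_eq (a * b) (a' * b')" by (simp add: uea_eq_def algebra_simps)
qed
lift_definition scaleC_uea :: "complex \<Rightarrow> 'a uea \<Rightarrow> 'a uea" is "(*\<^sub>C)"
  unfolding uea_eq_def cvs.scale_right_diff_distrib[symmetric] by (rule uea_ideal_scale)

instance
proof
  fix a b c :: "'a uea" and r s :: complex
  show "r *\<^sub>C (a + b) = r *\<^sub>C a + r *\<^sub>C b"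
    by transfer (simp add: scaleC_add_right uea_eq_def uea_ideal_zero)
  show "(r + s) *\<^sub>C a = r *\<^sub>C a + s *\<^sub>C a"
    by transfer (simp add: scaleC_add_left uea_eq_def uea_ideal_zero)
  show "r *\<^sub>C s *\<^sub>C a = (r * s) *\<^sub>C a"
    by transfer (simp add: scaleC_scaleC uea_eq_def uea_ideal_zero)
  show "1 *\<^sub>C a = a"
    by transfer (simp add: scaleC_one uea_eq_def uea_ideal_zero)
  show "a + b + c = a + (b + c)" "a * b * c = a * (b * c)" "a + b = b + a" "0 + a = a"
    "1 * a = a" "a * 1 = a" "- a + a = 0" "a - b = a + - b"
    "(a + b) * c = a * c + b * c" "a * (b + c) = a * b + a * c"
    by (transfer; simp add: uea_eq_def uea_ideal_zero algebra_simps)+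
  show "r *\<^sub>C a * b = r *\<^sub>C (a * b)"
    by transfer (simp add: scaleC_free uea_eq_def uea_ideal_zero mult.assoc)
  show "a * r *\<^sub>C b = r *\<^sub>C (a * b)"
    by transfer (simp add: free_scaleC uea_eq_def uea_ideal_zero)
qed

end

lift_definition uea_gen :: "'l::lie_superalgebra \<Rightarrow> 'l uea" is free_gen .


section \<open>The algebra \<open>\<complex>[\<kappa>]\<close>\<close>

text \<open>\<open>CK a b\<close> is \<open>a + b \<kappa>\<close> with \<open>\<kappa>\<^sup>2 = 0\<close>.\<close>

datatype ckappa = CK (ck0: complex) (ck1: complex)

instantiation ckappa :: complex_algebra
begin
definition "0 = CK 0 0"
definition "1 = CK 1 0"
definition "s + t = CK (ck0 s + ck0 t) (ck1 s + ck1 t)"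
definition "- s = CK (- ck0 s) (- ck1 s)"
definition "s - t = CK (ck0 s - ck0 t) (ck1 s - ck1 t)"
definition "s * t = CK (ck0 s * ck0 t) (ck0 s * ck1 t + ck1 s * ck0 t)"
definition "c *\<^sub>C s = CK (c * ck0 s) (c * ck1 s)"
instance
  by standard
    (simp_all add: zero_ckappa_def one_ckappa_def plus_ckappa_def uminus_ckappa_def minus_ckappa_def
      times_ckappa_def scaleC_ckappa_def algebra_simps)
end

definition ckappa_deg :: "int \<Rightarrow> bit \<Rightarrow> ckappa set" where
  "ckappa_deg d p =
     (if p = 0 \<and> d = 0 then {CK c 0 |c. True} else if p = 0 \<and> d = 1 then {CK 0 c |c. True} else {0})"


section \<open>The induced module\<close>

text \<open>\<open>U \<otimes> \<complex>[\<kappa>]\<close> over the enveloping algebra of the nonnegative part: formal combinations of pairs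
  \<open>u \<otimes> m\<close> modulo the relations below. The nonnegative part \<open>\<gg>[[u]] \<oplus> \<complex>\<kappa>\<close> consists of the \<open>X\<close> with
  \<open>mom X = 0\<close>, and acts on \<open>\<complex>[\<kappa>]\<close> through \<open>cen X \<cdot> \<kappa>\<close>; as it generates its enveloping algebra,
  balancing over its elements suffices.\<close>

abbreviation pure :: "'g::lie_superalgebra_form affine uea \<Rightarrow> ckappa \<Rightarrow> ('g affine uea \<times> ckappa) \<Rightarrow>\<^sub>0 complex" where
  "pure u m \<equiv> Poly_Mapping.single (u, m) 1"

inductive_set tensor_relators :: "(('g::lie_superalgebra_form affine uea \<times> ckappa) \<Rightarrow>\<^sub>0 complex) set" where
  "pure (u + u') m - pure u m - pure u' m \<in> tensor_relators"
| "pure u (m + m') - pure u m - pure u m' \<in> tensor_relators"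
| "pure (c *\<^sub>C u) m - c *\<^sub>C pure u m \<in> tensor_relators"
| "pure u (c *\<^sub>C m) - c *\<^sub>C pure u m \<in> tensor_relators"
| "mom X = 0 \<Longrightarrow> pure (u * uea_gen X) m - pure u (CK 0 (cen X) * m) \<in> tensor_relators"

definition tensor_eq :: "(('g::lie_superalgebra_form affine uea \<times> ckappa) \<Rightarrow>\<^sub>0 complex) \<Rightarrow>
    (('g affine uea \<times> ckappa) \<Rightarrow>\<^sub>0 complex) \<Rightarrow> bool" where
  "tensor_eq f g \<longleftrightarrow> f - g \<in> cvs.span tensor_relators"

lemma tensor_eq_equivp: "equivp tensor_eq"
proof (rule equivpI)
  show "reflp tensor_eq" by (simp add: reflp_def tensor_eq_def cvs.span_zero)
  show "symp tensor_eq"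
    unfolding symp_def tensor_eq_def using cvs.span_neg by fastforce
  show "transp tensor_eq"
    unfolding transp_def tensor_eq_def
  proof (intro allI impI)
    fix a b c
    assume "a - b \<in> cvs.span tensor_relators" "b - c \<in> cvs.span tensor_relators"
    hence "(a - b) + (b - c) \<in> cvs.span tensor_relators" by (rule cvs.span_add)
    thus "a - c \<in> cvs.span tensor_relators" by simp
  qed
qed

quotient_type (overloaded) 'g vuniv =
    "('g::lie_superalgebra_form affine uea \<times> ckappa) \<Rightarrow>\<^sub>0 complex" / tensor_eq
  by (rule tensor_eq_equivp)

instantiation vuniv :: (lie_superalgebra_form) complex_space
begin

lift_definition zero_vuniv :: "'a vuniv" is 0 .
lift_definition plus_vuniv :: "'a vuniv \<Rightarrow> 'a vuniv \<Rightarrow> 'a vuniv" is "(+)"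
proof -
  fix a a' b b' :: "('a affine uea \<times> ckappa) \<Rightarrow>\<^sub>0 complex"
  assume "tensor_eq a a'" "tensor_eq b b'"
  hence "(a - a') + (b - b') \<in> cvs.span tensor_relators" unfolding tensor_eq_def by (rule cvs.span_add)
  thus "tensor_eq (a + b) (a' + b')" by (simp add: tensor_eq_def algebra_simps)
qed
lift_definition uminus_vuniv :: "'a vuniv \<Rightarrow> 'a vuniv" is uminus
proof -
  fix a a' :: "('a affine uea \<times> ckappa) \<Rightarrow>\<^sub>0 complex"
  assume "tensor_eq a a'"
  hence "- (a - a') \<in> cvs.span tensor_relators" unfolding tensor_eq_def by (rule cvs.span_neg)
  thus "tensor_eq (- a) (- a')" by (simp add: tensor_eq_def)
qed
lift_definition minus_vuniv :: "'a vuniv \<Rightarrow> 'a vuniv \<Rightarrow> 'a vuniv" is "(-)"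
proof -
  fix a a' b b' :: "('a affine uea \<times> ckappa) \<Rightarrow>\<^sub>0 complex"
  assume "tensor_eq a a'" "tensor_eq b b'"
  hence "(a - a') + - (b - b') \<in> cvs.span tensor_relators" unfolding tensor_eq_def by (intro cvs.span_add cvs.span_neg)
  thus "tensor_eq (a - b) (a' - b')" by (simp add: tensor_eq_def algebra_simps)
qed
lift_definition scaleC_vuniv :: "complex \<Rightarrow> 'a vuniv \<Rightarrow> 'a vuniv" is "(*\<^sub>C)"
  unfolding tensor_eq_def cvs.scale_right_diff_distrib[symmetric] by (rule cvs.span_scale)

instance
proof
  fix a b c :: "'a vuniv" and r s :: complex
  show "r *\<^sub>C (a + b) = r *\<^sub>C a + r *\<^sub>C b" "(r + s) *\<^sub>C a = r *\<^sub>C a + s *\<^sub>C a"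
    "r *\<^sub>C s *\<^sub>C a = (r * s) *\<^sub>C a" "1 *\<^sub>C a = a" "a + b + c = a + (b + c)" "a + b = b + a" "0 + a = a"
    "- a + a = 0" "a - b = a + - b"
    by (transfer; simp add: tensor_eq_def cvs.span_zero scaleC_add_right scaleC_add_left scaleC_scaleC
        scaleC_one algebra_simps)+
qed

end

definition tensor_lmult :: "'g::lie_superalgebra_form affine uea \<Rightarrow>
    (('g affine uea \<times> ckappa) \<Rightarrow>\<^sub>0 complex) \<Rightarrow> (('g affine uea \<times> ckappa) \<Rightarrow>\<^sub>0 complex)" where
  "tensor_lmult u f =
     (\<Sum>(w, m)\<in>Poly_Mapping.keys f. Poly_Mapping.lookup f (w, m) *\<^sub>C pure (u * w) m)"

lemma tensor_lmult_superset:
  assumes "finite A" "Poly_Mapping.keys f \<subseteq> A"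
  shows "tensor_lmult u f = (\<Sum>(w, m)\<in>A. Poly_Mapping.lookup f (w, m) *\<^sub>C pure (u * w) m)"
  unfolding tensor_lmult_def
  by (rule sum.mono_neutral_left) (use assms in \<open>auto simp: in_keys_iff\<close>)

lemma tensor_lmult_add: "tensor_lmult u (f + g) = tensor_lmult u f + tensor_lmult u g"
proof -
  let ?A = "Poly_Mapping.keys f \<union> Poly_Mapping.keys g"
  have "Poly_Mapping.keys (f + g) \<subseteq> ?A" by (rule Poly_Mapping.keys_add)
  thus ?thesis
    by (simp add: tensor_lmult_superset[of ?A] lookup_add scaleC_add_left sum.distrib case_prod_unfold)
qed

lemma tensor_lmult_scale: "tensor_lmult u (c *\<^sub>C f) = c *\<^sub>C tensor_lmult u f"
  by (subst tensor_lmult_superset[OF finite_keys keys_scaleC])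
    (simp add: tensor_lmult_def cvs.scale_sum_right scaleC_scaleC scaleC_complex_def case_prod_unfold)

lemma tensor_lmult_diff: "tensor_lmult u (f - g) = tensor_lmult u f - tensor_lmult u g"
  using tensor_lmult_add[of u "f - g" g] by (simp add: algebra_simps)

lemma tensor_lmult_pure: "tensor_lmult u (pure w m) = pure (u * w) m"
  by (simp add: tensor_lmult_def scaleC_one)

lemma tensor_lmult_relators:
  assumes "f \<in> tensor_relators"
  shows "tensor_lmult u f \<in> tensor_relators"
  using assms
proof cases
  case (1 w w' m)
  show ?thesis
    unfolding 1 tensor_lmult_diff tensor_lmult_pure distrib_left by (rule tensor_relators.intros)
next
  case (2 w m m')
  show ?thesis
    unfolding 2 tensor_lmult_diff tensor_lmult_pure by (rule tensor_relators.intros)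
next
  case (3 c w m)
  show ?thesis
    unfolding 3 tensor_lmult_diff tensor_lmult_scale tensor_lmult_pure scaleC_mult_right
    by (rule tensor_relators.intros)
next
  case (4 w c m)
  show ?thesis
    unfolding 4 tensor_lmult_diff tensor_lmult_scale tensor_lmult_pure by (rule tensor_relators.intros)
next
  case (5 X w m)
  show ?thesis
    unfolding 5 tensor_lmult_diff tensor_lmult_pure mult.assoc[symmetric]
    by (rule tensor_relators.intros) (rule 5)
qed

lemma tensor_lmult_span:
  assumes "f \<in> cvs.span tensor_relators"
  shows "tensor_lmult u f \<in> cvs.span tensor_relators"
  using assms
proof (induction rule: cvs.span_induct_alt)
  case base
  show ?case by (simp add: tensor_lmult_def cvs.span_zero)
next
  case (step c x y)
  show ?case
    unfolding tensor_lmult_add tensor_lmult_scale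
    by (intro cvs.span_add cvs.span_scale cvs.span_base tensor_lmult_relators step)
qed

lift_definition uea_act :: "'g::lie_superalgebra_form affine uea \<Rightarrow> 'g vuniv \<Rightarrow> 'g vuniv" is tensor_lmult
  unfolding tensor_eq_def tensor_lmult_diff[symmetric] by (rule tensor_lmult_span)

lift_definition tensor :: "'g::lie_superalgebra_form affine uea \<Rightarrow> ckappa \<Rightarrow> 'g vuniv" is
  "\<lambda>u m. pure u m" .

definition affine_act :: "'g::lie_superalgebra_form affine \<Rightarrow> 'g vuniv \<Rightarrow> 'g vuniv" where
  "affine_act X = uea_act (uea_gen X)"

definition vac :: "'g::lie_superalgebra_form vuniv" where
  "vac = tensor 1 1"

text \<open>\<open>\<kappa> \<in> \<complex>[\<kappa>]\<close> acts on the induced module as the central element.\<close>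

definition ckappa_act :: "ckappa \<Rightarrow> 'g::lie_superalgebra_form vuniv \<Rightarrow> 'g vuniv" where
  "ckappa_act s v = ck0 s *\<^sub>C v + ck1 s *\<^sub>C affine_act kappa v"

text \<open>The operator on the induced module that is induced by the derivation; the vacuum generates, so
  there is at most one.\<close>

definition is_translation :: "('g::lie_superalgebra_form vuniv \<Rightarrow> 'g vuniv) \<Rightarrow> bool" where
  "is_translation D \<longleftrightarrow>
     (\<forall>v w. D (v + w) = D v + D w) \<and> (\<forall>c v. D (c *\<^sub>C v) = c *\<^sub>C D v) \<and>
     D vac = 0 \<and>
     (\<forall>X v. D (affine_act X v) = affine_act (affine_deriv X) v + affine_act X (D v))"

text \<open>\<open>monomial d p s v\<close>: \<open>v\<close> is a monomial in the generators applied to the vacuum, of cohomological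
  degree \<open>d\<close>, super parity \<open>p\<close> and spin \<open>s\<close>.\<close>

inductive monomial :: "int \<Rightarrow> bit \<Rightarrow> int \<Rightarrow> 'g::lie_superalgebra_form vuniv \<Rightarrow> bool" where
  "monomial 0 0 0 vac"
| "x \<in> homog q \<Longrightarrow> monomial d p s v \<Longrightarrow>
    monomial d (q + p) (s - int n) (affine_act (current x n) v)"
| "x \<in> homog q \<Longrightarrow> monomial d p s v \<Longrightarrow>
    monomial (d + 1) (q + p) (s + int n + 1) (affine_act (momentum x n) v)"
| "monomial d p s v \<Longrightarrow> monomial (d + 1) p s (affine_act kappa v)"

definition vuniv_deg :: "int \<Rightarrow> bit \<Rightarrow> 'g::lie_superalgebra_form vuniv set" where
  "vuniv_deg d p = cvs.span {v. \<exists>s. monomial d p s v}"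

definition vuniv_spin :: "int \<Rightarrow> 'g::lie_superalgebra_form vuniv set" where
  "vuniv_spin s = cvs.span {v. \<exists>d p. monomial d p s v}"


section \<open>Raviolo fields\<close>

text \<open>\<open>Zp n\<close> and \<open>Om n\<close> stand for \<open>z\<^sup>n\<close> and \<open>\<Omega>\<^sub>z\<^sup>n\<close>. An element of \<open>V \<otimes> K\<^sub>d\<^sub>i\<^sub>s\<^sub>t\<close>, or of its two-variable
  analogue, is given by its coefficients at \<open>b\<^sub>z\<close>, respectively \<open>b\<^sub>z c\<^sub>w\<close> (in this order).\<close>

datatype raviolo = Zp nat | Om nat

fun raviolo_parity :: "raviolo \<Rightarrow> bit" where
  "raviolo_parity (Zp n) = 0"
| "raviolo_parity (Om n) = 1"

text \<open>\<open>raviolo_mult a f\<close> gives the coefficients of \<open>a f\<close>, e.g. \<open>z\<^sup>n \<Omega>\<^sub>z\<^sup>k\<^sup>+\<^sup>n = \<Omega>\<^sub>z\<^sup>k\<close>. For \<open>mult_w\<close>, an \<open>\<Omega>\<^sub>w\<close> has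
  to be moved past \<open>b\<^sub>z\<close>.\<close>

fun raviolo_mult :: "raviolo \<Rightarrow> (raviolo \<Rightarrow> 'v) \<Rightarrow> raviolo \<Rightarrow> 'v::complex_space" where
  "raviolo_mult (Zp n) f (Zp k) = (if n \<le> k then f (Zp (k - n)) else 0)"
| "raviolo_mult (Zp n) f (Om k) = f (Om (k + n))"
| "raviolo_mult (Om n) f (Zp k) = 0"
| "raviolo_mult (Om n) f (Om k) = (if k \<le> n then f (Zp (n - k)) else 0)"

fun raviolo_deriv :: "(raviolo \<Rightarrow> 'v) \<Rightarrow> raviolo \<Rightarrow> 'v::complex_space" where
  "raviolo_deriv f (Zp n) = of_nat (n + 1) *\<^sub>C f (Zp (n + 1))"
| "raviolo_deriv f (Om 0) = 0"
| "raviolo_deriv f (Om (Suc n)) = - (of_nat (n + 1) *\<^sub>C f (Om n))"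

definition mult_z :: "raviolo \<Rightarrow> (raviolo \<Rightarrow> raviolo \<Rightarrow> 'v) \<Rightarrow> raviolo \<Rightarrow> raviolo \<Rightarrow> 'v::complex_space" where
  "mult_z a F = (\<lambda>b c. raviolo_mult a (\<lambda>b. F b c) b)"

definition mult_w :: "raviolo \<Rightarrow> (raviolo \<Rightarrow> raviolo \<Rightarrow> 'v) \<Rightarrow> raviolo \<Rightarrow> raviolo \<Rightarrow> 'v::complex_space" where
  "mult_w a F = (\<lambda>b c. koszul (raviolo_parity a) (raviolo_parity b) *\<^sub>C raviolo_mult a (F b) c)"

definition mult_z_minus_w :: "(raviolo \<Rightarrow> raviolo \<Rightarrow> 'v) \<Rightarrow> raviolo \<Rightarrow> raviolo \<Rightarrow> 'v::complex_space" where
  "mult_z_minus_w F = (\<lambda>b c. mult_z (Zp 1) F b c - mult_w (Zp 1) F b c)"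

definition mult_w_minus_z :: "(raviolo \<Rightarrow> raviolo \<Rightarrow> 'v) \<Rightarrow> raviolo \<Rightarrow> raviolo \<Rightarrow> 'v::complex_space" where
  "mult_w_minus_z F = (\<lambda>b c. mult_w (Zp 1) F b c - mult_z (Zp 1) F b c)"

text \<open>A field is given by its modes \<open>A\<^sub>m\<close>; \<open>coefficient A b\<close> is the mode that multiplies \<open>b\<close>.\<close>

fun coefficient :: "(int \<Rightarrow> 'v \<Rightarrow> 'v) \<Rightarrow> raviolo \<Rightarrow> 'v \<Rightarrow> 'v" where
  "coefficient A (Zp n) = A (- int n - 1)"
| "coefficient A (Om n) = A (int n)"

text \<open>The graded commutator \<open>A(z) B(w) - (-1)\<^sup>p\<^sup>q B(w) A(z)\<close> of fields of total parities \<open>p\<close> and \<open>q\<close>,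
  applied to \<open>v\<close>. The summand \<open>\<Omega>\<^sub>z\<^sup>m A\<^sub>m\<close> of a field is the element \<open>A\<^sub>m \<otimes> \<Omega>\<^sub>z\<^sup>m\<close> of \<open>End(V) \<otimes> K\<^sub>d\<^sub>i\<^sub>s\<^sub>t\<close>, so that
  \<open>(P \<otimes> b) (Q \<otimes> c) = (-1)\<^bsup>|b||Q|\<^esup> P Q \<otimes> b c\<close>; the coefficient of \<open>B\<close> at \<open>c\<close> has parity \<open>q + |c|\<close>. With the
  opposite placement of \<open>\<Omega>\<^sub>z\<^sup>m\<close> the fields \<open>\<mu>\<^sub>a(z)\<close>, \<open>\<mu>\<^sub>b(w)\<close> would fail to be local when \<open>T\<^sub>a\<close>, \<open>T\<^sub>b\<close> have
  different parities.\<close>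

definition field_commutator ::
    "bit \<Rightarrow> bit \<Rightarrow> (int \<Rightarrow> 'v \<Rightarrow> 'v) \<Rightarrow> (int \<Rightarrow> 'v \<Rightarrow> 'v) \<Rightarrow> 'v \<Rightarrow> raviolo \<Rightarrow> raviolo \<Rightarrow> 'v::complex_space" where
  "field_commutator p q A B v = (\<lambda>b c.
     koszul (raviolo_parity b) (q + raviolo_parity c) *\<^sub>C coefficient A b (coefficient B c v)
     - (koszul p q * koszul (raviolo_parity c) (p + raviolo_parity b) *
         koszul (raviolo_parity c) (raviolo_parity b)) *\<^sub>C coefficient B c (coefficient A b v))"

text \<open>Multiplication by scalar series is on the second factor of \<open>End(V) \<otimes> K\<^sub>d\<^sub>i\<^sub>s\<^sub>t\<close>; moving them past
  the operators would only change each coefficient by a sign depending on its degree in \<open>K\<^sub>d\<^sub>i\<^sub>s\<^sub>t\<close>.\<close>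

definition mutually_local ::
    "bit \<Rightarrow> bit \<Rightarrow> (int \<Rightarrow> 'v \<Rightarrow> 'v) \<Rightarrow> (int \<Rightarrow> 'v \<Rightarrow> 'v::complex_space) \<Rightarrow> bool" where
  "mutually_local p q A B \<longleftrightarrow> (\<exists>N::nat. \<forall>v b c.
     (mult_z_minus_w ^^ (N + 1)) (field_commutator p q A B v) b c = 0 \<and>
     (\<forall>m. mult_z (Om m) (field_commutator p q A B v) b c =
       (\<Sum>n\<le>N. of_nat ((m + n) choose n) *\<^sub>C
          (mult_w_minus_z ^^ n) (mult_w (Om (m + n)) (field_commutator p q A B v)) b c)))"


section \<open>Raviolo vertex algebras\<close>

locale graded_commutative_algebra =
  fixes sdeg :: "int \<Rightarrow> bit \<Rightarrow> 's::complex_algebra set"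
  assumes S_grading: "is_grading (\<lambda>(d, p). sdeg d p)"
    and S_one: "1 \<in> sdeg 0 0"
    and S_mult: "s \<in> sdeg d p \<Longrightarrow> t \<in> sdeg e q \<Longrightarrow> s * t \<in> sdeg (d + e) (p + q)"
    and S_commute: "s \<in> sdeg d p \<Longrightarrow> t \<in> sdeg e q \<Longrightarrow>
      s * t = koszul (total_parity d p) (total_parity e q) *\<^sub>C (t * s)"

locale graded_module = graded_commutative_algebra sdeg
  for sdeg :: "int \<Rightarrow> bit \<Rightarrow> 's::complex_algebra set" +
  fixes act :: "'s \<Rightarrow> 'v::complex_space \<Rightarrow> 'v"
    and vdeg :: "int \<Rightarrow> bit \<Rightarrow> 'v set"
  assumes V_grading: "is_grading (\<lambda>(d, p). vdeg d p)"
    and act_add_left: "act (s + t) v = act s v + act t v"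
    and act_add_right: "act s (v + w) = act s v + act s w"
    and act_mult: "act (s * t) v = act s (act t v)"
    and act_one: "act 1 v = v"
    and act_scale: "act (c *\<^sub>C s) v = c *\<^sub>C act s v"
    and act_degree: "s \<in> sdeg d p \<Longrightarrow> v \<in> vdeg e q \<Longrightarrow> act s v \<in> vdeg (d + e) (p + q)"
begin

text \<open>Homogeneous elements of \<open>End\<^sub>S(V)\<close> and homogeneous raviolo fields, of cohomological degree \<open>r\<close>
  and super parity \<open>p\<close>.\<close>

definition endo :: "int \<Rightarrow> bit \<Rightarrow> ('v \<Rightarrow> 'v) \<Rightarrow> bool" where
  "endo r p A \<longleftrightarrow>
     (\<forall>v w. A (v + w) = A v + A w) \<and>
     (\<forall>e q s v. s \<in> sdeg e q \<longrightarrow>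
        A (act s v) = koszul (total_parity r p) (total_parity e q) *\<^sub>C act s (A v)) \<and>
     (\<forall>e q v. v \<in> vdeg e q \<longrightarrow> A v \<in> vdeg (r + e) (p + q))"

definition raviolo_field :: "int \<Rightarrow> bit \<Rightarrow> (int \<Rightarrow> 'v \<Rightarrow> 'v) \<Rightarrow> bool" where
  "raviolo_field r p A \<longleftrightarrow>
     (\<forall>m<0. endo r p (A m)) \<and> (\<forall>m\<ge>0. endo (r - 1) p (A m)) \<and>
     (\<forall>v. \<exists>M. \<forall>m\<ge>M. A m v = 0)"

end

text \<open>\<open>Y a m\<close> is the mode \<open>a\<^sub>(\<^sub>m\<^sub>)\<close>. The super grading is built in: a raviolo vertex algebra without one
  has \<open>vdeg d 1 = {0}\<close>. The axioms on \<open>Y a\<close> that depend on degrees are stated for homogeneous \<open>a\<close>, which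
  span.\<close>

locale raviolo_vertex_algebra = graded_module sdeg act vdeg
  for sdeg :: "int \<Rightarrow> bit \<Rightarrow> 's::complex_algebra set"
    and act :: "'s \<Rightarrow> 'v::complex_space \<Rightarrow> 'v"
    and vdeg :: "int \<Rightarrow> bit \<Rightarrow> 'v set" +
  fixes vacuum :: 'v
    and D :: "'v \<Rightarrow> 'v"
    and Y :: "'v \<Rightarrow> int \<Rightarrow> 'v \<Rightarrow> 'v"
  assumes vacuum_degree: "vacuum \<in> vdeg 0 0"
    and D_endo: "endo 0 0 D"
    and Y_add: "Y (a + b) m v = Y a m v + Y b m v"
    and Y_act: "Y (act s a) m v = act s (Y a m v)"
    and Y_field: "a \<in> vdeg r p \<Longrightarrow> raviolo_field r p (Y a)"
    and Y_translation: "D (coefficient (Y a) k v) - coefficient (Y a) k (D v) =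
      raviolo_deriv (\<lambda>k. coefficient (Y a) k v) k"
    and D_vacuum: "D vacuum = 0"
    and Y_vacuum: "Y vacuum m v = (if m = -1 then v else 0)"
    and Y_creation: "m \<ge> 0 \<Longrightarrow> Y a m vacuum = 0" "Y a (-1) vacuum = a"
    and Y_locality: "a \<in> vdeg d p \<Longrightarrow> b \<in> vdeg e q \<Longrightarrow>
      mutually_local (total_parity d p) (total_parity e q) (Y a) (Y b)"

locale spin_graded_raviolo_vertex_algebra = raviolo_vertex_algebra sdeg act vdeg vacuum D Y
  for sdeg :: "int \<Rightarrow> bit \<Rightarrow> 's::complex_algebra set"
    and act :: "'s \<Rightarrow> 'v::complex_space \<Rightarrow> 'v"
    and vdeg vacuum D Y +
  fixes spin :: "int \<Rightarrow> 'v set"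
  assumes spin_grading: "is_grading spin"
    and spin_compatible: "is_grading (\<lambda>(d, p, s). vdeg d p \<inter> spin s)"
    and spin_act: "v \<in> spin s \<Longrightarrow> act f v \<in> spin s"
    and spin_vacuum: "vacuum \<in> spin 0"
    and spin_D: "v \<in> spin s \<Longrightarrow> D v \<in> spin (s + 1)"
    and spin_Y: "a \<in> spin s \<Longrightarrow> v \<in> spin t \<Longrightarrow> Y a n v \<in> spin (t + (s - n - 1))"

inductive_set module_span :: "('s \<Rightarrow> 'v \<Rightarrow> 'v) \<Rightarrow> 'v set \<Rightarrow> 'v::complex_space set"
  for act :: "'s \<Rightarrow> 'v \<Rightarrow> 'v" and X :: "'v set" where
  "0 \<in> module_span act X"
| "x \<in> X \<Longrightarrow> act s x \<in> module_span act X"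
| "v \<in> module_span act X \<Longrightarrow> w \<in> module_span act X \<Longrightarrow> v + w \<in> module_span act X"

inductive_set negative_mode_monomials :: "('v \<Rightarrow> int \<Rightarrow> 'v \<Rightarrow> 'v) \<Rightarrow> 'v \<Rightarrow> 'v set \<Rightarrow> 'v set"
  for Y :: "'v \<Rightarrow> int \<Rightarrow> 'v \<Rightarrow> 'v" and vacuum :: 'v and B :: "'v set" where
  "vacuum \<in> negative_mode_monomials Y vacuum B"
| "b \<in> B \<Longrightarrow> j < 0 \<Longrightarrow> v \<in> negative_mode_monomials Y vacuum B \<Longrightarrow>
    Y b j v \<in> negative_mode_monomials Y vacuum B"

definition strongly_generated ::
    "('s \<Rightarrow> 'v \<Rightarrow> 'v) \<Rightarrow> 'v \<Rightarrow> ('v \<Rightarrow> int \<Rightarrow> 'v \<Rightarrow> 'v) \<Rightarrow> 'v::complex_space set \<Rightarrow> bool" where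
  "strongly_generated act vacuum Y B \<longleftrightarrow>
     module_span act (negative_mode_monomials Y vacuum B) = UNIV"

text \<open>The modes of \<open>\<mu>\<^sub>x(z) = \<Sum>n z\<^sup>n \<mu>\<^bsub>x,n\<^esub> + \<Omega>\<^sub>z\<^sup>n J\<^bsub>x,n\<^esub>\<close>.\<close>

definition mu_field :: "'g::lie_superalgebra_form \<Rightarrow> int \<Rightarrow> 'g vuniv \<Rightarrow> 'g vuniv" where
  "mu_field x m =
     (if m < 0 then affine_act (momentum x (nat (- m - 1))) else affine_act (current x (nat m)))"

end

theory Submission
  imports Defs "HOL-Library.Product_Plus"
begin

text \<open>Degree reasons make a raviolo vertex algebra much more classical than a vertex algebra: it is a
  supercommutative differential algebra \<open>V\<close> with a Poisson vertex bracket of cohomological degree \<open>-1\<close>.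
  The mode \<open>a\<^sub>(\<^sub>-\<^sub>k\<^sub>-\<^sub>1\<^sub>)\<close> is multiplication by \<open>\<partial>\<^sup>k a / k!\<close>, and the modes \<open>a\<^sub>(\<^sub>n\<^sub>)\<close>, \<open>n \<ge> 0\<close>, are
  derivations of the product. The proof constructs this structure on the induced module.

  \<^item> Product. The momenta and \<open>\<kappa>\<close> supercommute and generate everything from the vacuum. Hence an
    operator that commutes with all of them is determined by its value at the vacuum, and every vector
    is such a value; these operators are the right multiplications (lemmas \<open>is_rmul_unique\<close> and
    \<open>is_rmul_exists\<close>). The currents and the translation operator are derivations of this product.

  \<^item> Bracket. The generators \<open>\<mu>\<^sub>x\<close> carry the derivations \<open>J\<^bsub>x,n\<^esub>\<close>, and the Leibniz rule extends the
    bracket to polynomials in them. The result could depend on how a state is written as a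
    polynomial. But skew-symmetry, which expresses \<open>a\<^sub>(\<^sub>n\<^sub>) b\<close> through the \<open>b\<^sub>(\<^sub>m\<^sub>) a\<close>, passes from the generators to
    products, and it shows that the derivations depend on \<open>a\<close> only (lemma \<open>state_bracket_unique\<close>). This
    is the counterpart of Goddard's uniqueness theorem.

  \<^item> Locality. For \<open>m, n \<ge> 0\<close> the array \<open>f(m,n) = [a\<^sub>(\<^sub>m\<^sub>), b\<^sub>(\<^sub>n\<^sub>)]\<close> is killed by a power of the operator
    \<open>f(m+1,n) - f(m,n+1)\<close>. For generators this is the bracket of currents; it passes to products by an
    analogue of Dong's lemma (\<open>mode_local_mul_family\<close>). At the other coefficients the first
    locality condition holds because \<open>a\<^sub>(\<^sub>n\<^sub>)\<close> can be moved past \<open>\<partial>\<^sup>k\<close> (lemma \<open>conf_der_dp\<close>), and the second condition is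
    skew-symmetry, up to an identity of Vandermonde type (lemma \<open>mutually_local_modes\<close>).

  \<^item> Gradings and translation. The universal property of the induced module (theorem \<open>universal_map\<close>)
    yields the translation operator, as the second component of a map to \<open>V \<oplus> V\<close>, and
    automorphisms that rescale the generators. Monomials are eigenvectors of these
    automorphisms with different eigenvalues in different degrees, so the sums of the graded pieces are
    direct.\<close>

section \<open>Linear maps and eventually vanishing sums\<close>

definition clinear :: "('a::complex_space \<Rightarrow> 'b::complex_space) \<Rightarrow> bool" where
  "clinear f \<longleftrightarrow> (\<forall>v w. f (v + w) = f v + f w) \<and> (\<forall>c v. f (c *\<^sub>C v) = c *\<^sub>C f v)"

lemma clinearI:
  "(\<And>v w. f (v + w) = f v + f w) \<Longrightarrow> (\<And>c v. f (c *\<^sub>C v) = c *\<^sub>C f v) \<Longrightarrow> clinear f"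
  by (simp add: clinear_def)

lemma clinear_add: "clinear f \<Longrightarrow> f (v + w) = f v + f w"
  and clinear_scale: "clinear f \<Longrightarrow> f (c *\<^sub>C v) = c *\<^sub>C f v"
  by (simp_all add: clinear_def)

lemma clinear_zero: "clinear f \<Longrightarrow> f 0 = 0"
  using clinear_add[of f 0 0] by simp

lemma clinear_uminus: "clinear f \<Longrightarrow> f (- v) = - f v"
  using clinear_add[of f v "- v"] clinear_zero[of f] by (simp add: eq_neg_iff_add_eq_0 add.commute)

lemma clinear_diff: "clinear f \<Longrightarrow> f (v - w) = f v - f w"
  using clinear_add[of f v "- w"] clinear_uminus[of f w] by simp

lemma clinear_sum: "clinear f \<Longrightarrow> f (sum g A) = (\<Sum>i\<in>A. f (g i))"
  by (induction A rule: infinite_finite_induct) (auto simp: clinear_zero clinear_add)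

lemma clinear_compose: "clinear f \<Longrightarrow> clinear g \<Longrightarrow> clinear (\<lambda>v. f (g v))"
  by (simp add: clinear_def)

text \<open>Sums \<open>\<Sum>j a\<^sub>j\<close> over all natural numbers occur below where on each vector only finitely many terms
  survive, with no bound that is uniform in the vector.\<close>

definition vanishing :: "(nat \<Rightarrow> 'a::zero) \<Rightarrow> bool" where
  "vanishing f \<longleftrightarrow> (\<exists>M. \<forall>j\<ge>M. f j = 0)"

definition fsum :: "(nat \<Rightarrow> 'a::comm_monoid_add) \<Rightarrow> 'a" where
  "fsum f = sum f {j. f j \<noteq> 0}"

lemma vanishingI: "(\<And>j. j \<ge> M \<Longrightarrow> f j = 0) \<Longrightarrow> vanishing f"
  by (auto simp: vanishing_def)

lemma vanishing_shift: "vanishing f \<Longrightarrow> vanishing (\<lambda>j. f (n + j))"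
  unfolding vanishing_def by (meson trans_le_add2)

lemma vanishing_Suc: "vanishing f \<Longrightarrow> vanishing (\<lambda>j. f (Suc j))"
  using vanishing_shift[of f 1] by simp

lemma vanishing_add: "vanishing f \<Longrightarrow> vanishing g \<Longrightarrow> vanishing (\<lambda>j. f j + g j :: 'a::monoid_add)"
  unfolding vanishing_def by (metis add.left_neutral le_trans nat_le_linear)

lemma fsum_eq: "(\<And>j. j \<ge> M \<Longrightarrow> f j = 0) \<Longrightarrow> fsum f = (\<Sum>j<M. f j)"
  unfolding fsum_def by (rule sum.mono_neutral_left) (use linorder_not_le in auto)

lemma fsum_zero [simp]: "fsum (\<lambda>j. 0) = 0"
  by (simp add: fsum_def)

lemma fsum_add:
  assumes "vanishing f" "vanishing g"
  shows "fsum (\<lambda>j. f j + g j) = fsum f + fsum g"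
proof -
  obtain M N where "\<forall>j\<ge>M. f j = 0" "\<forall>j\<ge>N. g j = 0" using assms by (auto simp: vanishing_def)
  thus ?thesis
    by (simp add: fsum_eq[of "max M N"] sum.distrib)
qed

lemma fsum_clinear:
  assumes "clinear h" "vanishing f"
  shows "h (fsum f) = fsum (\<lambda>j. h (f j))"
proof -
  obtain M where "\<forall>j\<ge>M. f j = 0" using assms by (auto simp: vanishing_def)
  thus ?thesis
    by (simp add: fsum_eq[of M] clinear_sum[OF assms(1)] clinear_zero[OF assms(1)])
qed

lemma clinear_scaleC: "clinear (\<lambda>v. c *\<^sub>C v)"
  by (rule clinearI) (simp_all add: scaleC_add_right scaleC_scaleC mult.commute)

lemma fsum_scale: "vanishing f \<Longrightarrow> fsum (\<lambda>j. c *\<^sub>C f j) = c *\<^sub>C fsum f"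
  using fsum_clinear[OF clinear_scaleC] by metis

lemma vanishing_scale: "vanishing f \<Longrightarrow> vanishing (\<lambda>j. c j *\<^sub>C f j)"
  by (auto simp: vanishing_def)

lemma vanishing_clinear: "vanishing f \<Longrightarrow> (\<And>j. clinear (h j)) \<Longrightarrow> vanishing (\<lambda>j. h j (f j))"
  unfolding vanishing_def by (metis clinear_zero)

lemma fsum_diff:
  assumes "vanishing f" "vanishing g"
  shows "fsum (\<lambda>j. f j - g j) = fsum f - fsum (g :: nat \<Rightarrow> 'a::complex_space)"
  using fsum_add[OF assms(1) vanishing_scale[OF assms(2), of "\<lambda>_. -1"]] fsum_scale[OF assms(2), of "-1"]
  by simp

lemma fsum_Suc:
  assumes "vanishing f"
  shows "fsum f = f 0 + fsum (\<lambda>j. f (Suc j))"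
proof -
  obtain M where "\<forall>j\<ge>M. f j = 0" using assms by (auto simp: vanishing_def)
  hence "fsum f = sum f {..<Suc M}" "fsum (\<lambda>j. f (Suc j)) = (\<Sum>j<M. f (Suc j))"
    by (auto intro!: fsum_eq)
  thus ?thesis by (simp only: sum.lessThan_Suc_shift)
qed

lemma fsum_triangle:
  assumes "\<And>j k. j + k \<ge> M \<Longrightarrow> F j k = 0"
  shows "fsum (\<lambda>j. fsum (F j)) = fsum (\<lambda>l. \<Sum>j\<le>l. F j (l - j))"
proof -
  have "fsum (\<lambda>j. fsum (F j)) = (\<Sum>j<M. \<Sum>k<M - j. F j k)"
  proof -
    have "fsum (F j) = (\<Sum>k<M - j. F j k)" for j
      by (rule fsum_eq) (use assms in auto)
    thus ?thesis by (simp add: fsum_eq[of M])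
  qed
  also have "\<dots> = (\<Sum>(j,k)\<in>{(j,k). j + k < M}. F j k)"
    by (subst sum.Sigma) (auto intro!: sum.cong)
  also have "\<dots> = (\<Sum>l<M. \<Sum>j\<le>l. F j (l - j))" by (rule sum.triangle_reindex)
  also have "\<dots> = fsum (\<lambda>l. \<Sum>j\<le>l. F j (l - j))"
    by (rule fsum_eq[symmetric]) (use assms in auto)
  finally show ?thesis .
qed

lemma poly_mapping_decompose:
  "f = (\<Sum>k\<in>Poly_Mapping.keys f. Poly_Mapping.single k (Poly_Mapping.lookup f k))"
  by (auto simp: poly_mapping_eq_iff fun_eq_iff lookup_sum lookup_single when_def in_keys_iff sum.delta)

lemma poly_mapping_sum_induct [case_names single sum]:
  assumes single: "\<And>k c. P (Poly_Mapping.single k c)" and sum: "\<And>f g. P f \<Longrightarrow> P g \<Longrightarrow> P (f + g)"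
  shows "P (f :: 'k \<Rightarrow>\<^sub>0 'b::comm_monoid_add)"
proof -
  have "P (\<Sum>k\<in>A. Poly_Mapping.single k (Poly_Mapping.lookup f k))" for A
    using single[of undefined 0] by (induction A rule: infinite_finite_induct) (auto intro: single sum)
  thus ?thesis using poly_mapping_decompose[of f] by metis
qed

lemma koszul_simps [simp]:
  "koszul 0 q = 1" "koszul p 0 = 1" "koszul 1 1 = -1"
  by (auto simp: koszul_def)

section \<open>Commutative differential superalgebras\<close>

locale comm_diff_superalgebra =
  fixes mul :: "'v::complex_space \<Rightarrow> 'v \<Rightarrow> 'v" (infixl "\<star>" 70)
    and one :: 'v and D :: "'v \<Rightarrow> 'v" and pv :: "bit \<Rightarrow> 'v set"
  assumes mul_add_left: "(a + b) \<star> c = a \<star> c + b \<star> c"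
    and mul_add_right: "a \<star> (b + c) = a \<star> b + a \<star> c"
    and mul_scale_left: "(t *\<^sub>C a) \<star> b = t *\<^sub>C (a \<star> b)"
    and mul_scale_right: "a \<star> (t *\<^sub>C b) = t *\<^sub>C (a \<star> b)"
    and mul_assoc: "a \<star> b \<star> c = a \<star> (b \<star> c)"
    and one_mul: "one \<star> a = a"
    and mul_one: "a \<star> one = a"
    and pv_add: "a \<in> pv p \<Longrightarrow> b \<in> pv p \<Longrightarrow> a + b \<in> pv p"
    and pv_scale: "a \<in> pv p \<Longrightarrow> t *\<^sub>C a \<in> pv p"
    and pv_zero: "0 \<in> pv p"
    and pv_one: "one \<in> pv 0"
    and pv_mul: "a \<in> pv p \<Longrightarrow> b \<in> pv q \<Longrightarrow> a \<star> b \<in> pv (p + q)"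
    and pv_disjoint: "a \<in> pv 0 \<Longrightarrow> a \<in> pv 1 \<Longrightarrow> a = 0"
    and pv_total: "\<exists>a\<in>pv 0. \<exists>b\<in>pv 1. v = a + b"
    and mul_commute: "a \<in> pv p \<Longrightarrow> b \<in> pv q \<Longrightarrow> a \<star> b = koszul p q *\<^sub>C (b \<star> a)"
    and D_add: "D (a + b) = D a + D b"
    and D_scale: "D (t *\<^sub>C a) = t *\<^sub>C D a"
    and D_mul: "D (a \<star> b) = D a \<star> b + a \<star> D b"
    and D_pv: "a \<in> pv p \<Longrightarrow> D a \<in> pv p"
begin

lemma clinear_D: "clinear D" by (rule clinearI) (fact D_add D_scale)+
lemma clinear_mul_left: "clinear (\<lambda>a. a \<star> b)" by (rule clinearI) (fact mul_add_left mul_scale_left)+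
lemma clinear_mul_right: "clinear (\<lambda>b. a \<star> b)" by (rule clinearI) (fact mul_add_right mul_scale_right)+

lemma mul_zero [simp]: "0 \<star> b = 0" "a \<star> 0 = 0"
  using clinear_zero[OF clinear_mul_left] clinear_zero[OF clinear_mul_right] by auto
lemma D_zero [simp]: "D 0 = 0" using clinear_zero[OF clinear_D] .
lemma D_one: "D one = 0" using D_mul[of one one] by (simp add: one_mul mul_one)

text \<open>The divided powers \<open>D\<^sup>k / k!\<close> of the derivation. Setting them to zero for \<open>k < 0\<close> makes shifts of the
  index harmless: sums in which \<open>k\<close> decreases end by themselves.\<close>

definition dp :: "int \<Rightarrow> 'v \<Rightarrow> 'v" where
  "dp k v = (if k < 0 then 0 else (1 / fact (nat k)) *\<^sub>C (D ^^ nat k) v)"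

lemma dp_neg: "k < 0 \<Longrightarrow> dp k v = 0" by (simp add: dp_def)
lemma dp_0 [simp]: "dp 0 v = v" by (simp add: dp_def scaleC_one)

lemma clinear_dp: "clinear (dp k)"
proof -
  have "clinear (D ^^ n)" for n
    by (induction n) (auto simp: clinear_def D_add D_scale)
  hence "clinear (\<lambda>v. (1 / fact (nat k)) *\<^sub>C (D ^^ nat k) v)" for k
    by (rule clinear_compose[OF clinear_scaleC])
  thus ?thesis by (simp add: dp_def clinear_def)
qed

lemma dp_zero [simp]: "dp k 0 = 0" by (rule clinear_zero[OF clinear_dp])

lemma D_dp: "D (dp k v) = of_int (k + 1) *\<^sub>C dp (k + 1) v"
proof (cases "k < 0")
  case True thus ?thesis by (cases "k = -1") (auto simp: dp_neg)
next
  case False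
  then obtain n where n: "k = int n" by (metis int_nat_eq linorder_not_less)
  have "nat (int n + 1) = Suc n" by simp
  thus ?thesis by (simp add: dp_def n D_scale scaleC_scaleC field_simps del: of_nat_Suc)
    (simp add: field_simps)
qed

lemma dp_Suc: "of_nat (Suc n) *\<^sub>C dp (int (Suc n)) v = D (dp (int n) v)"
  using D_dp[of "int n" v] by (simp add: add.commute)

lemma dp_D: "dp k (D v) = D (dp k v)"
  by (simp add: dp_def D_scale funpow_swap1)

lemma of_nat_Suc_cancel: "of_nat (Suc n) *\<^sub>C v = of_nat (Suc n) *\<^sub>C (w::'w::complex_space) \<Longrightarrow> v = w"
  using cvs.scale_left_imp_eq of_nat_neq_0 by blast

lemma dp_pv: "v \<in> pv p \<Longrightarrow> dp k v \<in> pv p"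
proof -
  assume "v \<in> pv p"
  hence "(D ^^ n) v \<in> pv p" for n by (induction n) (auto intro: D_pv)
  thus ?thesis by (simp add: dp_def pv_zero pv_scale)
qed

text \<open>The binomial coefficient vanishes when \<open>0 \<le> j + s < s\<close>, so the identity also holds for negative \<open>j\<close>.\<close>

lemma dp_dp: "dp j (dp (int s) v) = of_nat (nat (j + int s) choose s) *\<^sub>C dp (j + int s) v"
proof (cases "j < 0")
  case True
  hence "dp (j + int s) v = 0 \<or> nat (j + int s) choose s = 0"
    by (cases "j + int s < 0") (auto simp: dp_neg)
  thus ?thesis using True by (auto simp: dp_neg)
next
  case False
  then obtain n where n: "j = int n" by (metis int_nat_eq linorder_not_less)
  have [simp]: "nat (int n + int s) = n + s" by simp
  have c: "((n + s) choose s) = fact (n + s) / (fact n * fact s :: complex)"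
    by (subst binomial_fact) (auto simp: field_simps)
  have l: "(D ^^ n) (c *\<^sub>C w) = c *\<^sub>C (D ^^ n) w" for c w by (induction n) (auto simp: D_scale)
  show ?thesis
    by (simp add: dp_def n c l scaleC_scaleC field_simps funpow_add)
qed

lemma dp_one: "dp (int n) one = (if n = 0 then one else 0)"
proof -
  have "(D ^^ n) 0 = 0" for n by (induction n) auto
  hence "(D ^^ Suc n) one = 0" for n by (simp add: funpow_Suc_right D_one del: funpow.simps)
  hence "n \<noteq> 0 \<Longrightarrow> (D ^^ n) one = 0" by (cases n) blast+
  thus ?thesis by (simp add: dp_def scaleC_one)
qed


lemma dp_mul: "dp (int n) (a \<star> b) = (\<Sum>j\<le>n. dp (int j) a \<star> dp (int (n - j)) b)"
proof (induction n)
  case 0 thus ?case by simp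
next
  case (Suc n)
  let ?F = "\<lambda>j. dp (int j) a \<star> dp (int (Suc n - j)) b"
  have "of_nat (Suc n) *\<^sub>C dp (int (Suc n)) (a \<star> b)
      = (\<Sum>j\<le>n. D (dp (int j) a) \<star> dp (int (n - j)) b) + (\<Sum>j\<le>n. dp (int j) a \<star> D (dp (int (n - j)) b))"
    unfolding dp_Suc Suc by (simp add: clinear_sum[OF clinear_D] D_mul sum.distrib)
  also have "(\<Sum>j\<le>n. D (dp (int j) a) \<star> dp (int (n - j)) b) = (\<Sum>j\<le>n. of_nat (Suc j) *\<^sub>C ?F (Suc j))"
    by (simp only: dp_Suc[symmetric] mul_scale_left diff_Suc_Suc)
  also have "\<dots> = (\<Sum>j\<le>Suc n. of_nat j *\<^sub>C ?F j)"
    by (simp only: sum.atMost_Suc_shift[of "\<lambda>j. of_nat j *\<^sub>C ?F j" n] of_nat_0 cvs.scale_zero_left add_0)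
  also have "(\<Sum>j\<le>n. dp (int j) a \<star> D (dp (int (n - j)) b)) = (\<Sum>j\<le>n. of_nat (Suc n - j) *\<^sub>C ?F j)"
    by (intro sum.cong refl) (simp only: dp_Suc[symmetric] mul_scale_right Suc_diff_le atMost_iff)
  also have "\<dots> = (\<Sum>j\<le>Suc n. of_nat (Suc n - j) *\<^sub>C ?F j)"
    by simp
  also have "(\<Sum>j\<le>Suc n. of_nat j *\<^sub>C ?F j) + (\<Sum>j\<le>Suc n. of_nat (Suc n - j) *\<^sub>C ?F j)
      = (\<Sum>j\<le>Suc n. of_nat (Suc n) *\<^sub>C ?F j)"
    unfolding sum.distrib[symmetric] scaleC_add_left[symmetric] of_nat_add[symmetric]
    by (intro sum.cong refl) (simp only: atMost_iff le_add_diff_inverse)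
  finally show ?case
    unfolding cvs.scale_sum_right[symmetric] by (rule of_nat_Suc_cancel)
qed

section \<open>Conformal derivations\<close>

text \<open>The nonnegative modes of a field of parity \<open>p\<close>, as a family of derivations. Its members have the
  opposite parity \<open>p + 1\<close>, since \<open>\<Omega>\<^sub>z\<^sup>n\<close> is odd.\<close>

definition conf_der :: "bit \<Rightarrow> (nat \<Rightarrow> 'v \<Rightarrow> 'v) \<Rightarrow> bool" where
  "conf_der p A \<longleftrightarrow> (\<forall>n. clinear (A n)) \<and> (\<forall>n q v. v \<in> pv q \<longrightarrow> A n v \<in> pv (p + 1 + q)) \<and>
     (\<forall>n q a b. a \<in> pv q \<longrightarrow> A n (a \<star> b) = A n a \<star> b + koszul (p + 1) q *\<^sub>C (a \<star> A n b)) \<and>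
     (\<forall>n v. A n (D v) = D (A n v) + of_nat n *\<^sub>C A (n - 1) v) \<and>
     (\<forall>v. vanishing (\<lambda>n. A n v))"

lemma conf_der_clinear: "conf_der p A \<Longrightarrow> clinear (A n)"
  and conf_der_pv: "conf_der p A \<Longrightarrow> v \<in> pv q \<Longrightarrow> A n v \<in> pv (p + 1 + q)"
  and conf_der_mul: "conf_der p A \<Longrightarrow> a \<in> pv q \<Longrightarrow> A n (a \<star> b) = A n a \<star> b + koszul (p + 1) q *\<^sub>C (a \<star> A n b)"
  and conf_der_D: "conf_der p A \<Longrightarrow> A n (D v) = D (A n v) + of_nat n *\<^sub>C A (n - 1) v"
  and conf_der_vanishing: "conf_der p A \<Longrightarrow> vanishing (\<lambda>n. A n v)"
  by (auto simp: conf_der_def)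

lemma conf_der_one: "conf_der p A \<Longrightarrow> A n one = 0"
  using conf_der_mul[of p A one 0 n one] pv_one by (simp add: one_mul mul_one)

text \<open>This is \<open>A(z) e\<^bsup>w D\<^esup> v = e\<^bsup>w D\<^esup> A(z - w) v\<close> in terms of modes. The sum runs up to an arbitrary bound \<open>K\<close>
  rather than to \<open>n\<close>, so that its range does not change when \<open>n\<close> does.\<close>

lemma conf_der_dp:
  assumes "conf_der p A" and K: "\<And>i. i \<ge> K \<Longrightarrow> A i v = 0"
  shows "A n (dp j v) = (\<Sum>i<K. of_nat (n choose i) *\<^sub>C dp (j - int n + int i) (A i v))"
proof (cases "j < 0")
  case True
  have "of_nat (n choose i) *\<^sub>C dp (j - int n + int i) (A i v) = 0" for i
    using True by (cases "i \<le> n") (auto simp: dp_neg binomial_eq_0)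
  hence "(\<Sum>i<K. of_nat (n choose i) *\<^sub>C dp (j - int n + int i) (A i v)) = 0"
    by (intro sum.neutral) blast
  thus ?thesis using True by (simp add: dp_neg clinear_zero[OF conf_der_clinear[OF assms(1)]])
next
  case False
  then obtain m where j: "j = int m" by (metis int_nat_eq linorder_not_less)
  have "A n (dp (int m) v) = (\<Sum>i<K. of_nat (n choose i) *\<^sub>C dp (int m - int n + int i) (A i v))" for n
  proof (induction m arbitrary: n)
    case 0
    have "(\<Sum>i<K. of_nat (n choose i) *\<^sub>C dp (int 0 - int n + int i) (A i v))
       = (\<Sum>i<K. if i = n then A n v else 0)"
    proof (rule sum.cong)
      fix i
      show "of_nat (n choose i) *\<^sub>C dp (int 0 - int n + int i) (A i v) = (if i = n then A n v else 0)"
        by (cases i n rule: linorder_cases) (auto simp: dp_neg binomial_eq_0 scaleC_one)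
    qed simp
    also have "\<dots> = A n v" using K[of n] by simp
    finally show ?case by simp
  next
    case (Suc m)
    let ?t = "\<lambda>i. dp (int (Suc m) - int n + int i) (A i v)"
    have "of_nat (Suc m) *\<^sub>C A n (dp (int (Suc m)) v) = A n (D (dp (int m) v))"
      by (simp only: dp_Suc[symmetric] clinear_scale[OF conf_der_clinear[OF assms(1)]])
    also have "\<dots> = D (A n (dp (int m) v)) + of_nat n *\<^sub>C A (n - 1) (dp (int m) v)"
      by (rule conf_der_D[OF assms(1)])
    also have "D (A n (dp (int m) v)) = (\<Sum>i<K. (of_nat (n choose i) * of_int (int (Suc m) - int n + int i)) *\<^sub>C ?t i)"
      unfolding Suc
      by (auto simp: clinear_sum[OF clinear_D] D_scale D_dp scaleC_scaleC algebra_simps intro!: sum.cong)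
    also have "of_nat n *\<^sub>C A (n - 1) (dp (int m) v) = (\<Sum>i<K. (of_nat (n choose i) * of_int (int n - int i)) *\<^sub>C ?t i)"
    proof (cases n)
      case 0
      have "(of_nat (n choose i) * of_int (int n - int i) :: complex) = 0" for i
        using 0 by (cases i) auto
      hence "(\<Sum>i<K. (of_nat (n choose i) * of_int (int n - int i)) *\<^sub>C ?t i) = 0"
        by (intro sum.neutral) (metis cvs.scale_zero_left)
      thus ?thesis using 0 by simp
    next
      case n: (Suc k)
      have "of_nat n * of_nat (n - 1 choose i) = (of_nat (n choose i) * of_int (int n - int i) :: complex)" for i
      proof (cases "i \<le> n")
        case True
        have "n * (n - 1 choose i) = (n - i) * (n choose i)"
          using binomial_absorb_comp[of n i] n by simp
        hence "of_nat n * of_nat (n - 1 choose i) = (of_nat (n - i) * of_nat (n choose i) :: complex)"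
          by (metis of_nat_mult)
        thus ?thesis using True by (simp add: of_nat_diff mult.commute)
      qed (auto simp: binomial_eq_0 n)
      moreover have "int m - int (n - 1) + int i = int (Suc m) - int n + int i" for i using n by simp
      ultimately show ?thesis
        by (simp only: Suc cvs.scale_sum_right scaleC_scaleC)
    qed
    also have "(\<Sum>i<K. (of_nat (n choose i) * of_int (int (Suc m) - int n + int i)) *\<^sub>C ?t i) + \<dots>
       = of_nat (Suc m) *\<^sub>C (\<Sum>i<K. of_nat (n choose i) *\<^sub>C ?t i)"
      unfolding sum.distrib[symmetric] scaleC_add_left[symmetric] cvs.scale_sum_right scaleC_scaleC
      by (intro sum.cong refl arg_cong[of _ _ "\<lambda>c. c *\<^sub>C _"]) (simp add: algebra_simps)
    finally show ?case by (rule of_nat_Suc_cancel)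
  qed
  thus ?thesis by (simp add: j)
qed

text \<open>The first half \<open>\<Sum>j (D\<^sup>j a / j!) B\<^bsub>n+j\<^esub>\<close> of the Leibniz rule for the bracket with a product \<open>a b\<close>, where \<open>B\<close> is the
  bracket with \<open>b\<close>. The other half has \<open>a\<close> and \<open>b\<close> exchanged (see \<open>product_family\<close>), so statements
  about products reduce to this expression.\<close>

definition mul_family :: "'v \<Rightarrow> (nat \<Rightarrow> 'v \<Rightarrow> 'v) \<Rightarrow> nat \<Rightarrow> 'v \<Rightarrow> 'v" where
  "mul_family a B n v = fsum (\<lambda>j. dp (int j) a \<star> B (n + j) v)"

lemma vanishing_mul: "vanishing f \<Longrightarrow> vanishing (\<lambda>j. g j \<star> f j)"
  by (rule vanishing_clinear[of f "\<lambda>j. (\<star>) (g j)"], assumption, rule clinear_mul_right)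

lemma mul_family_vanishing: "conf_der p B \<Longrightarrow> vanishing (\<lambda>j. dp (int j) a \<star> B (n + j) v)"
  by (intro vanishing_mul vanishing_shift conf_der_vanishing)

lemma fsum_pv: "(\<And>j. f j \<in> pv p) \<Longrightarrow> fsum f \<in> pv p"
proof -
  assume f: "\<And>j. f j \<in> pv p"
  have "sum f S \<in> pv p" for S
    by (induction S rule: infinite_finite_induct) (auto intro: f pv_add pv_zero)
  thus ?thesis by (simp add: fsum_def)
qed

text \<open>Multiplying a derivation from the left by an element gives a derivation. The relation with \<open>D\<close>
  persists because differentiating the first factor shifts \<open>j\<close>, which turns the factor \<open>n + j\<close> from the
  second factor into \<open>n\<close>.\<close>

lemma conf_der_mul_family:
  assumes a: "a \<in> pv p" and B: "conf_der q B"
  shows "conf_der (p + q) (mul_family a B)"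
  unfolding conf_der_def
proof (intro conjI allI impI)
  note Bl = conf_der_clinear[OF B] and van = mul_family_vanishing[OF B]
  fix n v
  show "clinear (mul_family a B n)"
    by (rule clinearI)
      (simp_all add: mul_family_def clinear_add[OF Bl] mul_add_right fsum_add van clinear_scale[OF Bl] mul_scale_right fsum_scale)
  show "mul_family a B n v \<in> pv (p + q + 1 + r)" if "v \<in> pv r" for r
  proof -
    have "dp (int j) a \<star> B (n + j) v \<in> pv (p + (q + 1 + r))" for j
      by (intro pv_mul dp_pv a conf_der_pv[OF B] that)
    thus ?thesis unfolding mul_family_def add.assoc by (rule fsum_pv)
  qed
  show "mul_family a B n (v \<star> w) = mul_family a B n v \<star> w + koszul (p + q + 1) r *\<^sub>C (v \<star> mul_family a B n w)" if "v \<in> pv r" for r w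
  proof -
    have 1: "dp (int j) a \<star> B (n + j) (v \<star> w)
      = dp (int j) a \<star> B (n + j) v \<star> w + koszul (p + q + 1) r *\<^sub>C (v \<star> (dp (int j) a \<star> B (n + j) w))" for j
    proof -
      have "dp (int j) a \<star> v = koszul p r *\<^sub>C (v \<star> dp (int j) a)"
        by (rule mul_commute[OF dp_pv[OF a] that])
      hence "dp (int j) a \<star> (v \<star> B (n + j) w) = koszul p r *\<^sub>C (v \<star> (dp (int j) a \<star> B (n + j) w))"
        by (simp add: mul_assoc[symmetric] mul_scale_left)
      moreover have "koszul (q + 1) r * koszul p r = koszul (p + q + 1) r"
        by (cases p; cases q; cases r; simp)
      ultimately show ?thesis
        by (simp add: conf_der_mul[OF B that] mul_add_right mul_scale_right mul_assoc scaleC_scaleC)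
    qed
    show ?thesis unfolding mul_family_def 1
      by (simp add: fsum_add vanishing_scale fsum_scale vanishing_mul van
          vanishing_clinear[OF van clinear_mul_left] fsum_clinear[OF clinear_mul_right van] fsum_clinear[OF clinear_mul_left van])
  qed
  show "vanishing (\<lambda>n. mul_family a B n v)"
  proof -
    obtain M where M: "\<forall>n\<ge>M. B n v = 0" using conf_der_vanishing[OF B, of v] by (auto simp: vanishing_def)
    show ?thesis by (rule vanishingI[of M]) (simp add: mul_family_def M)
  qed
  show "mul_family a B n (D v) = D (mul_family a B n v) + of_nat n *\<^sub>C mul_family a B (n - 1) v"
  proof -
    let ?u = "\<lambda>j. dp (int j) a \<star> B (n + j - 1) v"
    obtain M where M: "\<forall>j\<ge>M. B j v = 0" using conf_der_vanishing[OF B, of v] by (auto simp: vanishing_def)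
    have u: "vanishing ?u" by (rule vanishingI[of "Suc M"]) (simp add: M)
    have vD: "vanishing (\<lambda>j. dp (int j) a \<star> D (B (n + j) v))" "vanishing (\<lambda>j. D (dp (int j) a) \<star> B (n + j) v)"
      by (rule vanishingI[of M], simp add: M)+
    have 1: "mul_family a B n (D v) = fsum (\<lambda>j. dp (int j) a \<star> D (B (n + j) v)) + fsum (\<lambda>j. of_nat (n + j) *\<^sub>C ?u j)"
      unfolding mul_family_def conf_der_D[OF B] mul_add_right mul_scale_right
      by (rule fsum_add) (intro vD vanishing_scale u)+
    have 2: "D (mul_family a B n v) = fsum (\<lambda>j. D (dp (int j) a) \<star> B (n + j) v) + fsum (\<lambda>j. dp (int j) a \<star> D (B (n + j) v))"
      unfolding mul_family_def fsum_clinear[OF clinear_D van] D_mul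
      by (rule fsum_add) (rule vD)+
    have 3: "fsum (\<lambda>j. of_nat j *\<^sub>C ?u j) = fsum (\<lambda>j. D (dp (int j) a) \<star> B (n + j) v)"
      by (subst fsum_Suc[OF vanishing_scale[OF u]]) (simp add: dp_Suc[symmetric] mul_scale_left del: of_nat_Suc)
    have 4: "of_nat n *\<^sub>C mul_family a B (n - 1) v = of_nat n *\<^sub>C fsum ?u"
      by (cases n) (simp_all add: mul_family_def)
    have 5: "fsum (\<lambda>j. of_nat (n + j) *\<^sub>C ?u j) = of_nat n *\<^sub>C fsum ?u + fsum (\<lambda>j. of_nat j *\<^sub>C ?u j)"
      unfolding of_nat_add scaleC_add_left fsum_scale[OF u, symmetric]
      by (rule fsum_add) (intro vanishing_scale u)+
    show ?thesis unfolding 1 2 4 5 3 by (simp add: algebra_simps)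
  qed
qed

lemma conf_der_add: "conf_der p A \<Longrightarrow> conf_der p B \<Longrightarrow> conf_der p (\<lambda>n v. A n v + B n v)"
  unfolding conf_der_def
  by (auto simp: clinear_def mul_add_left mul_add_right scaleC_add_right D_add pv_add intro!: vanishing_add)

lemma conf_der_scale: "conf_der p A \<Longrightarrow> conf_der p (\<lambda>n v. c *\<^sub>C A n v)"
  unfolding conf_der_def
  by (auto simp: clinear_def mul_scale_left mul_scale_right scaleC_add_right scaleC_scaleC D_scale pv_scale mult.commute
      intro!: vanishing_scale)

lemma conf_der_zero: "conf_der p (\<lambda>n v. 0)"
  unfolding conf_der_def
  by (auto simp: clinear_def pv_zero intro!: vanishingI)

text \<open>The bracket with \<open>D a\<close>, by sesquilinearity.\<close>

definition deriv_family :: "(nat \<Rightarrow> 'v \<Rightarrow> 'v) \<Rightarrow> nat \<Rightarrow> 'v \<Rightarrow> 'v" where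
  "deriv_family A n v = - (of_nat n *\<^sub>C A (n - 1) v)"

lemma conf_der_deriv_family:
  assumes "conf_der p A" shows "conf_der p (deriv_family A)"
  unfolding conf_der_def
proof (intro conjI allI impI)
  have m: "- v = (-1) *\<^sub>C v" for v :: 'v by simp
  fix n v
  show "clinear (deriv_family A n)" using conf_der_clinear[OF assms, of "n - 1"]
    by (auto simp: clinear_def deriv_family_def scaleC_add_right scaleC_scaleC mult.commute)
  show "v \<in> pv q \<Longrightarrow> deriv_family A n v \<in> pv (p + 1 + q)" for q
    unfolding deriv_family_def m by (intro pv_scale conf_der_pv[OF assms])
  show "v \<in> pv q \<Longrightarrow> deriv_family A n (v \<star> b) = deriv_family A n v \<star> b + koszul (p + 1) q *\<^sub>C (v \<star> deriv_family A n b)" for q b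
    unfolding deriv_family_def m
    by (simp add: conf_der_mul[OF assms] scaleC_add_right scaleC_scaleC mul_scale_left mul_scale_right mult_ac del: cvs.scale_minus_left)
  show "deriv_family A n (D v) = D (deriv_family A n v) + of_nat n *\<^sub>C deriv_family A (n - 1) v"
    unfolding deriv_family_def m by (simp add: conf_der_D[OF assms] D_scale scaleC_add_right del: cvs.scale_minus_left)
  obtain M where M: "\<forall>j\<ge>M. A j v = 0" using conf_der_vanishing[OF assms, of v] by (auto simp: vanishing_def)
  show "vanishing (\<lambda>n. deriv_family A n v)" by (rule vanishingI[of "Suc M"]) (simp add: deriv_family_def M)
qed

section \<open>Skew-symmetry\<close>

text \<open>The sign is \<open>-(-1)\<^bsup>(p+1)(q+1)\<^esup>\<close> because the bracket has odd degree: it is a shifted Lie bracket.\<close>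

definition skew :: "bit \<Rightarrow> 'v \<Rightarrow> (nat \<Rightarrow> 'v \<Rightarrow> 'v) \<Rightarrow> bit \<Rightarrow> 'v \<Rightarrow> (nat \<Rightarrow> 'v \<Rightarrow> 'v) \<Rightarrow> bool" where
  "skew p a A q b B \<longleftrightarrow>
     (\<forall>n. A n b = - (koszul (p + 1) (q + 1) *\<^sub>C fsum (\<lambda>s. (-1) ^ (n + s) *\<^sub>C dp (int s) (B (n + s) a))))"

lemma skew_vanishing: "conf_der q B \<Longrightarrow> vanishing (\<lambda>s. c s *\<^sub>C dp (int s) (B (n + s) a))"
  by (intro vanishing_scale vanishing_clinear[of _ "\<lambda>s. dp (int s)"] clinear_dp vanishing_shift conf_der_vanishing)

text \<open>Substituting the identity into itself gives the coefficient \<open>\<Sum>j (-1)\<^bsup>l-j\<^esup> (l choose j) = 0\<^sup>l\<close> at \<open>D\<^sup>l/l!\<close>.\<close>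

lemma skew_sym:
  assumes A: "conf_der p A" and B: "conf_der q B" and s: "skew p a A q b B"
  shows "skew q b B p a A"
  unfolding skew_def
proof
  fix n
  obtain M where M: "\<forall>j\<ge>M. B j a = 0" using conf_der_vanishing[OF B, of a] by (auto simp: vanishing_def)
  let ?k = "koszul (p + 1) (q + 1)"
  have kk: "koszul (q + 1) (p + 1) = ?k" "?k * ?k = 1" by (auto simp: koszul_def)
  let ?F = "\<lambda>s t. ((-1) ^ t * of_nat ((s + t) choose s)) *\<^sub>C dp (int (s + t)) (B (n + (s + t)) a)"
  have 1: "(-1) ^ (n + s) *\<^sub>C dp (int s) (A (n + s) b) = - (?k *\<^sub>C fsum (?F s))" for s
  proof -
    have "(-1) ^ (n + s) *\<^sub>C dp (int s) (A (n + s) b)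
      = - (?k *\<^sub>C ((-1) ^ (n + s) *\<^sub>C dp (int s) (fsum (\<lambda>t. (-1) ^ (n + s + t) *\<^sub>C dp (int t) (B (n + s + t) a)))))"
      using s unfolding skew_def
      by (simp add: clinear_uminus[OF clinear_dp] clinear_scale[OF clinear_dp] scaleC_scaleC mult.commute)
    also have "(-1) ^ (n + s) *\<^sub>C dp (int s) (fsum (\<lambda>t. (-1) ^ (n + s + t) *\<^sub>C dp (int t) (B (n + s + t) a)))
      = fsum (\<lambda>t. (-1) ^ (n + s) *\<^sub>C dp (int s) ((-1) ^ (n + s + t) *\<^sub>C dp (int t) (B (n + s + t) a)))"
      using skew_vanishing[OF B, of "\<lambda>t. (-1) ^ (n + s + t)" "n + s" a]
      by (rule fsum_clinear[OF clinear_compose[OF clinear_scaleC clinear_dp]])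
    also have "\<dots> = fsum (?F s)"
    proof (rule arg_cong[of _ _ fsum], rule ext)
      fix t
      have "(-1) ^ (n + s) * (-1) ^ (n + s + t) = ((-1) ^ t :: complex)"
        by (simp only: power_add[of "- 1 :: complex" "n + s" t] mult.assoc[symmetric] power_mult_distrib[symmetric]) simp
      moreover have "nat (int s + int t) choose t = (s + t) choose s"
        using binomial_symmetric[of s "s + t"] by (simp add: nat_int_add)
      ultimately show "(-1) ^ (n + s) *\<^sub>C dp (int s) ((-1) ^ (n + s + t) *\<^sub>C dp (int t) (B (n + s + t) a)) = ?F s t"
        by (simp add: clinear_scale[OF clinear_dp] dp_dp scaleC_scaleC mult.assoc[symmetric] add.assoc)
    qed
    finally show ?thesis .
  qed
  have F0: "?F s t = 0" if "s + t \<ge> M" for s t using M that by simp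
  have vF: "vanishing (\<lambda>s. fsum (?F s))"
    by (rule vanishingI[of M]) (simp add: F0 del: of_nat_add)
  have al: "(\<Sum>j\<le>l. ?F j (l - j)) = (if l = 0 then B n a else 0)" for l
  proof -
    have "(\<Sum>j\<le>l. ?F j (l - j)) = (\<Sum>j\<le>l. (-1) ^ (l - j) * of_nat (l choose j)) *\<^sub>C dp (int l) (B (n + l) a)"
      by (simp add: cvs.scale_sum_left)
    also have "(\<Sum>j\<le>l. (-1) ^ (l - j) * of_nat (l choose j)) = ((1 + (-1)) ^ l :: complex)"
      by (subst binomial_ring) (simp add: mult.commute)
    finally show ?thesis by (auto simp: scaleC_one)
  qed
  have "- (koszul (q + 1) (p + 1) *\<^sub>C fsum (\<lambda>s. (-1) ^ (n + s) *\<^sub>C dp (int s) (A (n + s) b)))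
     = - (?k *\<^sub>C fsum (\<lambda>s. (- ?k) *\<^sub>C fsum (?F s)))"
    by (simp only: 1 kk) simp
  also have "\<dots> = fsum (\<lambda>s. fsum (?F s))"
    unfolding fsum_scale[OF vF] by (simp add: scaleC_scaleC kk(2) scaleC_one)
  also have "\<dots> = fsum (\<lambda>l. if l = 0 then B n a else 0)"
    by (subst fsum_triangle[OF F0]) (simp_all only: al)
  also have "\<dots> = B n a" by (subst fsum_eq[of 1]) auto
  finally show "B n a = - (koszul (q + 1) (p + 1) *\<^sub>C fsum (\<lambda>s. (-1) ^ (n + s) *\<^sub>C dp (int s) (A (n + s) b)))" ..
qed


text \<open>The Leibniz rule for \<open>D\<^sup>l/l!\<close> collects the two sums, over \<open>j\<close> and over the index of skew-symmetry,
  into one.\<close>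

lemma mul_family_skew:
  assumes C: "conf_der r C" and s: "skew q b B r c C"
  shows "mul_family a B n c = - (koszul (q + 1) (r + 1) *\<^sub>C fsum (\<lambda>l. (-1) ^ (n + l) *\<^sub>C dp (int l) (a \<star> C (n + l) b)))"
proof -
  obtain M where M: "\<forall>j\<ge>M. C j b = 0" using conf_der_vanishing[OF C, of b] by (auto simp: vanishing_def)
  let ?k = "koszul (q + 1) (r + 1)"
  let ?F = "\<lambda>j s. (-1) ^ (n + (j + s)) *\<^sub>C (dp (int j) a \<star> dp (int s) (C (n + (j + s)) b))"
  have F0: "?F j s = 0" if "j + s \<ge> M" for j s using M that by simp
  have vF: "vanishing (\<lambda>j. fsum (?F j))"
    by (rule vanishingI[of M]) (simp add: F0)
  have 1: "dp (int j) a \<star> B (n + j) c = (- ?k) *\<^sub>C fsum (?F j)" for j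
  proof -
    have "B (n + j) c = (- ?k) *\<^sub>C fsum (\<lambda>t. (-1) ^ (n + j + t) *\<^sub>C dp (int t) (C (n + j + t) b))"
      using s by (simp add: skew_def)
    moreover have "dp (int j) a \<star> fsum (\<lambda>t. (-1) ^ (n + j + t) *\<^sub>C dp (int t) (C (n + j + t) b))
      = fsum (\<lambda>t. dp (int j) a \<star> (-1) ^ (n + j + t) *\<^sub>C dp (int t) (C (n + j + t) b))"
      by (rule fsum_clinear[OF clinear_mul_right skew_vanishing[OF C]])
    ultimately show ?thesis
      by (simp only: mul_scale_right add.assoc)
  qed
  have "mul_family a B n c = (- ?k) *\<^sub>C fsum (\<lambda>j. fsum (?F j))"
    by (simp only: mul_family_def 1 fsum_scale[OF vF])
  also have "fsum (\<lambda>j. fsum (?F j)) = fsum (\<lambda>l. \<Sum>j\<le>l. ?F j (l - j))"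
    by (rule fsum_triangle[OF F0])
  also have "(\<lambda>l. \<Sum>j\<le>l. ?F j (l - j)) = (\<lambda>l. (-1) ^ (n + l) *\<^sub>C dp (int l) (a \<star> C (n + l) b))"
    by (rule ext) (simp add: dp_mul cvs.scale_sum_right)
  finally show ?thesis by simp
qed

definition product_family where
  "product_family p a A q b B = (\<lambda>n v. mul_family a B n v + koszul p q *\<^sub>C mul_family b A n v)"

lemma conf_der_product_family:
  assumes "a \<in> pv p" "b \<in> pv q" "conf_der p A" "conf_der q B"
  shows "conf_der (p + q) (product_family p a A q b B)"
  unfolding product_family_def
  by (rule conf_der_add[OF conf_der_mul_family[OF assms(1,4)] conf_der_scale[OF conf_der_mul_family[OF assms(2,3), unfolded add.commute[of q p]]]])

text \<open>Each half of \<open>product_family\<close> produces one of the two terms of \<open>C\<^sub>n (a b) = C\<^sub>n a b \<plusminus> a C\<^sub>n b\<close>, with the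
  right sign.\<close>

lemma skew_product_family:
  assumes a: "a \<in> pv p" and b: "b \<in> pv q" and C: "conf_der r C"
    and sa: "skew p a A r c C" and sb: "skew q b B r c C"
  shows "skew (p + q) (a \<star> b) (product_family p a A q b B) r c C"
  unfolding skew_def
proof
  fix n
  let ?X = "\<lambda>l. (-1) ^ (n + l) *\<^sub>C dp (int l) (a \<star> C (n + l) b)"
  let ?Y = "\<lambda>l. (-1) ^ (n + l) *\<^sub>C dp (int l) (b \<star> C (n + l) a)"
  have v: "vanishing ?X" "vanishing ?Y"
    by (intro vanishing_scale vanishing_clinear[of _ "\<lambda>s. dp (int s)"] clinear_dp vanishing_mul vanishing_shift conf_der_vanishing[OF C])+
  have "C m (a \<star> b) = koszul (r + 1 + p) q *\<^sub>C (b \<star> C m a) + koszul (r + 1) p *\<^sub>C (a \<star> C m b)" for m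
    using mul_commute[OF conf_der_pv[OF C a] b] by (simp add: conf_der_mul[OF C a])
  hence "(-1) ^ (n + l) *\<^sub>C dp (int l) (C (n + l) (a \<star> b)) = koszul (r + 1 + p) q *\<^sub>C ?Y l + koszul (r + 1) p *\<^sub>C ?X l" for l
    by (simp add: clinear_add[OF clinear_dp] clinear_scale[OF clinear_dp] scaleC_add_right scaleC_scaleC mult.commute)
  hence "fsum (\<lambda>l. (-1) ^ (n + l) *\<^sub>C dp (int l) (C (n + l) (a \<star> b))) = koszul (r + 1 + p) q *\<^sub>C fsum ?Y + koszul (r + 1) p *\<^sub>C fsum ?X"
    by (simp only: fsum_add[OF vanishing_scale[OF v(2)] vanishing_scale[OF v(1)]] fsum_scale[OF v(1)] fsum_scale[OF v(2)])
  moreover have "product_family p a A q b B n c = - (koszul (q + 1) (r + 1) *\<^sub>C fsum ?X) - (koszul p q * koszul (p + 1) (r + 1)) *\<^sub>C fsum ?Y"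
    unfolding product_family_def mul_family_skew[OF C sa] mul_family_skew[OF C sb] by (simp add: scaleC_scaleC)
  moreover have "koszul (q + 1) (r + 1) = koszul (p + q + 1) (r + 1) * koszul (r + 1) p"
      "koszul p q * koszul (p + 1) (r + 1) = koszul (p + q + 1) (r + 1) * koszul (r + 1 + p) q"
    by (cases p; cases q; cases r; simp)+
  ultimately show "product_family p a A q b B n c
    = - (koszul (p + q + 1) (r + 1) *\<^sub>C fsum (\<lambda>s. (-1) ^ (n + s) *\<^sub>C dp (int s) (C (n + s) (a \<star> b))))"
    by (simp add: scaleC_add_right scaleC_scaleC)
qed

lemma skew_add:
  assumes "conf_der q B" "skew p a A q b B" "skew p a' A' q b B"
  shows "skew p (a + a') (\<lambda>n v. A n v + A' n v) q b B"
proof -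
  have "(-1) ^ (n + s) *\<^sub>C dp (int s) (B (n + s) (a + a')) = (-1) ^ (n + s) *\<^sub>C dp (int s) (B (n + s) a) + (-1) ^ (n + s) *\<^sub>C dp (int s) (B (n + s) a')" for n s
    by (simp add: clinear_add[OF conf_der_clinear[OF assms(1)]] clinear_add[OF clinear_dp] scaleC_add_right)
  thus ?thesis using assms(2,3) unfolding skew_def
    by (simp add: fsum_add[OF skew_vanishing[OF assms(1)] skew_vanishing[OF assms(1)]] scaleC_add_right)
qed

lemma skew_scale:
  assumes "conf_der q B" "skew p a A q b B"
  shows "skew p (t *\<^sub>C a) (\<lambda>n v. t *\<^sub>C A n v) q b B"
proof -
  have "(-1) ^ (n + s) *\<^sub>C dp (int s) (B (n + s) (t *\<^sub>C a)) = t *\<^sub>C (-1) ^ (n + s) *\<^sub>C dp (int s) (B (n + s) a)" for n s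
    by (simp add: clinear_scale[OF conf_der_clinear[OF assms(1)]] clinear_scale[OF clinear_dp] scaleC_scaleC mult.commute)
  thus ?thesis using assms(2) unfolding skew_def
    by (simp only: fsum_scale[OF skew_vanishing[OF assms(1)]]) (simp add: scaleC_scaleC mult.commute)
qed

lemma skew_one: "conf_der q B \<Longrightarrow> skew 0 one (\<lambda>n v. 0) q b B"
  by (simp add: skew_def conf_der_one)

lemma skew_deriv_family:
  assumes B: "conf_der q B" and s: "skew p a A q b B"
  shows "skew p (D a) (deriv_family A) q b B"
  unfolding skew_def
proof
  fix n
  let ?u = "\<lambda>s. (-1) ^ (n + s) *\<^sub>C dp (int s) (B (n + s - 1) a)"
  let ?w = "\<lambda>s. (-1) ^ (n + s) *\<^sub>C D (dp (int s) (B (n + s) a))"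
  obtain M where M: "\<forall>j\<ge>M. B j a = 0" using conf_der_vanishing[OF B, of a] by (auto simp: vanishing_def)
  have u: "vanishing ?u" by (rule vanishingI[of "Suc M"]) (simp add: M)
  have w: "vanishing ?w" by (rule vanishingI[of M]) (simp add: M)
  have 1: "(-1) ^ (n + s) *\<^sub>C dp (int s) (B (n + s) (D a)) = ?w s + of_nat (n + s) *\<^sub>C ?u s" for s
    by (simp add: conf_der_D[OF B] clinear_add[OF clinear_dp] clinear_scale[OF clinear_dp] dp_D scaleC_add_right scaleC_scaleC mult.commute)
  have 2: "fsum (\<lambda>s. of_nat s *\<^sub>C ?u s) = - fsum ?w"
  proof -
    have "fsum (\<lambda>s. of_nat s *\<^sub>C ?u s) = fsum (\<lambda>s. of_nat (Suc s) *\<^sub>C ?u (Suc s))"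
      by (subst fsum_Suc[OF vanishing_scale[OF u]]) simp
    also have "\<dots> = fsum (\<lambda>s. (-1) *\<^sub>C ?w s)"
    proof (rule arg_cong[of _ _ fsum], rule ext)
      fix s
      have "of_nat (Suc s) *\<^sub>C ?u (Suc s) = (-1) ^ (n + Suc s) *\<^sub>C (of_nat (Suc s) *\<^sub>C dp (int (Suc s)) (B (n + s) a))"
        by (simp only: scaleC_scaleC mult.commute) simp
      thus "of_nat (Suc s) *\<^sub>C ?u (Suc s) = (-1) *\<^sub>C ?w s"
        by (simp only: dp_Suc) (simp add: scaleC_scaleC)
    qed
    finally show ?thesis by (simp only: fsum_scale[OF w]) simp
  qed
  have 3: "fsum (\<lambda>s. (-1) ^ (n + s) *\<^sub>C dp (int s) (B (n + s) (D a))) = of_nat n *\<^sub>C fsum ?u"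
    unfolding 1 of_nat_add scaleC_add_left fsum_add[OF w vanishing_add[OF vanishing_scale[OF u] vanishing_scale[OF u]]]
      fsum_add[OF vanishing_scale[OF u] vanishing_scale[OF u]] fsum_scale[OF u] 2 by simp
  have 4: "of_nat n *\<^sub>C A (n - 1) b = koszul (p + 1) (q + 1) *\<^sub>C of_nat n *\<^sub>C fsum ?u"
  proof (cases n)
    case (Suc m)
    have "?u = (\<lambda>s. (-1) *\<^sub>C (-1) ^ (m + s) *\<^sub>C dp (int s) (B (m + s) a))"
      by (simp add: Suc scaleC_scaleC)
    hence "fsum ?u = - fsum (\<lambda>s. (-1) ^ (m + s) *\<^sub>C dp (int s) (B (m + s) a))"
      by (simp only: fsum_scale[OF skew_vanishing[OF B]]) simp
    moreover have "A (n - 1) b = - (koszul (p + 1) (q + 1) *\<^sub>C fsum (\<lambda>t. (-1) ^ (m + t) *\<^sub>C dp (int t) (B (m + t) a)))"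
      unfolding Suc diff_Suc_1 using s unfolding skew_def by (rule spec)
    ultimately have "A (n - 1) b = koszul (p + 1) (q + 1) *\<^sub>C fsum ?u"
      by (simp only: cvs.scale_minus_right)
    thus ?thesis by (simp only: scaleC_scaleC mult.commute)
  qed simp
  show "deriv_family A n b = - (koszul (p + 1) (q + 1) *\<^sub>C fsum (\<lambda>s. (-1) ^ (n + s) *\<^sub>C dp (int s) (B (n + s) (D a))))"
    unfolding deriv_family_def 3 4 ..
qed

section \<open>Locality of conformal derivations\<close>

text \<open>Multiplication by \<open>z - w\<close> on the coefficients at \<open>\<Omega>\<^sub>z\<^sup>m \<Omega>\<^sub>w\<^sup>n\<close>, so that \<open>mode_local\<close> is the part of locality that
  concerns these coefficients.\<close>

definition cdiff :: "(nat \<Rightarrow> nat \<Rightarrow> 'v) \<Rightarrow> nat \<Rightarrow> nat \<Rightarrow> 'v" where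
  "cdiff f m n = f (Suc m) n - f m (Suc n)"

definition scomm :: "bit \<Rightarrow> (nat \<Rightarrow> 'v \<Rightarrow> 'v) \<Rightarrow> bit \<Rightarrow> (nat \<Rightarrow> 'v \<Rightarrow> 'v) \<Rightarrow> 'v \<Rightarrow> nat \<Rightarrow> nat \<Rightarrow> 'v" where
  "scomm p A q B v m n = A m (B n v) - koszul (p + 1) (q + 1) *\<^sub>C B n (A m v)"

definition mode_local :: "bit \<Rightarrow> (nat \<Rightarrow> 'v \<Rightarrow> 'v) \<Rightarrow> bit \<Rightarrow> (nat \<Rightarrow> 'v \<Rightarrow> 'v) \<Rightarrow> bool" where
  "mode_local p A q B \<longleftrightarrow> (\<exists>N. \<forall>v. (cdiff ^^ N) (scomm p A q B v) = (\<lambda>m n. 0))"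

lemma cdiff_zero: "(cdiff ^^ N) (\<lambda>m n. 0) = (\<lambda>m n. 0)"
  by (induction N) (auto simp: cdiff_def fun_eq_iff)

lemma cdiff_add: "(cdiff ^^ N) (\<lambda>m n. f m n + g m n) = (\<lambda>m n. (cdiff ^^ N) f m n + (cdiff ^^ N) g m n)"
  by (induction N) (auto simp: cdiff_def fun_eq_iff)

lemma cdiff_scale: "(cdiff ^^ N) (\<lambda>m n. c *\<^sub>C f m n) = (\<lambda>m n. c *\<^sub>C (cdiff ^^ N) f m n)"
  by (induction N) (auto simp: cdiff_def fun_eq_iff cvs.scale_right_diff_distrib)

lemma cdiff_mono:
  assumes "(cdiff ^^ N) f = (\<lambda>m n. 0)" "N \<le> N'"
  shows "(cdiff ^^ N') f = (\<lambda>m n. 0)"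
proof -
  have "(cdiff ^^ N') f = (cdiff ^^ (N' - N)) ((cdiff ^^ N) f)"
    using assms(2) by (simp add: funpow_add[symmetric] flip: comp_apply[of "cdiff ^^ _"])
  thus ?thesis by (simp add: assms(1) cdiff_zero)
qed

lemma mode_localI:
  assumes "\<And>v. scomm p A q B v = (\<lambda>m n. f v m n + c *\<^sub>C g v m n)"
    "\<exists>N. \<forall>v. (cdiff ^^ N) (f v) = (\<lambda>m n. 0)" "\<exists>N. \<forall>v. (cdiff ^^ N) (g v) = (\<lambda>m n. 0)"
  shows "mode_local p A q B"
proof -
  obtain N N' where "\<forall>v. (cdiff ^^ N) (f v) = (\<lambda>m n. 0)" "\<forall>v. (cdiff ^^ N') (g v) = (\<lambda>m n. 0)"
    using assms(2,3) by blast
  hence "(cdiff ^^ max N N') (f v) = (\<lambda>m n. 0)" "(cdiff ^^ max N N') (g v) = (\<lambda>m n. 0)" for v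
    using cdiff_mono by (metis max.cobounded1, metis max.cobounded2)
  hence "(cdiff ^^ max N N') (scomm p A q B v) = (\<lambda>m n. 0)" for v
    by (simp add: assms(1) cdiff_add cdiff_scale)
  thus ?thesis unfolding mode_local_def by blast
qed

lemma mode_local_sym:
  assumes "mode_local p A q B" shows "mode_local q B p A"
proof -
  obtain N where N: "\<forall>v. (cdiff ^^ N) (scomm p A q B v) = (\<lambda>m n. 0)" using assms by (auto simp: mode_local_def)
  have sw: "(cdiff ^^ N) (\<lambda>m n. f n m) = (\<lambda>m n. (-1) ^ N *\<^sub>C (cdiff ^^ N) f n m)" for f N
    by (induction N) (auto simp: cdiff_def fun_eq_iff scaleC_one cvs.scale_right_diff_distrib)
  have k: "koszul (q + 1) (p + 1) = koszul (p + 1) (q + 1)" "koszul (p + 1) (q + 1) * koszul (p + 1) (q + 1) = 1"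
    by (auto simp: koszul_def)
  have "scomm q B p A v = (\<lambda>m n. (- koszul (p + 1) (q + 1)) *\<^sub>C scomm p A q B v n m)" for v
    by (simp add: fun_eq_iff scomm_def k cvs.scale_right_diff_distrib scaleC_scaleC scaleC_one)
  hence "(cdiff ^^ N) (scomm q B p A v) = (\<lambda>m n. 0)" for v
    by (simp only: cdiff_scale sw[of N "scomm p A q B v"]) (simp add: N)
  thus ?thesis by (auto simp: mode_local_def)
qed

lemma mode_local_add:
  assumes "\<And>n. clinear (B n)" and "mode_local p A q B" "mode_local p A' q B"
  shows "mode_local p (\<lambda>n v. A n v + A' n v) q B"
proof (rule mode_localI)
  show "scomm p (\<lambda>n v. A n v + A' n v) q B v = (\<lambda>m n. scomm p A q B v m n + 1 *\<^sub>C scomm p A' q B v m n)" for v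
    by (simp add: fun_eq_iff scomm_def clinear_add[OF assms(1)] scaleC_add_right scaleC_one)
qed (use assms(2,3) in \<open>simp_all add: mode_local_def\<close>)

lemma mode_local_scale:
  assumes "\<And>n. clinear (B n)" and "mode_local p A q B"
  shows "mode_local p (\<lambda>n v. t *\<^sub>C A n v) q B"
proof -
  have "scomm p (\<lambda>n v. t *\<^sub>C A n v) q B v = (\<lambda>m n. t *\<^sub>C scomm p A q B v m n)" for v
    by (simp add: fun_eq_iff scomm_def clinear_scale[OF assms(1)] scaleC_scaleC cvs.scale_right_diff_distrib mult.commute)
  moreover obtain N where "\<forall>v. (cdiff ^^ N) (scomm p A q B v) = (\<lambda>m n. 0)" using assms(2) by (auto simp: mode_local_def)
  ultimately have "\<forall>v. (cdiff ^^ N) (scomm p (\<lambda>n v. t *\<^sub>C A n v) q B v) = (\<lambda>m n. 0)"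
    by (simp add: cdiff_scale)
  thus ?thesis unfolding mode_local_def by blast
qed

lemma mode_local_zero: "(\<And>n. clinear (B n)) \<Longrightarrow> mode_local p (\<lambda>n v. 0) q B"
  unfolding mode_local_def scomm_def by (intro exI[of _ 0]) (auto simp: fun_eq_iff clinear_zero)

text \<open>Passing from \<open>A\<close> to \<open>D A\<close> applies the operator \<open>S\<close> to the commutators, up to sign. As
  \<open>[cdiff, S] = 1\<close>, one more power of \<open>cdiff\<close> suffices.\<close>

lemma mode_local_deriv_family:
  assumes "\<And>n. clinear (B n)" and "mode_local p A q B"
  shows "mode_local p (deriv_family A) q B"
proof -
  obtain N where N: "\<forall>v. (cdiff ^^ N) (scomm p A q B v) = (\<lambda>m n. 0)" using assms by (auto simp: mode_local_def)
  define S where "S f = (\<lambda>m n. of_nat m *\<^sub>C f (m - 1) n)" for f :: "nat \<Rightarrow> nat \<Rightarrow> 'v"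
  have two: "2 *\<^sub>C x = x + (x::'v)" for x by (metis one_add_one scaleC_add_left scaleC_one)
  have 0: "cdiff (S f) = (\<lambda>m n. f m n + S (cdiff f) m n)" for f
  proof (rule ext, rule ext)
    fix m n show "cdiff (S f) m n = f m n + S (cdiff f) m n"
      by (cases m) (simp_all add: cdiff_def S_def scaleC_add_left scaleC_one cvs.scale_right_diff_distrib two)
  qed
  have 1: "(cdiff ^^ r) (S f) = (\<lambda>m n. of_nat r *\<^sub>C (cdiff ^^ (r - 1)) f m n + S ((cdiff ^^ r) f) m n)" for r f
  proof (induction r)
    case (Suc r)
    have c1: "cdiff (\<lambda>m n. of_nat r *\<^sub>C (cdiff ^^ (r - 1)) f m n + S ((cdiff ^^ r) f) m n)
      = (\<lambda>m n. of_nat r *\<^sub>C cdiff ((cdiff ^^ (r - 1)) f) m n + cdiff (S ((cdiff ^^ r) f)) m n)"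
      using cdiff_add[of 1] cdiff_scale[of 1] by simp
    have c2: "of_nat r *\<^sub>C cdiff ((cdiff ^^ (r - 1)) f) m n = of_nat r *\<^sub>C (cdiff ^^ r) f m n" for m n
      by (cases r) simp_all
    show ?case unfolding funpow.simps comp_apply Suc c1 c2 0 by (simp add: scaleC_add_left scaleC_one add_ac)
  qed simp
  have "scomm p (deriv_family A) q B v = (\<lambda>m n. (-1) *\<^sub>C S (scomm p A q B v) m n)" for v
    by (simp add: fun_eq_iff scomm_def S_def deriv_family_def clinear_uminus[OF assms(1)] clinear_scale[OF assms(1)]
        scaleC_scaleC cvs.scale_right_diff_distrib mult.commute)
  hence "(cdiff ^^ Suc N) (scomm p (deriv_family A) q B v) = (\<lambda>m n. 0)" for v
    by (simp only: cdiff_scale 1) (simp add: N S_def cdiff_def)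
  thus ?thesis unfolding mode_local_def by blast
qed


text \<open>For \<open>r = 0\<close> this is \<open>A\<^sub>n (D\<^sup>j b / j!)\<close> as expanded in \<open>conf_der_dp\<close>. Multiplication by \<open>z - w\<close> raises \<open>r\<close> by one up to
  sign (lemma \<open>shifted_step\<close>), and the terms with \<open>i < r\<close> are gone, so \<open>K\<close> steps reach zero.\<close>

definition shifted :: "nat \<Rightarrow> (nat \<Rightarrow> 'v \<Rightarrow> 'v) \<Rightarrow> 'v \<Rightarrow> nat \<Rightarrow> nat \<Rightarrow> int \<Rightarrow> 'v" where
  "shifted K A b r n j =
     (\<Sum>i<K. (if r \<le> i then of_nat (n choose (i - r)) else 0) *\<^sub>C dp (j - int n + int i - int r) (A i b))"

lemma shifted_0: "conf_der p A \<Longrightarrow> (\<And>i. i \<ge> K \<Longrightarrow> A i b = 0) \<Longrightarrow> shifted K A b 0 n j = A n (dp j b)"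
  by (simp add: shifted_def conf_der_dp[of p A K])

lemma shifted_neg: "j < 0 \<Longrightarrow> shifted K A b r n j = 0"
  unfolding shifted_def
proof (intro sum.neutral ballI)
  fix i assume "j < 0"
  thus "(if r \<le> i then of_nat (n choose (i - r)) else 0) *\<^sub>C dp (j - int n + int i - int r) (A i b) = 0"
    by (cases "r \<le> i \<and> i - r \<le> n") (auto simp: dp_neg binomial_eq_0)
qed

lemma shifted_large: "r \<ge> K \<Longrightarrow> shifted K A b r n j = 0"
  unfolding shifted_def by (intro sum.neutral) auto

lemma shifted_step: "shifted K A b r n (j - 1) - shifted K A b r (Suc n) j = - shifted K A b (Suc r) n j"
proof -
  have c: "(if r \<le> i then of_nat (n choose (i - r)) else 0) - (if r \<le> i then of_nat (Suc n choose (i - r)) else 0)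
     = - (if Suc r \<le> i then of_nat (n choose (i - Suc r)) else 0 :: complex)" for i
  proof (cases "Suc r \<le> i")
    case True
    then obtain k where "i - r = Suc k" "i - Suc r = k" by (metis Suc_diff_Suc Suc_le_lessD)
    thus ?thesis using True by simp
  qed (cases "i = r"; simp)
  have e: "j - 1 - int n + int i - int r = j - int (Suc n) + int i - int r"
    "j - int n + int i - int (Suc r) = j - int (Suc n) + int i - int r" for i by simp_all
  show ?thesis
    unfolding shifted_def e sum_subtractf[symmetric] cvs.scale_left_diff_distrib[symmetric] sum_negf[symmetric] c by simp
qed

text \<open>The analogue of Dong's lemma. In \<open>[\<Sum>j (D\<^sup>j a/j!) B\<^bsub>m+j\<^esub>, C\<^sub>n]\<close> either \<open>C\<^sub>n\<close> meets \<open>B\<^bsub>m+j\<^esub>\<close>, which \<open>cdiff\<close>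
  treats as \<open>[B\<^sub>m, C\<^sub>n]\<close>, or it hits \<open>D\<^sup>j a/j!\<close>, which \<open>cdiff\<close> treats as in \<open>shifted_step\<close>.\<close>

lemma mode_local_mul_family:
  assumes a: "a \<in> pv p" and B: "conf_der q B" and C: "conf_der r C" and l: "mode_local q B r C"
  shows "mode_local (p + q) (mul_family a B) r C"
proof (rule mode_localI)
  note vB = conf_der_vanishing[OF B] and vC = conf_der_vanishing[OF C]
  let ?f = "\<lambda>v m n. fsum (\<lambda>j. dp (int j) a \<star> scomm q B r C v (m + j) n)"
  let ?g = "\<lambda>v m n. fsum (\<lambda>j. C n (dp (int j) a) \<star> B (m + j) v)"
  have vsc: "vanishing (\<lambda>m. scomm q B r C v m n)" for v n
  proof -
    have "vanishing (\<lambda>m. B m (C n v) + (- koszul (q + 1) (r + 1)) *\<^sub>C C n (B m v))"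
      by (intro vanishing_add vB vanishing_scale vanishing_clinear[where h = "\<lambda>_. C n"] conf_der_clinear[OF C])
    thus ?thesis by (simp add: scomm_def)
  qed
  show "scomm (p + q) (mul_family a B) r C v = (\<lambda>m n. ?f v m n + (- koszul (p + q + 1) (r + 1)) *\<^sub>C ?g v m n)" for v
  proof (rule ext, rule ext)
    fix m n
    let ?k = "koszul (p + q + 1) (r + 1)"
    have k: "?k * koszul (r + 1) p = koszul (q + 1) (r + 1)" by (cases p; cases q; cases r; simp)
    have v1: "vanishing (\<lambda>j. dp (int j) a \<star> B (m + j) (C n v))"
      and v2: "vanishing (\<lambda>j. C n (dp (int j) a) \<star> B (m + j) v)"
      and v3: "vanishing (\<lambda>j. dp (int j) a \<star> C n (B (m + j) v))"
      by (intro vanishing_mul vanishing_clinear[where h = "\<lambda>_. C n"] conf_der_clinear[OF C] vanishing_shift vB)+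
    have "scomm (p + q) (mul_family a B) r C v m n
      = fsum (\<lambda>j. dp (int j) a \<star> B (m + j) (C n v)) - ?k *\<^sub>C fsum (\<lambda>j. C n (dp (int j) a \<star> B (m + j) v))"
      by (simp add: scomm_def mul_family_def fsum_clinear[OF conf_der_clinear[OF C] mul_family_vanishing[OF B]])
    also have "(\<lambda>j. C n (dp (int j) a \<star> B (m + j) v)) = (\<lambda>j. C n (dp (int j) a) \<star> B (m + j) v + koszul (r + 1) p *\<^sub>C (dp (int j) a \<star> C n (B (m + j) v)))"
      by (simp add: conf_der_mul[OF C dp_pv[OF a]])
    also have "fsum \<dots> = ?g v m n + koszul (r + 1) p *\<^sub>C fsum (\<lambda>j. dp (int j) a \<star> C n (B (m + j) v))"
      by (simp add: fsum_add[OF v2 vanishing_scale[OF v3]] fsum_scale[OF v3])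
    also have "fsum (\<lambda>j. dp (int j) a \<star> B (m + j) (C n v)) - ?k *\<^sub>C \<dots>
      = (fsum (\<lambda>j. dp (int j) a \<star> B (m + j) (C n v)) - koszul (q + 1) (r + 1) *\<^sub>C fsum (\<lambda>j. dp (int j) a \<star> C n (B (m + j) v))) - ?k *\<^sub>C ?g v m n"
      by (simp add: scaleC_add_right scaleC_scaleC k)
    also have "fsum (\<lambda>j. dp (int j) a \<star> B (m + j) (C n v)) - koszul (q + 1) (r + 1) *\<^sub>C fsum (\<lambda>j. dp (int j) a \<star> C n (B (m + j) v)) = ?f v m n"
      by (simp add: scomm_def clinear_diff[OF clinear_mul_right] mul_scale_right fsum_diff[OF v1 vanishing_scale[OF v3]] fsum_scale[OF v3])
    finally show "scomm (p + q) (mul_family a B) r C v m n = ?f v m n + (- ?k) *\<^sub>C ?g v m n" by simp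
  qed
  show "\<exists>N. \<forall>v. (cdiff ^^ N) (?f v) = (\<lambda>m n. 0)"
  proof -
    obtain N where N: "\<forall>v. (cdiff ^^ N) (scomm q B r C v) = (\<lambda>m n. 0)" using l by (auto simp: mode_local_def)
    have 1: "(\<forall>n. vanishing (\<lambda>m. (cdiff ^^ t) G m n)) \<and>
      (cdiff ^^ t) (\<lambda>m n. fsum (\<lambda>j. dp (int j) a \<star> G (m + j) n)) = (\<lambda>m n. fsum (\<lambda>j. dp (int j) a \<star> (cdiff ^^ t) G (m + j) n))"
      if G: "\<And>n. vanishing (\<lambda>m. G m n)" for G t
    proof (induction t)
      case (Suc t)
      let ?G = "(cdiff ^^ t) G"
      have v: "vanishing (\<lambda>m. ?G m n)" for n using Suc by blast
      have "vanishing (\<lambda>m. ?G (Suc m) n + (-1) *\<^sub>C ?G m (Suc n))" for n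
        by (intro vanishing_add vanishing_scale vanishing_Suc v)
      hence 1: "vanishing (\<lambda>m. cdiff ?G m n)" for n by (simp add: cdiff_def)
      have "fsum (\<lambda>j. dp (int j) a \<star> cdiff ?G (m + j) n)
         = fsum (\<lambda>j. dp (int j) a \<star> ?G (Suc m + j) n) - fsum (\<lambda>j. dp (int j) a \<star> ?G (m + j) (Suc n))" for m n
      proof -
        have "cdiff ?G (m + j) n = ?G (Suc m + j) n - ?G (m + j) (Suc n)" for j
          by (simp add: cdiff_def[of ?G])
        thus ?thesis
          by (simp only: clinear_diff[OF clinear_mul_right]
              fsum_diff[OF vanishing_mul[OF vanishing_shift[OF v]] vanishing_mul[OF vanishing_shift[OF v]]])
      qed
      hence "cdiff (\<lambda>m n. fsum (\<lambda>j. dp (int j) a \<star> ?G (m + j) n)) = (\<lambda>m n. fsum (\<lambda>j. dp (int j) a \<star> cdiff ?G (m + j) n))"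
        by (intro ext) (simp add: cdiff_def[of "\<lambda>m n. fsum (\<lambda>j. dp (int j) a \<star> ?G (m + j) n)"])
      thus ?case using 1 Suc by simp
    qed (use G in simp)
    show ?thesis using 1[OF vsc] by (intro exI[of _ N]) (simp add: N)
  qed
  show "\<exists>N. \<forall>v. (cdiff ^^ N) (?g v) = (\<lambda>m n. 0)"
  proof -
    obtain K where K: "\<And>i. i \<ge> K \<Longrightarrow> C i a = 0" using vC[of a] unfolding vanishing_def by blast
    have "(cdiff ^^ t) (?g v) = (\<lambda>m n. (-1) ^ t *\<^sub>C fsum (\<lambda>j. shifted K C a t n (int j) \<star> B (m + j) v))" for t v
    proof (induction t)
      case 0 thus ?case by (simp add: shifted_0[OF C K])
    next
      case (Suc t)
      let ?h = "\<lambda>m n. fsum (\<lambda>j. shifted K C a t n (int j) \<star> B (m + j) v)"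
      have "cdiff ?h m n = - fsum (\<lambda>j. shifted K C a (Suc t) n (int j) \<star> B (m + j) v)" for m n
      proof -
        have v: "vanishing (\<lambda>j. x j \<star> B (m + j) v)" for x m by (intro vanishing_mul vanishing_shift vB)
        have "?h (Suc m) n = fsum (\<lambda>j. shifted K C a t n (int j - 1) \<star> B (m + j) v)"
          by (subst (2) fsum_Suc[OF v]) (simp add: shifted_neg)
        hence "cdiff ?h m n = fsum (\<lambda>j. (shifted K C a t n (int j - 1) - shifted K C a t (Suc n) (int j)) \<star> B (m + j) v)"
          by (simp add: cdiff_def clinear_diff[OF clinear_mul_left] fsum_diff[OF v v])
        also have "\<dots> = fsum (\<lambda>j. (-1) *\<^sub>C (shifted K C a (Suc t) n (int j) \<star> B (m + j) v))"
          by (simp add: shifted_step clinear_uminus[OF clinear_mul_left])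
        finally show ?thesis by (simp only: fsum_scale[OF v]) simp
      qed
      moreover have "(cdiff ^^ Suc t) (?g v) = (\<lambda>m n. (-1) ^ t *\<^sub>C cdiff ?h m n)"
        using cdiff_scale[of 1 _ ?h] by (simp add: Suc)
      ultimately show ?case by (simp add: fun_eq_iff)
    qed
    thus ?thesis by (intro exI[of _ K]) (simp add: shifted_large)
  qed
qed

lemma mode_local_product_family:
  assumes "a \<in> pv p" "b \<in> pv q" "conf_der p A" "conf_der q B" "conf_der r C" "mode_local p A r C" "mode_local q B r C"
  shows "mode_local (p + q) (product_family p a A q b B) r C"
  unfolding product_family_def
  by (intro mode_local_add mode_local_scale mode_local_mul_family[OF assms(1,4,5,7)] mode_local_mul_family[OF assms(2,3,5,6), unfolded add.commute[of q p]]
      conf_der_clinear[OF assms(5)])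

end

section \<open>Extending a bracket from generators to products\<close>


locale bracket_generators = comm_diff_superalgebra +
  fixes gens :: "bit \<Rightarrow> 'a \<Rightarrow> (nat \<Rightarrow> 'a \<Rightarrow> 'a) \<Rightarrow> bool"
  assumes gens_pv: "gens p a A \<Longrightarrow> a \<in> pv p"
    and gens_conf_der: "gens p a A \<Longrightarrow> conf_der p A"
    and gens_skew: "gens p a A \<Longrightarrow> gens q b B \<Longrightarrow> skew p a A q b B"
    and gens_mode_local: "gens p a A \<Longrightarrow> gens q b B \<Longrightarrow> mode_local p A q B"
begin

text \<open>\<open>state_bracket p a A\<close>: some way of writing the state \<open>a\<close> in terms of the generators makes \<open>A\<close> the bracket
  with \<open>a\<close>. That \<open>A\<close> depends on \<open>a\<close> alone is proved below in \<open>state_bracket_unique\<close>.\<close>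

inductive state_bracket :: "bit \<Rightarrow> 'a \<Rightarrow> (nat \<Rightarrow> 'a \<Rightarrow> 'a) \<Rightarrow> bool" where
  one: "state_bracket 0 one (\<lambda>n v. 0)"
| gen: "gens p a A \<Longrightarrow> state_bracket p a A"
| add: "state_bracket p a A \<Longrightarrow> state_bracket p b B \<Longrightarrow> state_bracket p (a + b) (\<lambda>n v. A n v + B n v)"
| scale: "state_bracket p a A \<Longrightarrow> state_bracket p (t *\<^sub>C a) (\<lambda>n v. t *\<^sub>C A n v)"
| deriv: "state_bracket p a A \<Longrightarrow> state_bracket p (D a) (deriv_family A)"
| mul: "state_bracket p a A \<Longrightarrow> state_bracket q b B \<Longrightarrow> state_bracket (p + q) (a \<star> b) (product_family p a A q b B)"

lemma state_bracket_pv: "state_bracket p a A \<Longrightarrow> a \<in> pv p"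
  by (induction rule: state_bracket.induct) (blast intro: pv_one gens_pv pv_add pv_scale D_pv pv_mul)+

lemma state_bracket_conf_der: "state_bracket p a A \<Longrightarrow> conf_der p A"
  by (induction rule: state_bracket.induct)
    (blast intro: conf_der_zero gens_conf_der conf_der_add conf_der_scale conf_der_deriv_family conf_der_product_family state_bracket_pv)+

lemma state_bracket_skew_of_gens:
  assumes "\<And>q b B. gens q b B \<Longrightarrow> skew q b B r c C" and C: "conf_der r C"
  shows "state_bracket p a A \<Longrightarrow> skew p a A r c C"
  by (induction rule: state_bracket.induct)
    (blast intro: C assms(1) skew_one skew_add skew_scale skew_deriv_family skew_product_family state_bracket_pv)+

text \<open>Induction on the first state needs skew-symmetry with an arbitrary second one for generators; by
  symmetry this is the same induction on the second state.\<close>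

lemma state_bracket_skew:
  assumes "state_bracket p a A" "state_bracket q b B"
  shows "skew p a A q b B"
proof (rule state_bracket_skew_of_gens[OF _ state_bracket_conf_der[OF assms(2)] assms(1)])
  fix r c C assume g: "gens r c C"
  have "skew q b B r c C"
    by (rule state_bracket_skew_of_gens[OF gens_skew[OF _ g] gens_conf_der[OF g] assms(2)])
  thus "skew r c C q b B"
    by (rule skew_sym[OF state_bracket_conf_der[OF assms(2)] gens_conf_der[OF g]])
qed

lemma state_bracket_mode_local_of_gens:
  assumes "\<And>q b B. gens q b B \<Longrightarrow> mode_local q B r C" and C: "conf_der r C"
  shows "state_bracket p a A \<Longrightarrow> mode_local p A r C"
  by (induction rule: state_bracket.induct)
    (blast intro: C assms(1) mode_local_zero mode_local_add mode_local_scale mode_local_deriv_family mode_local_product_family state_bracket_pv state_bracket_conf_der conf_der_clinear[OF C])+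

lemma state_bracket_mode_local:
  assumes "state_bracket p a A" "state_bracket q b B"
  shows "mode_local p A q B"
proof (rule state_bracket_mode_local_of_gens[OF _ state_bracket_conf_der[OF assms(2)] assms(1)])
  fix r c C assume g: "gens r c C"
  have "mode_local q B r C"
    by (rule state_bracket_mode_local_of_gens[OF gens_mode_local[OF _ g] gens_conf_der[OF g] assms(2)])
  thus "mode_local r C q B" by (rule mode_local_sym)
qed

end

section \<open>Locality of the fields\<close>

lemma raviolo_cases2:
  assumes "\<And>i j. b = Zp i \<Longrightarrow> c = Zp j \<Longrightarrow> P" "\<And>i j. b = Zp i \<Longrightarrow> c = Om j \<Longrightarrow> P"
    "\<And>i j. b = Om i \<Longrightarrow> c = Zp j \<Longrightarrow> P" "\<And>i j. b = Om i \<Longrightarrow> c = Om j \<Longrightarrow> P"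
  shows P
  using assms by (cases b; cases c) blast+

text \<open>The coefficient that arises on the right of the second locality condition:
  the coefficient of \<open>t\<^sup>i\<close> in \<open>(1 + t)\<^bsup>-m-1\<^esup> (1 + t)\<^sup>k\<close>, computed in two ways.\<close>

lemma locality_coefficient:
  "(\<Sum>n\<le>i. (-1) ^ n * of_nat (m + n choose n) * of_nat (k choose (i - n))) = ((of_nat k - of_nat m - 1) gchoose i :: complex)"
proof (induction k arbitrary: i)
  case 0
  have "((0 - of_nat m - 1) gchoose i :: complex) = (-1) ^ i * ((of_nat i - (0 - of_nat m - 1) - 1) gchoose i)"
    by (rule gbinomial_negated_upper)
  also have "of_nat i - (0 - of_nat m - 1) - 1 = (of_nat (m + i) :: complex)" by simp
  finally have "((0 - of_nat m - 1) gchoose i :: complex) = (-1) ^ i * of_nat (m + i choose i)"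
    by (simp only: binomial_gbinomial)
  moreover have "(\<Sum>n\<le>i. (-1) ^ n * of_nat (m + n choose n) * of_nat (0 choose (i - n)) :: complex)
    = (\<Sum>n\<le>i. if n = i then (-1) ^ i * of_nat (m + i choose i) else 0)"
    by (rule sum.cong) auto
  ultimately show ?case by simp
next
  case (Suc k)
  show ?case
  proof (cases i)
    case (Suc h)
    let ?f = "\<lambda>n. (-1) ^ n * of_nat (m + n choose n) :: complex"
    have "(\<Sum>n\<le>Suc h. ?f n * of_nat (Suc k choose (Suc h - n)))
      = (\<Sum>n\<le>h. ?f n * of_nat (k choose (h - n))) + (\<Sum>n\<le>Suc h. ?f n * of_nat (k choose (Suc h - n)))"
      by (simp add: Suc_diff_le algebra_simps sum.distrib)
    also have "\<dots> = ((of_nat k - of_nat m - 1) gchoose h) + ((of_nat k - of_nat m - 1) gchoose Suc h)"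
      by (simp only: Suc.IH)
    also have "\<dots> = ((of_nat k - of_nat m - 1 + 1) gchoose Suc h)" by (rule gbinomial_Suc_Suc[symmetric])
    finally show ?thesis by (simp only: Suc) (simp add: algebra_simps)
  qed simp
qed

context comm_diff_superalgebra
begin

text \<open>Expanding \<open>B\<^sub>l (D\<^sup>M a/M!)\<close> by \<open>conf_der_dp\<close> and then the \<open>B\<^sub>j a\<close> by skew-symmetry gives a Vandermonde sum. This is
  the left side of the second locality condition.\<close>

lemma skew_dp:
  assumes A: "conf_der p A" and B: "conf_der q B" and s: "skew q b B p a A" and K: "\<And>i. i \<ge> K \<Longrightarrow> A i b = 0"
  shows "B l (dp (int M) a) = - (koszul (p + 1) (q + 1) *\<^sub>C
    (\<Sum>i<K. ((-1) ^ i * of_nat (M + i choose i)) *\<^sub>C dp (int M - int l + int i) (A i b)))"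
proof -
  let ?k = "koszul (p + 1) (q + 1)"
  have Ba: "B j a = - (?k *\<^sub>C fsum (\<lambda>t. (-1) ^ (j + t) *\<^sub>C dp (int t) (A (j + t) b)))" for j
    using s unfolding skew_def by (simp add: koszul_def)
  let ?F = "\<lambda>j t. ((-1) ^ (j + t) * of_nat (l choose j) * of_nat (nat (int M - int l + int (j + t)) choose t)) *\<^sub>C
     dp (int M - int l + int (j + t)) (A (j + t) b)"
  have F0: "?F j t = 0" if "j + t \<ge> K" for j t using K[OF that] by simp
  have vF: "vanishing (\<lambda>j. fsum (?F j))" by (rule vanishingI[of K]) (simp add: F0 del: of_nat_add)
  have B0: "B j a = 0" if "j \<ge> K" for j
    using that by (simp add: Ba K)
  have "B l (dp (int M) a) = (\<Sum>j<K. of_nat (l choose j) *\<^sub>C dp (int M - int l + int j) (B j a))"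
    by (rule conf_der_dp[OF B B0])
  also have "\<dots> = (\<Sum>j<K. (- ?k) *\<^sub>C fsum (?F j))"
  proof (rule sum.cong)
    fix j
    have "of_nat (l choose j) *\<^sub>C dp (int M - int l + int j) (B j a)
      = (- ?k) *\<^sub>C (of_nat (l choose j) *\<^sub>C dp (int M - int l + int j) (fsum (\<lambda>t. (-1) ^ (j + t) *\<^sub>C dp (int t) (A (j + t) b))))"
      by (simp add: Ba clinear_uminus[OF clinear_dp] clinear_scale[OF clinear_dp] scaleC_scaleC mult.commute)
    also have "of_nat (l choose j) *\<^sub>C dp (int M - int l + int j) (fsum (\<lambda>t. (-1) ^ (j + t) *\<^sub>C dp (int t) (A (j + t) b)))
      = fsum (\<lambda>t. of_nat (l choose j) *\<^sub>C dp (int M - int l + int j) ((-1) ^ (j + t) *\<^sub>C dp (int t) (A (j + t) b)))"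
      by (rule fsum_clinear[OF clinear_compose[OF clinear_scaleC clinear_dp] skew_vanishing[OF A]])
    also have "\<dots> = fsum (?F j)"
      by (rule arg_cong[of _ _ fsum], rule ext)
        (simp add: clinear_scale[OF clinear_dp] dp_dp scaleC_scaleC mult_ac add_ac)
    finally show "of_nat (l choose j) *\<^sub>C dp (int M - int l + int j) (B j a) = (- ?k) *\<^sub>C fsum (?F j)" .
  qed simp
  also have "\<dots> = (- ?k) *\<^sub>C fsum (\<lambda>j. fsum (?F j))"
    unfolding cvs.scale_sum_right[symmetric] by (subst (2) fsum_eq[of K]) (simp_all add: F0 del: of_nat_add)
  also have "fsum (\<lambda>j. fsum (?F j)) = fsum (\<lambda>i. \<Sum>j\<le>i. ?F j (i - j))" by (rule fsum_triangle[OF F0])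
  also have "\<dots> = fsum (\<lambda>i. ((-1) ^ i * of_nat (M + i choose i)) *\<^sub>C dp (int M - int l + int i) (A i b))"
  proof (rule arg_cong[of _ _ fsum], rule ext)
    fix i
    let ?N = "nat (int M - int l + int i)"
    have "(\<Sum>j\<le>i. ?F j (i - j)) = ((-1) ^ i * of_nat (\<Sum>j\<le>i. (l choose j) * (?N choose (i - j)))) *\<^sub>C dp (int M - int l + int i) (A i b)"
      by (simp add: cvs.scale_sum_left sum_distrib_left mult.assoc)
    also have "(\<Sum>j\<le>i. (l choose j) * (?N choose (i - j))) = l + ?N choose i" by (rule vandermonde)
    also have "((-1) ^ i * of_nat (l + ?N choose i)) *\<^sub>C dp (int M - int l + int i) (A i b)
       = ((-1) ^ i * of_nat (M + i choose i)) *\<^sub>C dp (int M - int l + int i) (A i b)"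
    proof (cases "int M - int l + int i < 0")
      case False
      hence "l + ?N = M + i" by linarith
      thus ?thesis by simp
    qed (simp add: dp_neg)
    finally show "(\<Sum>j\<le>i. ?F j (i - j)) = \<dots>" .
  qed
  also have "\<dots> = (\<Sum>i<K. ((-1) ^ i * of_nat (M + i choose i)) *\<^sub>C dp (int M - int l + int i) (A i b))"
    by (rule fsum_eq) (simp add: K)
  finally show ?thesis by simp
qed

text \<open>The modes of a field: multiplications by divided powers at negative index, a conformal derivation
  at nonnegative index.\<close>

definition modes :: "'v \<Rightarrow> (nat \<Rightarrow> 'v \<Rightarrow> 'v) \<Rightarrow> int \<Rightarrow> 'v \<Rightarrow> 'v" where
  "modes a A m v = (if m < 0 then dp (- m - 1) a \<star> v else A (nat m) v)"

lemma coefficient_modes: "coefficient (modes a A) (Zp n) v = dp (int n) a \<star> v"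
  "coefficient (modes a A) (Om n) v = A n v"
  by (simp_all add: modes_def)

text \<open>The four types of coefficients of the commutator behave as follows. At \<open>z\<^sup>i w\<^sup>j\<close> it vanishes by
  supercommutativity; at \<open>\<Omega>\<^sub>z\<^sup>i w\<^sup>j\<close> it is multiplication by \<open>A\<^sub>i (D\<^sup>j b/j!)\<close>; at \<open>z\<^sup>i \<Omega>\<^sub>w\<^sup>j\<close> multiplication by
  \<open>B\<^sub>j (D\<^sup>i a/i!)\<close>; at \<open>\<Omega>\<^sub>z\<^sup>i \<Omega>\<^sub>w\<^sup>j\<close> it is the commutator of derivations. The first condition holds by
  \<open>shifted_step\<close> and \<open>mode_local\<close>. The second one only relates coefficients at \<open>\<Omega>\<^sub>z\<^sup>k \<Omega>\<^sub>w\<^sup>l\<close>, where the left side comes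
  from \<open>z\<^bsup>m-k\<^esup> \<Omega>\<^sub>w\<^sup>l\<close> and the right side from the \<open>\<Omega>\<^sub>z\<^sup>i w\<^sup>j\<close>, so it amounts to skew-symmetry.\<close>

lemma mutually_local_modes:
  assumes a: "a \<in> pv p" and b: "b \<in> pv q" and A: "conf_der p A" and B: "conf_der q B"
    and sk: "skew p a A q b B" and lc: "mode_local p A q B"
  shows "mutually_local p q (modes a A) (modes b B)"
proof -
  obtain N0 where N0: "\<And>v. (cdiff ^^ N0) (scomm p A q B v) = (\<lambda>m n. 0)" using lc unfolding mode_local_def by blast
  obtain KA where KA: "\<forall>i\<ge>KA. A i b = 0" using conf_der_vanishing[OF A] unfolding vanishing_def by blast
  obtain KB where KB: "\<forall>i\<ge>KB. B i a = 0" using conf_der_vanishing[OF B] unfolding vanishing_def by blast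
  define N where "N = max N0 (max KA KB)"
  have K: "\<And>i. i \<ge> N \<Longrightarrow> A i b = 0" "\<And>i. i \<ge> N \<Longrightarrow> B i a = 0" using KA KB by (auto simp: N_def)
  let ?S = "shifted N A b" and ?S' = "shifted N B a"
  note sA0 = shifted_0[OF A K(1)] and sB0 = shifted_0[OF B K(2)]
  let ?k = "- (koszul p q * koszul 1 p)"
  show ?thesis
    unfolding mutually_local_def
  proof (intro exI[of _ N] allI conjI)
    fix v b' c' and m
    let ?F = "field_commutator p q (modes a A) (modes b B) v"
    have ZZ: "?F (Zp i) (Zp j) = 0" for i j
      using mul_commute[OF dp_pv[OF a, of "int i"] dp_pv[OF b, of "int j"]]
      by (simp add: field_commutator_def coefficient_modes mul_assoc[symmetric] mul_scale_left scaleC_one del: coefficient.simps)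
    have OZ: "?F (Om i) (Zp j) = koszul 1 q *\<^sub>C (?S 0 i (int j) \<star> v)" for i j
      by (simp add: field_commutator_def coefficient_modes sA0 conf_der_mul[OF A dp_pv[OF b]] scaleC_add_right scaleC_scaleC del: coefficient.simps)
    have ZO: "?F (Zp i) (Om j) = ?k *\<^sub>C (?S' 0 j (int i) \<star> v)" for i j
      by (simp add: field_commutator_def coefficient_modes sB0 conf_der_mul[OF B dp_pv[OF a]] scaleC_add_right scaleC_scaleC del: coefficient.simps)
    have OO: "?F (Om i) (Om j) = koszul 1 (q + 1) *\<^sub>C scomm p A q B v i j" for i j
      by (simp add: field_commutator_def coefficient_modes scomm_def cvs.scale_right_diff_distrib scaleC_scaleC del: coefficient.simps)
    have mzw: "mult_z_minus_w G (Zp i) (Zp j) = (if 1 \<le> i then G (Zp (i - 1)) (Zp j) else 0) - (if 1 \<le> j then G (Zp i) (Zp (j - 1)) else 0)"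
      "mult_z_minus_w G (Om i) (Zp j) = G (Om (Suc i)) (Zp j) - (if 1 \<le> j then G (Om i) (Zp (j - 1)) else 0)"
      "mult_z_minus_w G (Zp i) (Om j) = (if 1 \<le> i then G (Zp (i - 1)) (Om j) else 0) - G (Zp i) (Om (Suc j))"
      "mult_z_minus_w G (Om i) (Om j) = G (Om (Suc i)) (Om j) - G (Om i) (Om (Suc j))" for G :: "raviolo \<Rightarrow> raviolo \<Rightarrow> 'v" and i j
      by (simp_all add: mult_z_minus_w_def mult_z_def mult_w_def scaleC_one)
    have mwz: "mult_w_minus_z G (Zp i) (Zp j) = (if 1 \<le> j then G (Zp i) (Zp (j - 1)) else 0) - (if 1 \<le> i then G (Zp (i - 1)) (Zp j) else 0)"
      "mult_w_minus_z G (Om i) (Zp j) = (if 1 \<le> j then G (Om i) (Zp (j - 1)) else 0) - G (Om (Suc i)) (Zp j)"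
      "mult_w_minus_z G (Zp i) (Om j) = G (Zp i) (Om (Suc j)) - (if 1 \<le> i then G (Zp (i - 1)) (Om j) else 0)"
      "mult_w_minus_z G (Om i) (Om j) = G (Om i) (Om (Suc j)) - G (Om (Suc i)) (Om j)" for G :: "raviolo \<Rightarrow> raviolo \<Rightarrow> 'v" and i j
      by (simp_all add: mult_w_minus_z_def mult_z_def mult_w_def scaleC_one)
    have pred: "(if 1 \<le> j then ?S r n (int (j - 1)) else 0) = ?S r n (int j - 1)"
      "(if 1 \<le> j then ?S' r n (int (j - 1)) else 0) = ?S' r n (int j - 1)" for j r n
      by (cases j; simp add: shifted_neg)+
    \<comment> \<open>the effect of powers of \<open>z - w\<close> on each type of coefficient\<close>
    have P: "(mult_z_minus_w ^^ r) ?F (Zp i) (Zp j) = 0 \<and>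
        (mult_z_minus_w ^^ r) ?F (Om i) (Zp j) = koszul 1 q *\<^sub>C (?S r i (int j) \<star> v) \<and>
        (mult_z_minus_w ^^ r) ?F (Zp i) (Om j) = ((-1) ^ r * ?k) *\<^sub>C (?S' r j (int i) \<star> v) \<and>
        (mult_z_minus_w ^^ r) ?F (Om i) (Om j) = koszul 1 (q + 1) *\<^sub>C (cdiff ^^ r) (scomm p A q B v) i j" for r i j
    proof (induction r arbitrary: i j)
      case 0 show ?case by (simp add: ZZ OZ ZO OO)
    next
      case (Suc r)
      let ?G = "(mult_z_minus_w ^^ r) ?F"
      have z: "(if b then x *\<^sub>C (y \<star> v) else 0) = x *\<^sub>C ((if b then y else 0) \<star> v)" for b x and y :: 'v by simp
      have OZ: "mult_z_minus_w ?G (Om i) (Zp j) = koszul 1 q *\<^sub>C (?S (Suc r) i (int j) \<star> v)"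
      proof -
        have "mult_z_minus_w ?G (Om i) (Zp j) = koszul 1 q *\<^sub>C (- (?S r i (int j - 1) - ?S r (Suc i) (int j)) \<star> v)"
          by (simp only: mzw Suc z pred cvs.scale_right_diff_distrib[symmetric] clinear_diff[OF clinear_mul_left, symmetric] minus_diff_eq)
        thus ?thesis by (simp only: shifted_step minus_minus)
      qed
      have ZO: "mult_z_minus_w ?G (Zp i) (Om j) = ((-1) ^ Suc r * ?k) *\<^sub>C (?S' (Suc r) j (int i) \<star> v)"
      proof -
        have "mult_z_minus_w ?G (Zp i) (Om j) = ((-1) ^ r * ?k) *\<^sub>C ((?S' r j (int i - 1) - ?S' r (Suc j) (int i)) \<star> v)"
          by (simp only: mzw Suc z pred cvs.scale_right_diff_distrib[symmetric] clinear_diff[OF clinear_mul_left, symmetric])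
        thus ?thesis by (simp only: shifted_step clinear_uminus[OF clinear_mul_left]) simp
      qed
      show ?case using OZ ZO by (simp add: mzw Suc cdiff_def cvs.scale_right_diff_distrib)
    qed
    show "(mult_z_minus_w ^^ (N + 1)) ?F b' c' = 0"
    proof (rule raviolo_cases2[of b' c'])
      fix i j assume "b' = Om i" "c' = Om j"
      moreover have "(cdiff ^^ (N + 1)) (scomm p A q B v) = (\<lambda>m n. 0)"
        by (rule cdiff_mono[OF N0]) (simp add: N_def)
      ultimately show ?thesis by (simp only: P) simp
    qed (simp_all only: P shifted_large[of N "N + 1"] le_add1 mul_zero cvs.scale_zero_right)
    \<comment> \<open>the summands on the right of the second condition; only \<open>\<Omega>\<^sub>z\<^sup>k \<Omega>\<^sub>w\<^sup>l\<close> occurs in them\<close>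
    define H where "H r = (\<lambda>n. (mult_w_minus_z ^^ n) (mult_w (Om r) ?F))" for r
    have H0: "H r n (Zp k) c = 0 \<and> H r n c (Zp k) = 0" for r n k c
    proof (induction n arbitrary: k c)
      case 0
      have "mult_w (Om r) ?F (Zp k) c = 0" for k c by (cases c) (auto simp: mult_w_def ZZ)
      moreover have "mult_w (Om r) ?F c (Zp k) = 0" for k c by (simp add: mult_w_def)
      ultimately show ?case by (simp add: H_def)
    next
      case (Suc n)
      have "H r (Suc n) = mult_w_minus_z (H r n)" by (simp add: H_def)
      thus ?case by (cases c) (auto simp: mwz Suc)
    qed
    have H1: "H r n (Om k) (Om l) = ((-1) ^ n * - koszul 1 q) *\<^sub>C (?S n k (int r - int l) \<star> v)" for r n k l
    proof (induction n arbitrary: k l)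
      case 0
      have "mult_w (Om r) ?F (Om k) (Om l) = (- koszul 1 q) *\<^sub>C (?S 0 k (int r - int l) \<star> v)"
        by (cases "l \<le> r") (simp_all add: mult_w_def OZ of_nat_diff shifted_neg)
      thus ?case by (simp add: H_def)
    next
      case (Suc n)
      have "H r (Suc n) = mult_w_minus_z (H r n)" by (simp add: H_def)
      hence "H r (Suc n) (Om k) (Om l) = ((-1) ^ n * - koszul 1 q) *\<^sub>C
         ((?S n k (int r - int l - 1) - ?S n (Suc k) (int r - int l)) \<star> v)"
        by (simp add: mwz Suc clinear_diff[OF clinear_mul_left] cvs.scale_right_diff_distrib algebra_simps)
      thus ?case by (simp only: shifted_step clinear_uminus[OF clinear_mul_left]) simp
    qed
    show "mult_z (Om m) ?F b' c' = (\<Sum>n\<le>N. of_nat (m + n choose n) *\<^sub>C (mult_w_minus_z ^^ n) (mult_w (Om (m + n)) ?F) b' c')"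
      unfolding H_def[symmetric, THEN fun_cong]
    proof (rule raviolo_cases2[of b' c'])
      fix k l assume bc: "b' = Om k" "c' = Om l"
      let ?d = "\<lambda>i. dp (int m - int l - int k + int i) (A i b)"
      have e: "?S n k (int (m + n) - int l) = (\<Sum>i<N. (if n \<le> i then of_nat (k choose (i - n)) else 0) *\<^sub>C ?d i)" for n
        unfolding shifted_def by (intro sum.cong refl arg_cong2[of _ _ _ _ "(*\<^sub>C)"] arg_cong2[of _ _ _ _ dp]) auto
      have "(\<Sum>n\<le>N. of_nat (m + n choose n) *\<^sub>C H (m + n) n b' c')
        = (- koszul 1 q) *\<^sub>C ((\<Sum>n\<le>N. ((-1) ^ n * of_nat (m + n choose n)) *\<^sub>C ?S n k (int (m + n) - int l)) \<star> v)"
        by (simp add: bc H1 clinear_sum[OF clinear_mul_left] mul_scale_left cvs.scale_sum_right scaleC_scaleC mult_ac)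
      also have "(\<Sum>n\<le>N. ((-1) ^ n * of_nat (m + n choose n)) *\<^sub>C ?S n k (int (m + n) - int l))
        = (\<Sum>i<N. (\<Sum>n\<le>N. (-1) ^ n * of_nat (m + n choose n) * (if n \<le> i then of_nat (k choose (i - n)) else 0)) *\<^sub>C ?d i)"
        unfolding e cvs.scale_sum_right scaleC_scaleC cvs.scale_sum_left by (rule sum.swap)
      also have "\<dots> = (\<Sum>i<N. ((of_nat k - of_nat m - 1) gchoose i) *\<^sub>C ?d i)"
      proof (intro sum.cong refl arg_cong2[of _ _ _ _ "(*\<^sub>C)"])
        fix i assume "i \<in> {..<N}"
        have "(\<Sum>n\<le>N. (-1) ^ n * of_nat (m + n choose n) * (if n \<le> i then of_nat (k choose (i - n)) else 0))
          = (\<Sum>n\<le>i. (-1) ^ n * of_nat (m + n choose n) * of_nat (k choose (i - n)) :: complex)"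
          by (rule sum.mono_neutral_cong_right) (use \<open>i \<in> {..<N}\<close> in auto)
        thus "(\<Sum>n\<le>N. (-1) ^ n * of_nat (m + n choose n) * (if n \<le> i then of_nat (k choose (i - n)) else 0))
          = ((of_nat k - of_nat m - 1) gchoose i :: complex)"
          by (simp only: locality_coefficient)
      qed
      finally have R: "(\<Sum>n\<le>N. of_nat (m + n choose n) *\<^sub>C H (m + n) n b' c')
         = (- koszul 1 q) *\<^sub>C ((\<Sum>i<N. ((of_nat k - of_nat m - 1) gchoose i) *\<^sub>C ?d i) \<star> v)" .
      show "mult_z (Om m) ?F b' c' = (\<Sum>n\<le>N. of_nat (m + n choose n) *\<^sub>C H (m + n) n b' c')"
      \<comment> \<open>for \<open>k > m\<close> both sides vanish: \<open>z\<^bsup>m-k\<^esup>\<close> is absent, and the binomial or the divided power is zero\<close>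
      proof (cases "k \<le> m")
        case True
        have "?S' 0 l (int (m - k)) = - (koszul (p + 1) (q + 1) *\<^sub>C
          (\<Sum>i<N. ((-1) ^ i * of_nat (m - k + i choose i)) *\<^sub>C dp (int (m - k) - int l + int i) (A i b)))"
          by (rule trans[OF sB0 skew_dp[OF A B skew_sym[OF A B sk] K(1)]])
        also have "(\<Sum>i<N. ((-1) ^ i * of_nat (m - k + i choose i)) *\<^sub>C dp (int (m - k) - int l + int i) (A i b))
          = (\<Sum>i<N. ((of_nat k - of_nat m - 1) gchoose i) *\<^sub>C ?d i)"
        proof (intro sum.cong refl arg_cong2[of _ _ _ _ "(*\<^sub>C)"] arg_cong2[of _ _ _ _ dp])
          fix i
          have "((of_nat k - of_nat m - 1) gchoose i :: complex) = (-1) ^ i * ((of_nat i - (of_nat k - of_nat m - 1) - 1) gchoose i)"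
            by (rule gbinomial_negated_upper)
          also have "of_nat i - (of_nat k - of_nat m - 1) - 1 = (of_nat (m - k + i) :: complex)"
            using True by (simp add: of_nat_diff)
          finally show "(-1) ^ i * of_nat (m - k + i choose i) = ((of_nat k - of_nat m - 1) gchoose i :: complex)"
            by (simp add: binomial_gbinomial)
        qed (use True in \<open>simp add: of_nat_diff\<close>)
        finally have S': "?S' 0 l (int (m - k)) = - (koszul (p + 1) (q + 1) *\<^sub>C (\<Sum>i<N. ((of_nat k - of_nat m - 1) gchoose i) *\<^sub>C ?d i))" .
        have "?k * koszul (p + 1) (q + 1) = koszul 1 q" by (cases p; cases q; simp)
        moreover have "mult_z (Om m) ?F b' c' = ?k *\<^sub>C (?S' 0 l (int (m - k)) \<star> v)"
          using True by (simp only: bc mult_z_def raviolo_mult.simps ZO if_True)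
        ultimately have "mult_z (Om m) ?F b' c' = (- koszul 1 q) *\<^sub>C ((\<Sum>i<N. ((of_nat k - of_nat m - 1) gchoose i) *\<^sub>C ?d i) \<star> v)"
          by (simp only: S' clinear_uminus[OF clinear_mul_left] mul_scale_left scaleC_scaleC cvs.scale_minus_right cvs.scale_minus_left)
        thus ?thesis using R by simp
      next
        case False
        have "((of_nat k - of_nat m - 1) gchoose i) *\<^sub>C ?d i = 0" for i
        proof (cases "int m - int l - int k + int i < 0")
          case neg: False
          have "of_nat k - of_nat m - 1 = (of_nat (k - m - 1) :: complex)" using False by (simp add: of_nat_diff)
          moreover have "k - m - 1 choose i = 0" using neg False by (intro binomial_eq_0) linarith
          ultimately show ?thesis by (metis binomial_gbinomial of_nat_0 cvs.scale_zero_left)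
        qed (simp add: dp_neg)
        hence "(\<Sum>i<N. ((of_nat k - of_nat m - 1) gchoose i) *\<^sub>C ?d i) = 0" by (intro sum.neutral) blast
        thus ?thesis using R False by (simp add: bc mult_z_def)
      qed
    qed (auto simp: H0 mult_z_def ZZ)
  qed
qed


section \<open>Uniqueness of the bracket and the state-field correspondence\<close>

definition component :: "bit \<Rightarrow> 'v \<Rightarrow> 'v" where
  "component p v = (THE a. a \<in> pv p \<and> v - a \<in> pv (p + 1))"

lemma pv_diff: "a \<in> pv p \<Longrightarrow> b \<in> pv p \<Longrightarrow> a - b \<in> pv p"
  using pv_add[of a p "(-1) *\<^sub>C b"] pv_scale[of b p "-1"] by simp

lemma pv_disjoint': "a \<in> pv p \<Longrightarrow> a \<in> pv (p + 1) \<Longrightarrow> a = 0"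
  using pv_disjoint by (cases p) auto

lemma component_unique:
  assumes "a \<in> pv p" "v - a \<in> pv (p + 1)" shows "component p v = a"
  unfolding component_def
proof (rule the_equality)
  fix b assume b: "b \<in> pv p \<and> v - b \<in> pv (p + 1)"
  have "b - a = (v - a) - (v - b)" by simp
  hence "b - a \<in> pv (p + 1)" using pv_diff b assms by metis
  hence "b - a = 0" using pv_disjoint' pv_diff b assms by blast
  thus "b = a" by simp
qed (use assms in auto)

lemma component: "component p v \<in> pv p" "v - component p v \<in> pv (p + 1)"
proof -
  obtain a b where "a \<in> pv 0" "b \<in> pv 1" "v = a + b" using pv_total by blast
  hence "\<exists>w. w \<in> pv p \<and> v - w \<in> pv (p + 1)"
    by (cases p) (force intro: exI[of _ a] exI[of _ b])+
  then obtain w where w: "w \<in> pv p" "v - w \<in> pv (p + 1)" by blast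
  with component_unique[OF w] show "component p v \<in> pv p" "v - component p v \<in> pv (p + 1)" by auto
qed

lemma component_add: "component p (v + w) = component p v + component p w"
proof (rule component_unique)
  have "v + w - (component p v + component p w) = (v - component p v) + (w - component p w)" by simp
  thus "v + w - (component p v + component p w) \<in> pv (p + 1)" by (metis component(2) pv_add)
qed (intro pv_add component)

lemma component_scale: "component p (t *\<^sub>C v) = t *\<^sub>C component p v"
  by (rule component_unique) (simp only: cvs.scale_right_diff_distrib[symmetric] pv_scale component)+

lemma component_pv: "v \<in> pv q \<Longrightarrow> component p v = (if p = q then v else 0)"
  by (rule component_unique) (cases p; cases q; auto simp: pv_zero)+

lemma component_sum: "component 0 v + component 1 v = v"
proof -
  have "v - component 0 v = component 1 v"
    by (rule sym, rule component_unique) (use component[where p = 0 and v = v] in auto)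
  thus ?thesis by (metis add.commute diff_add_cancel)
qed

end

locale generated_bracket = bracket_generators +
  assumes bracket_total: "a \<in> pv p \<Longrightarrow> \<exists>A. state_bracket p a A"
begin

text \<open>Skew-symmetry with \<open>b\<close> writes \<open>A\<^sub>n b\<close> through \<open>a\<close> and the bracket with \<open>b\<close>, in which \<open>A\<close> does not occur;
  and by \<open>bracket_total\<close> every homogeneous \<open>b\<close> has such a bracket.\<close>

lemma state_bracket_unique:
  assumes "state_bracket p a A" "state_bracket p a A'"
  shows "A = A'"
proof (rule ext, rule ext)
  fix n v
  have *: "A n b = A' n b" if "b \<in> pv q" for b q
  proof -
    obtain B where "state_bracket q b B" using bracket_total \<open>b \<in> pv q\<close> by blast
    thus ?thesis using state_bracket_skew[OF assms(1)] state_bracket_skew[OF assms(2)] by (simp add: skew_def)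
  qed
  obtain b c where "b \<in> pv 0" "c \<in> pv 1" "v = b + c" using pv_total by blast
  thus "A n v = A' n v"
    using * assms[THEN state_bracket_conf_der] by (simp add: clinear_add[OF conf_der_clinear])
qed

definition hbracket :: "bit \<Rightarrow> 'a \<Rightarrow> nat \<Rightarrow> 'a \<Rightarrow> 'a" where
  "hbracket p a = (THE A. state_bracket p a A)"

lemma hbracket: "a \<in> pv p \<Longrightarrow> state_bracket p a (hbracket p a)"
  unfolding hbracket_def by (metis bracket_total state_bracket_unique theI)

lemma hbracket_eq: "state_bracket p a A \<Longrightarrow> hbracket p a = A"
  using hbracket state_bracket_pv state_bracket_unique by blast

definition vbracket :: "'a \<Rightarrow> nat \<Rightarrow> 'a \<Rightarrow> 'a" where
  "vbracket a n v = hbracket 0 (component 0 a) n v + hbracket 1 (component 1 a) n v"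

lemma hbracket_add: "a \<in> pv p \<Longrightarrow> b \<in> pv p \<Longrightarrow> hbracket p (a + b) = (\<lambda>n v. hbracket p a n v + hbracket p b n v)"
  by (intro hbracket_eq state_bracket.add hbracket)

lemma hbracket_scale: "a \<in> pv p \<Longrightarrow> hbracket p (t *\<^sub>C a) = (\<lambda>n v. t *\<^sub>C hbracket p a n v)"
  by (intro hbracket_eq state_bracket.scale hbracket)

lemma hbracket_zero: "hbracket p 0 = (\<lambda>n v. 0)"
  using hbracket_scale[OF pv_zero, of p 0] by simp

lemma vbracket_hom: "a \<in> pv p \<Longrightarrow> vbracket a = hbracket p a"
  by (cases p) (simp_all add: vbracket_def fun_eq_iff component_pv hbracket_zero)

lemma vbracket_eq: "state_bracket p a A \<Longrightarrow> vbracket a = A"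
  by (metis hbracket_eq state_bracket_pv vbracket_hom)

lemma vbracket: "a \<in> pv p \<Longrightarrow> state_bracket p a (vbracket a)"
  by (simp add: vbracket_hom hbracket)

lemma vbracket_add: "vbracket (a + b) n v = vbracket a n v + vbracket b n v"
  by (simp add: vbracket_def component_add hbracket_add component)

lemma vbracket_scale: "vbracket (t *\<^sub>C a) n v = t *\<^sub>C vbracket a n v"
  by (simp add: vbracket_def component_scale hbracket_scale component scaleC_add_right)

lemma vbracket_clinear: "clinear (vbracket a n)"
  and vbracket_one: "vbracket a n one = 0"
  and vbracket_D: "vbracket a n (D v) = D (vbracket a n v) + of_nat n *\<^sub>C vbracket a (n - 1) v"
  and vbracket_vanishing: "vanishing (\<lambda>n. vbracket a n v)"
proof -
  note c = state_bracket_conf_der[OF hbracket[OF component(1)]]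
  show "clinear (vbracket a n)" using conf_der_clinear[OF c]
    by (auto simp: clinear_def vbracket_def scaleC_add_right)
  show "vbracket a n one = 0" by (simp add: vbracket_def conf_der_one[OF c])
  show "vbracket a n (D v) = D (vbracket a n v) + of_nat n *\<^sub>C vbracket a (n - 1) v"
    by (simp add: vbracket_def conf_der_D[OF c] D_add scaleC_add_right)
  show "vanishing (\<lambda>n. vbracket a n v)"
    unfolding vbracket_def by (intro vanishing_add conf_der_vanishing[OF c])
qed

text \<open>For the linearity of the fields over \<open>\<complex>[\<kappa>]\<close>: in the Leibniz rule for \<open>c a\<close> only \<open>j = 0\<close> survives, since
  \<open>D c = 0\<close>.\<close>

lemma vbracket_central_mul:
  assumes c: "state_bracket p c (\<lambda>n v. 0)" and Dc: "D c = 0"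
  shows "vbracket (c \<star> a) n v = c \<star> vbracket a n v"
proof -
  have hom: "vbracket (c \<star> b) n v = c \<star> vbracket b n v" if b: "b \<in> pv q" for b q
  proof -
    have dpc: "dp (int j) c = (if j = 0 then c else 0)" for j
    proof -
      have "(D ^^ k) 0 = 0" for k by (induction k) auto
      hence "(D ^^ Suc k) c = 0" for k by (simp add: funpow_Suc_right Dc del: funpow.simps)
      hence "j \<noteq> 0 \<Longrightarrow> (D ^^ j) c = 0" by (cases j) blast+
      thus ?thesis by (simp add: dp_def scaleC_one)
    qed
    have "vbracket (c \<star> b) = product_family p c (\<lambda>n v. 0) q b (vbracket b)"
      by (rule vbracket_eq[OF state_bracket.mul[OF c vbracket[OF b]]])
    moreover have "mul_family c (vbracket b) n v = c \<star> vbracket b n v"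
      by (simp add: mul_family_def dpc fsum_eq[of 1])
    moreover have "mul_family b (\<lambda>n v. 0) n v = 0" by (simp add: mul_family_def)
    ultimately show ?thesis by (simp add: product_family_def)
  qed
  show ?thesis
    using hom[OF component(1)[of 0 a]] hom[OF component(1)[of 1 a]] component_sum[of a]
    by (metis mul_add_right vbracket_add)
qed

definition vertex :: "'a \<Rightarrow> int \<Rightarrow> 'a \<Rightarrow> 'a" where
  "vertex a = modes a (vbracket a)"

lemma vertex_neg: "m < 0 \<Longrightarrow> vertex a m v = dp (- m - 1) a \<star> v"
  and vertex_nonneg: "m \<ge> 0 \<Longrightarrow> vertex a m v = vbracket a (nat m) v"
  by (simp_all add: vertex_def modes_def)

lemma vertex_add: "vertex (a + b) m v = vertex a m v + vertex b m v"
  by (simp add: vertex_def modes_def clinear_add[OF clinear_dp] mul_add_left vbracket_add)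

lemma vertex_scale: "vertex (t *\<^sub>C a) m v = t *\<^sub>C vertex a m v"
  by (simp add: vertex_def modes_def clinear_scale[OF clinear_dp] mul_scale_left vbracket_scale)

lemma vertex_clinear: "clinear (vertex a m)"
  by (cases "m < 0")
    (auto simp: clinear_def vertex_def modes_def mul_add_right mul_scale_right clinear_add[OF vbracket_clinear] clinear_scale[OF vbracket_clinear])

lemma vertex_central_mul:
  assumes "state_bracket p c (\<lambda>n v. 0)" "D c = 0"
  shows "vertex (c \<star> a) m v = c \<star> vertex a m v"
proof -
  have "(D ^^ k) (c \<star> a) = c \<star> (D ^^ k) a" for k by (induction k) (simp_all add: D_mul assms(2))
  hence "dp k (c \<star> a) = c \<star> dp k a" for k by (simp add: dp_def mul_scale_right)
  thus ?thesis by (simp add: vertex_def modes_def vbracket_central_mul[OF assms] mul_assoc)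
qed

lemma vertex_translation:
  "D (coefficient (vertex a) k v) - coefficient (vertex a) k (D v) = raviolo_deriv (\<lambda>k. coefficient (vertex a) k v) k"
proof (cases k)
  case (Zp n)
  have "D (dp (int n) a) = of_nat (n + 1) *\<^sub>C dp (int n + 1) a" by (simp add: D_dp add.commute)
  thus ?thesis using Zp by (simp add: vertex_neg D_mul mul_scale_left add.commute)
next
  case (Om n)
  thus ?thesis by (cases n) (simp_all add: vertex_nonneg vbracket_D nat_add_distrib)
qed

lemma vertex_one: "vertex one m v = (if m = -1 then v else 0)"
proof (cases "m < 0")
  case True
  then obtain n where n: "- m - 1 = int n" by (metis int_nat_eq diff_ge_0_iff_ge zle_diff1_eq neg_0_less_iff_less int_one_le_iff_zero_less)
  have "vertex one m v = dp (int n) one \<star> v" using True n by (simp add: vertex_neg)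
  thus ?thesis using n by (auto simp: dp_one one_mul)
qed (simp add: vertex_nonneg vbracket_eq[OF state_bracket.one])

lemma vertex_creation: "m \<ge> 0 \<Longrightarrow> vertex a m one = 0" "vertex a (-1) one = a"
  by (simp_all add: vertex_nonneg vertex_neg vbracket_one mul_one)

lemma vertex_local: "a \<in> pv p \<Longrightarrow> b \<in> pv q \<Longrightarrow> mutually_local p q (vertex a) (vertex b)"
  unfolding vertex_def
  using state_bracket_conf_der state_bracket_skew state_bracket_mode_local vbracket
  by (intro mutually_local_modes) blast+

end

section \<open>The universal property of the induced module\<close>

lemma kappa_homog: "kappa \<in> homog 1"
  by (simp add: kappa_def homog_affine_def homog_zero)

text \<open>A representation with a vector that the currents annihilate. Only elements of definite parity have
  to satisfy the bracket relation; for them it reads \<open>XY = \<plusminus> YX + [X,Y]\<close>.\<close>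

locale affine_rep =
  fixes \<rho> :: "'g::lie_superalgebra_form affine \<Rightarrow> 'w::complex_space \<Rightarrow> 'w" and w0 :: 'w
  assumes rho_clinear: "clinear (\<rho> X)"
    and rho_add: "\<rho> (X + Y) w = \<rho> X w + \<rho> Y w"
    and rho_scale: "\<rho> (c *\<^sub>C X) w = c *\<^sub>C \<rho> X w"
    and rho_bracket: "X \<in> homog p \<Longrightarrow> Y \<in> homog q \<Longrightarrow>
      \<rho> X (\<rho> Y w) = koszul p q *\<^sub>C \<rho> Y (\<rho> X w) + \<rho> (bracket X Y) w"
    and rho_w0: "mom X = 0 \<Longrightarrow> cen X = 0 \<Longrightarrow> \<rho> X w0 = 0"
begin

definition word_act :: "'g affine word \<Rightarrow> 'w \<Rightarrow> 'w" where
  "word_act v = foldr \<rho> (letters v)"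

definition free_act :: "('g affine word \<Rightarrow>\<^sub>0 complex) \<Rightarrow> 'w \<Rightarrow> 'w" where
  "free_act f w = (\<Sum>k\<in>Poly_Mapping.keys f. Poly_Mapping.lookup f k *\<^sub>C word_act k w)"

lemma clinear_word_act: "clinear (word_act v)"
proof -
  have "clinear (foldr \<rho> xs)" for xs
    by (induction xs) (auto simp: clinear_def clinear_add[OF rho_clinear] clinear_scale[OF rho_clinear])
  thus ?thesis by (simp add: word_act_def)
qed

lemma free_act_superset:
  "finite A \<Longrightarrow> Poly_Mapping.keys f \<subseteq> A \<Longrightarrow> free_act f w = (\<Sum>k\<in>A. Poly_Mapping.lookup f k *\<^sub>C word_act k w)"
  unfolding free_act_def by (rule sum.mono_neutral_left) (auto simp: in_keys_iff)

lemma free_act_add: "free_act (f + g) w = free_act f w + free_act g w"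
proof -
  let ?A = "Poly_Mapping.keys f \<union> Poly_Mapping.keys g"
  have "Poly_Mapping.keys (f + g) \<subseteq> ?A" by (rule Poly_Mapping.keys_add)
  thus ?thesis by (simp add: free_act_superset[of ?A] lookup_add scaleC_add_left sum.distrib)
qed

lemma free_act_scale: "free_act (c *\<^sub>C f) w = c *\<^sub>C free_act f w"
  by (subst free_act_superset[OF finite_keys keys_scaleC])
    (simp add: free_act_def cvs.scale_sum_right scaleC_scaleC scaleC_complex_def)

lemma free_act_diff: "free_act (f - g) w = free_act f w - free_act g w"
  using free_act_add[of "f - g" g w] by (simp add: algebra_simps)

lemma free_act_single: "free_act (Poly_Mapping.single k c) w = c *\<^sub>C word_act k w"
  by (simp add: free_act_superset[of "{k}"])

lemma clinear_free_act: "clinear (free_act f)"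
  using clinear_word_act by (auto simp: clinear_def free_act_def scaleC_add_right sum.distrib cvs.scale_sum_right scaleC_scaleC mult.commute)

lemma free_act_sum: "free_act (sum f A) w = (\<Sum>i\<in>A. free_act (f i) w)"
  by (induction A rule: infinite_finite_induct) (auto simp: free_act_add, simp_all add: free_act_def)

lemma free_act_mult: "free_act (f * g) w = free_act f (free_act g w)"
proof -
  have w: "word_act (u + v) w = word_act u (word_act v w)" for u v by (simp add: word_act_def plus_word_def)
  have "free_act (f * g) w = (\<Sum>k\<in>Poly_Mapping.keys f. \<Sum>l\<in>Poly_Mapping.keys g.
      free_act (Poly_Mapping.single (k + l) (Poly_Mapping.lookup f k * Poly_Mapping.lookup g l)) w)"
    by (subst poly_mapping_decompose[of f], subst poly_mapping_decompose[of g])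
      (simp add: sum_distrib_left sum_distrib_right mult_single free_act_sum sum.swap[of _ "Poly_Mapping.keys g"])
  also have "\<dots> = free_act f (free_act g w)"
    by (simp add: free_act_single w free_act_def[of f] free_act_def[of g] clinear_sum[OF clinear_word_act]
        clinear_scale[OF clinear_word_act] cvs.scale_sum_right scaleC_scaleC)
  finally show ?thesis .
qed

lemma free_act_gen: "free_act (free_gen X) w = \<rho> X w"
  by (simp add: free_gen_def free_act_single scaleC_one word_act_def)

lemma free_act_ideal: "a \<in> uea_ideal \<Longrightarrow> free_act a w = 0"
proof (induction arbitrary: w rule: uea_ideal.induct)
  case (bracket x p y q)
  thus ?case by (simp add: free_act_diff free_act_scale free_act_mult free_act_gen rho_bracket[OF bracket])
next
  case (mult a u v)
  thus ?case by (simp add: free_act_mult clinear_zero[OF clinear_free_act])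
qed (simp_all add: free_act_diff free_act_add free_act_scale free_act_gen rho_add rho_scale)

lemma free_act_cong: "uea_eq a b \<Longrightarrow> free_act a w = free_act b w"
  using free_act_ideal[of "a - b" w] by (simp add: uea_eq_def free_act_diff)

definition u_act :: "'g affine uea \<Rightarrow> 'w \<Rightarrow> 'w" where
  "u_act u = free_act (rep_uea u)"

lemma u_act_abs: "u_act (abs_uea f) w = free_act f w"
  unfolding u_act_def by (rule free_act_cong) (metis Quotient3_rep_abs Quotient3_uea uea_eq_equivp equivp_reflp)

lemma uea_cases: obtains f where "u = abs_uea f"
  by (metis Quotient3_abs_rep Quotient3_uea)

lemma u_act_add: "u_act (u + v) w = u_act u w + u_act v w"
  by (rule uea_cases[of u], rule uea_cases[of v]) (simp add: plus_uea.abs_eq u_act_abs free_act_add)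
lemma u_act_scale: "u_act (c *\<^sub>C u) w = c *\<^sub>C u_act u w"
  by (rule uea_cases[of u]) (simp add: scaleC_uea.abs_eq u_act_abs free_act_scale)
lemma u_act_mult: "u_act (u * v) w = u_act u (u_act v w)"
  by (rule uea_cases[of u], rule uea_cases[of v]) (simp add: times_uea.abs_eq u_act_abs free_act_mult)
lemma u_act_gen: "u_act (uea_gen X) w = \<rho> X w"
  by (simp add: uea_gen.abs_eq u_act_abs free_act_gen)
lemma u_act_one: "u_act 1 w = w"
  by (simp add: one_uea.abs_eq u_act_abs flip: single_one) (simp add: free_act_single word_act_def zero_word_def scaleC_one)
lemma clinear_u_act: "clinear (u_act u)"
  unfolding u_act_def by (rule clinear_free_act)

definition ck_act :: "ckappa \<Rightarrow> 'w" where
  "ck_act m = ck0 m *\<^sub>C w0 + ck1 m *\<^sub>C \<rho> kappa w0"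

definition pre_act :: "('g affine uea \<times> ckappa \<Rightarrow>\<^sub>0 complex) \<Rightarrow> 'w" where
  "pre_act f = (\<Sum>k\<in>Poly_Mapping.keys f. Poly_Mapping.lookup f k *\<^sub>C u_act (fst k) (ck_act (snd k)))"

lemma pre_act_superset:
  "finite A \<Longrightarrow> Poly_Mapping.keys f \<subseteq> A \<Longrightarrow> pre_act f = (\<Sum>k\<in>A. Poly_Mapping.lookup f k *\<^sub>C u_act (fst k) (ck_act (snd k)))"
  unfolding pre_act_def by (rule sum.mono_neutral_left) (auto simp: in_keys_iff)

lemma pre_act_add: "pre_act (f + g) = pre_act f + pre_act g"
proof -
  let ?A = "Poly_Mapping.keys f \<union> Poly_Mapping.keys g"
  have "Poly_Mapping.keys (f + g) \<subseteq> ?A" by (rule Poly_Mapping.keys_add)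
  thus ?thesis by (simp add: pre_act_superset[of ?A] lookup_add scaleC_add_left sum.distrib)
qed

lemma pre_act_scale: "pre_act (c *\<^sub>C f) = c *\<^sub>C pre_act f"
  by (subst pre_act_superset[OF finite_keys keys_scaleC])
    (simp add: pre_act_def cvs.scale_sum_right scaleC_scaleC scaleC_complex_def)

lemma pre_act_diff: "pre_act (f - g) = pre_act f - pre_act g"
  using pre_act_add[of "f - g" g] by (simp add: algebra_simps)

lemma pre_act_pure: "pre_act (pure u m) = u_act u (ck_act m)"
  by (simp add: pre_act_superset[of "{(u, m)}"] scaleC_one)

text \<open>The relation for the odd element \<open>\<kappa>\<close> with itself says \<open>2 \<kappa>\<^sup>2 = 0\<close>, so \<open>\<complex>[\<kappa>]\<close> acts.\<close>

lemma rho_kappa: "\<rho> kappa (\<rho> kappa w) = 0"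
proof -
  have "\<rho> kappa (\<rho> kappa w) = - \<rho> kappa (\<rho> kappa w) + \<rho> 0 w"
    using rho_bracket[OF kappa_homog kappa_homog, of w] by (simp add: bracket_kappa)
  moreover have "\<rho> 0 w = 0" using rho_scale[of 0 0 w] by simp
  ultimately have "2 *\<^sub>C \<rho> kappa (\<rho> kappa w) = 0"
    by (metis add.right_neutral add_neg_numeral_special(9) cvs.scale_zero_left diff_add_cancel eq_neg_iff_add_eq_0 one_add_one scaleC_add_left scaleC_one)
  thus ?thesis by simp
qed

lemma affine_split: "X = Affine (cur X) (mom X) 0 + cen X *\<^sub>C kappa"
  by (cases X) (simp add: plus_affine_def scaleC_affine_def kappa_def)

lemma rho_nonneg:
  assumes "mom X = 0"
  shows "\<rho> X (ck_act m) = ck_act (CK 0 (cen X) * m)"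
proof -
  have c0: "\<rho> C w0 = 0 \<and> \<rho> C (\<rho> kappa w0) = 0" if C: "mom C = 0" "cen C = 0" for C
  proof -
    let ?C = "\<lambda>p. Affine (\<lambda>n. parity_part p (cur C n)) 0 0"
    have h: "?C p \<in> homog p" for p by (simp add: homog_affine_def parity_part_props homog_zero)
    have "\<rho> (?C p) (\<rho> kappa w0) = 0" for p
      using rho_bracket[OF h[of p] kappa_homog, of w0] rho_w0[of "?C p"] rho_scale[of 0 0 w0]
      by (simp add: bracket_kappa clinear_zero[OF rho_clinear])
    moreover have "C = ?C 0 + ?C 1" using C by (cases C) (simp add: plus_affine_def parity_part_sum)
    ultimately show ?thesis using rho_w0[OF C] by (metis rho_add add_0)
  qed
  have "\<rho> X w = \<rho> (Affine (cur X) 0 0) w + cen X *\<^sub>C \<rho> kappa w" for w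
    using affine_split[of X] assms by (metis rho_add rho_scale)
  thus ?thesis
    by (simp add: ck_act_def clinear_add[OF rho_clinear] clinear_scale[OF rho_clinear] c0 rho_kappa times_ckappa_def scaleC_scaleC mult.commute)
qed

lemma pre_act_relators: "f \<in> tensor_relators \<Longrightarrow> pre_act f = 0"
proof (induction rule: tensor_relators.induct)
  case (5 X u m)
  thus ?case by (simp add: pre_act_diff pre_act_pure u_act_mult u_act_gen rho_nonneg)
next
  case (2 u m m')
  have "ck_act (m + m') = ck_act m + ck_act m'" by (simp add: ck_act_def plus_ckappa_def scaleC_add_left)
  thus ?case by (simp add: pre_act_diff pre_act_pure clinear_add[OF clinear_u_act])
next
  case (4 u c m)
  have "ck_act (c *\<^sub>C m) = c *\<^sub>C ck_act m" by (simp add: ck_act_def scaleC_ckappa_def scaleC_add_right scaleC_scaleC)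
  thus ?case by (simp add: pre_act_diff pre_act_scale pre_act_pure clinear_scale[OF clinear_u_act])
qed (simp_all add: pre_act_diff pre_act_scale pre_act_pure u_act_add u_act_scale)

lemma pre_act_span: "f \<in> cvs.span tensor_relators \<Longrightarrow> pre_act f = 0"
proof (induction rule: cvs.span_induct_alt)
  case base show ?case by (simp add: pre_act_def)
next
  case (step c x y) thus ?case by (simp add: pre_act_add pre_act_scale pre_act_relators)
qed

text \<open>Words act through \<open>\<rho>\<close>, the ideal that defines the enveloping algebra acts by zero, and the relators
  of the tensor product go to zero when \<open>u \<otimes> (a + b \<kappa>)\<close> is sent to \<open>u (a w\<^sub>0 + b \<kappa> w\<^sub>0)\<close>.\<close>

theorem universal_map:
  "\<exists>\<phi>. clinear \<phi> \<and> \<phi> vac = w0 \<and> (\<forall>X v. \<phi> (affine_act X v) = \<rho> X (\<phi> v))"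
proof (intro exI conjI allI)
  let ?\<phi> = "\<lambda>v. pre_act (rep_vuniv v)"
  have abs: "?\<phi> (abs_vuniv f) = pre_act f" for f
  proof -
    have "tensor_eq (rep_vuniv (abs_vuniv f)) f"
      by (metis Quotient3_rep_abs Quotient3_vuniv tensor_eq_equivp equivp_reflp)
    thus ?thesis using pre_act_span pre_act_diff by (metis tensor_eq_def eq_iff_diff_eq_0)
  qed
  have ex: "\<exists>f. v = abs_vuniv f" for v :: "'g vuniv" by (metis Quotient3_abs_rep Quotient3_vuniv)
  show "clinear ?\<phi>"
  proof (rule clinearI)
    fix v w :: "'g vuniv" and c
    obtain f g where "v = abs_vuniv f" "w = abs_vuniv g" using ex[of v] ex[of w] by blast
    thus "?\<phi> (v + w) = ?\<phi> v + ?\<phi> w" "?\<phi> (c *\<^sub>C v) = c *\<^sub>C ?\<phi> v"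
      by (simp_all add: plus_vuniv.abs_eq scaleC_vuniv.abs_eq abs pre_act_add pre_act_scale)
  qed
  have "ck_act 1 = w0" by (simp add: ck_act_def one_ckappa_def scaleC_one)
  thus "?\<phi> vac = w0" by (simp add: vac_def tensor.abs_eq abs pre_act_pure u_act_one)
  fix X and v :: "'g vuniv"
  obtain f where v: "v = abs_vuniv f" using ex by blast
  have "pre_act (tensor_lmult u f) = u_act u (pre_act f)" for u
  proof -
    have s: "pre_act (sum h A) = (\<Sum>i\<in>A. pre_act (h i))" for h A
      by (induction A rule: infinite_finite_induct) (auto simp: pre_act_add, simp_all add: pre_act_def)
    show ?thesis
      by (simp add: tensor_lmult_def s case_prod_unfold pre_act_scale pre_act_pure u_act_mult pre_act_def[of f]
          clinear_sum[OF clinear_u_act] clinear_scale[OF clinear_u_act])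
  qed
  thus "?\<phi> (affine_act X v) = \<rho> X (?\<phi> v)"
    by (simp add: v affine_act_def uea_act.abs_eq abs u_act_gen)
qed

end

section \<open>The structure of the induced module\<close>

lemma uea_gen_add: "uea_gen (X + Y) = uea_gen X + uea_gen Y"
  by transfer (use uea_ideal.add in \<open>simp add: uea_eq_def diff_diff_add\<close>)

lemma uea_gen_scale: "uea_gen (c *\<^sub>C X) = c *\<^sub>C uea_gen X"
  by transfer (simp add: uea_eq_def uea_ideal.scale)

lemma uea_gen_bracket:
  "X \<in> homog p \<Longrightarrow> Y \<in> homog q \<Longrightarrow>
     uea_gen X * uea_gen Y = koszul p q *\<^sub>C (uea_gen Y * uea_gen X) + uea_gen (bracket X Y)"
  by transfer (use uea_ideal.bracket in \<open>simp add: uea_eq_def diff_diff_add\<close>)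

lemma tensor_add_left: "tensor (u + u') m = tensor u m + tensor u' m"
  by transfer (use cvs.span_base[OF tensor_relators.intros(1)] in \<open>simp add: tensor_eq_def diff_diff_add\<close>)
lemma tensor_add_right: "tensor u (m + m') = tensor u m + tensor u m'"
  by transfer (use cvs.span_base[OF tensor_relators.intros(2)] in \<open>simp add: tensor_eq_def diff_diff_add\<close>)
lemma tensor_scale_left: "tensor (c *\<^sub>C u) m = c *\<^sub>C tensor u m"
  by transfer (use cvs.span_base[OF tensor_relators.intros(3)] in \<open>simp add: tensor_eq_def\<close>)
lemma tensor_scale_right: "tensor u (c *\<^sub>C m) = c *\<^sub>C tensor u m"
  by transfer (use cvs.span_base[OF tensor_relators.intros(4)] in \<open>simp add: tensor_eq_def\<close>)
lemma tensor_balanced: "mom X = 0 \<Longrightarrow> tensor (u * uea_gen X) m = tensor u (CK 0 (cen X) * m)"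
proof -
  assume X: "mom X = 0"
  have "tensor_eq (pure (u * uea_gen X) m) (pure u (CK 0 (cen X) * m))"
    using cvs.span_base[OF tensor_relators.intros(5)[OF X, of u m]] by (simp add: tensor_eq_def)
  thus ?thesis by (simp add: tensor.abs_eq vuniv.abs_eq_iff)
qed

lemma uea_act_tensor: "uea_act u (tensor w m) = tensor (u * w) m"
  by (simp add: tensor.abs_eq uea_act.abs_eq tensor_lmult_pure)

lemma clinear_uea_act: "clinear (uea_act u)"
proof (rule clinearI)
  show "uea_act u (v + w) = uea_act u v + uea_act u w" for v w
    by transfer (simp add: tensor_eq_def tensor_lmult_add cvs.span_zero)
  show "uea_act u (c *\<^sub>C v) = c *\<^sub>C uea_act u v" for c v
    by transfer (simp add: tensor_eq_def tensor_lmult_scale cvs.span_zero)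
qed

lemma vuniv_tensor_induct:
  assumes "\<And>u m. P (tensor u m)" "\<And>v w. P v \<Longrightarrow> P w \<Longrightarrow> P (v + w)" "\<And>c v. P v \<Longrightarrow> P (c *\<^sub>C v)"
  shows "P (v :: 'g::lie_superalgebra_form vuniv)"
proof -
  have P0: "P 0" using assms(3)[OF assms(1), of 0] by simp
  have "P (abs_vuniv f)" for f
  proof (induction f rule: poly_mapping_sum_induct)
    case (single k c)
    obtain u m where k: "k = (u, m)" by fastforce
    have "Poly_Mapping.single k c = c *\<^sub>C pure u m"
      by (simp add: k flip: single_scaleC) (simp add: scaleC_complex_def)
    hence "abs_vuniv (Poly_Mapping.single k c) = c *\<^sub>C tensor u m"
      by (simp add: scaleC_vuniv.abs_eq tensor.abs_eq)
    thus ?case by (simp add: assms)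
  next
    case (sum f g)
    thus ?case by (simp add: plus_vuniv.abs_eq[symmetric] assms)
  qed
  moreover obtain f where "v = abs_vuniv f" by (metis Quotient3_abs_rep Quotient3_vuniv)
  ultimately show ?thesis by simp
qed

lemma uea_act_add: "uea_act (u + u') v = uea_act u v + uea_act u' v"
  by (induction v rule: vuniv_tensor_induct)
    (simp_all add: uea_act_tensor distrib_right tensor_add_left clinear_add[OF clinear_uea_act] clinear_scale[OF clinear_uea_act] scaleC_add_right)

lemma uea_act_scale: "uea_act (c *\<^sub>C u) v = c *\<^sub>C uea_act u v"
  by (induction v rule: vuniv_tensor_induct)
    (simp_all add: uea_act_tensor scaleC_mult_left tensor_scale_left clinear_add[OF clinear_uea_act] clinear_scale[OF clinear_uea_act] scaleC_add_right scaleC_scaleC mult.commute)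

lemma uea_act_mult: "uea_act (u * u') v = uea_act u (uea_act u' v)"
  by (induction v rule: vuniv_tensor_induct)
    (simp_all add: uea_act_tensor mult.assoc clinear_add[OF clinear_uea_act] clinear_scale[OF clinear_uea_act])

lemma uea_act_one: "uea_act 1 v = v"
  by (induction v rule: vuniv_tensor_induct)
    (simp_all add: uea_act_tensor clinear_add[OF clinear_uea_act] clinear_scale[OF clinear_uea_act])

lemma clinear_affine_act: "clinear (affine_act X)"
  unfolding affine_act_def by (rule clinear_uea_act)
lemmas affine_act_add_right = clinear_add[OF clinear_affine_act]
  and affine_act_scale_right = clinear_scale[OF clinear_affine_act]

lemma affine_act_add_left: "affine_act (X + Y) v = affine_act X v + affine_act Y v"
  by (simp add: affine_act_def uea_gen_add uea_act_add)
lemma affine_act_scale_left: "affine_act (c *\<^sub>C X) v = c *\<^sub>C affine_act X v"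
  by (simp add: affine_act_def uea_gen_scale uea_act_scale)
lemma affine_act_zero_left: "affine_act 0 v = 0"
  using affine_act_scale_left[of 0 0 v] by simp
lemma affine_act_sum_left: "affine_act (sum f A) v = (\<Sum>i\<in>A. affine_act (f i) v)"
  by (induction A rule: infinite_finite_induct) (auto simp: affine_act_add_left affine_act_zero_left)

lemma affine_act_bracket:
  assumes "X \<in> homog p" "Y \<in> homog q"
  shows "affine_act X (affine_act Y v) = koszul p q *\<^sub>C affine_act Y (affine_act X v) + affine_act (bracket X Y) v"
proof -
  have "uea_act (uea_gen X * uea_gen Y) v = koszul p q *\<^sub>C uea_act (uea_gen Y * uea_gen X) v + uea_act (uea_gen (bracket X Y)) v"
    by (simp only: uea_gen_bracket[OF assms] uea_act_add uea_act_scale)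
  thus ?thesis by (simp only: affine_act_def uea_act_mult)
qed

lemma affine_act_vac: "mom X = 0 \<Longrightarrow> cen X = 0 \<Longrightarrow> affine_act X vac = 0"
proof -
  assume X: "mom X = 0" "cen X = 0"
  have "CK 0 (cen X) = 0" by (simp add: X zero_ckappa_def)
  moreover have "tensor 1 0 = (0 :: 'a vuniv)" using tensor_scale_right[of 1 0 0] by simp
  ultimately show ?thesis using tensor_balanced[OF X(1), of 1 1]
    by (simp add: affine_act_def vac_def uea_act_tensor)
qed

lemma affine_act_is_rep: "affine_rep affine_act vac"
  by unfold_locales
    (fact clinear_affine_act affine_act_add_left affine_act_scale_left affine_act_bracket affine_act_vac)+

lemma tensor_eq_act: "tensor u m = uea_act u (ck0 m *\<^sub>C vac + ck1 m *\<^sub>C affine_act kappa vac)"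
proof -
  have k: "affine_act kappa (tensor 1 1) = tensor 1 (CK 0 1)"
    using tensor_balanced[of kappa 1 1]
    by (simp add: affine_act_def uea_act_tensor kappa_def times_ckappa_def one_ckappa_def)
  have "m = ck0 m *\<^sub>C 1 + ck1 m *\<^sub>C CK 0 1"
    by (cases m) (simp add: scaleC_ckappa_def one_ckappa_def plus_ckappa_def)
  hence "tensor u m = ck0 m *\<^sub>C tensor u 1 + ck1 m *\<^sub>C tensor u (CK 0 1)"
    by (metis tensor_add_right tensor_scale_right)
  thus ?thesis
    by (simp add: clinear_add[OF clinear_uea_act] clinear_scale[OF clinear_uea_act] k vac_def uea_act_tensor)
qed

text \<open>The vacuum generates: \<open>1 \<otimes> \<kappa>\<close> is \<open>\<kappa>\<close> applied to the vacuum, and the enveloping algebra is spanned by words.\<close>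

lemma vuniv_induct:
  assumes vac: "P vac" and add: "\<And>v w. P v \<Longrightarrow> P w \<Longrightarrow> P (v + w)" and scale: "\<And>c v. P v \<Longrightarrow> P (c *\<^sub>C v)"
    and act: "\<And>X v. P v \<Longrightarrow> P (affine_act X v)"
  shows "P (v :: 'g::lie_superalgebra_form vuniv)"
proof -
  have P0: "P 0" using scale[OF vac, of 0] by simp
  have u: "P (uea_act (abs_uea f) v)" if v: "P v" for f v
  proof (induction f rule: poly_mapping_sum_induct)
    case (single k c)
    have "P (uea_act (abs_uea (Poly_Mapping.single (Word xs) 1)) v)" for xs
    proof (induction xs)
      case Nil
      have "abs_uea (Poly_Mapping.single (Word []) 1) = (1 :: 'g affine uea)"
        by (simp add: one_uea_def zero_word_def flip: single_one)
      thus ?case by (simp add: uea_act_one v)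
    next
      case (Cons x xs)
      have "Poly_Mapping.single (Word (x # xs)) 1 = free_gen x * Poly_Mapping.single (Word xs) 1"
        by (simp add: free_gen_def mult_single plus_word_def)
      hence "abs_uea (Poly_Mapping.single (Word (x # xs)) 1) = uea_gen x * abs_uea (Poly_Mapping.single (Word xs) 1)"
        by (simp add: times_uea.abs_eq uea_gen.abs_eq)
      thus ?case using act[OF Cons] by (simp add: uea_act_mult affine_act_def)
    qed
    from this[of "letters k"] have "P (uea_act (abs_uea (Poly_Mapping.single k 1)) v)" by simp
    moreover have "Poly_Mapping.single k c = c *\<^sub>C Poly_Mapping.single k 1"
      by (simp flip: single_scaleC) (simp add: scaleC_complex_def)
    ultimately show ?case by (simp add: scaleC_uea.abs_eq[symmetric] uea_act_scale scale)
  next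
    case (sum f g)
    thus ?case by (simp add: plus_uea.abs_eq[symmetric] uea_act_add add)
  qed
  have ua: "P (uea_act u w)" if "P w" for u w
    using u[OF that] by (metis Quotient3_abs_rep Quotient3_uea)
  thus ?thesis
    by (induction v rule: vuniv_tensor_induct) (auto simp: tensor_eq_act intro!: ua add scale act vac)
qed

lemma affine_decompose:
  fixes X :: "'g::lie_superalgebra_form affine"
  shows "X = Affine (cur X) 0 0 + (\<Sum>n\<in>Poly_Mapping.keys (mom X). momentum (Poly_Mapping.lookup (mom X) n) n) + cen X *\<^sub>C kappa"
proof -
  have "(\<Sum>n\<in>A. momentum (f n) n) = Affine (\<lambda>k. 0) (\<Sum>n\<in>A. Poly_Mapping.single n (f n)) 0" for A and f :: "nat \<Rightarrow> 'g"
    by (induction A rule: infinite_finite_induct)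
      (auto simp: momentum_def plus_affine_def zero_affine_def)
  moreover note poly_mapping_decompose[of "mom X"]
  ultimately show ?thesis
    by (cases X) (simp add: plus_affine_def scaleC_affine_def kappa_def)
qed

lemma momentum_add: "momentum (x + y) n = momentum x n + momentum y n"
  and momentum_scale: "momentum (c *\<^sub>C x) n = c *\<^sub>C momentum x n"
  by (auto simp: momentum_def plus_affine_def scaleC_affine_def single_add single_scaleC)

lemma momentum_homog: "x \<in> homog p \<Longrightarrow> momentum x n \<in> homog (p + 1)"
  and current_homog: "x \<in> homog p \<Longrightarrow> current x n \<in> homog p"
  by (auto simp: momentum_def current_def homog_affine_def lookup_single when_def homog_zero)

lemma current_part_homog: "(\<And>n. f n \<in> homog p) \<Longrightarrow> Affine f 0 0 \<in> homog p"
  by (simp add: homog_affine_def homog_zero)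


text \<open>The span of the monomials in momenta and \<open>\<kappa>\<close>.\<close>

inductive momentum_generated :: "'g::lie_superalgebra_form vuniv \<Rightarrow> bool" where
  vac: "momentum_generated vac"
| add: "momentum_generated v \<Longrightarrow> momentum_generated w \<Longrightarrow> momentum_generated (v + w)"
| scale: "momentum_generated v \<Longrightarrow> momentum_generated (c *\<^sub>C v)"
| momentum: "x \<in> homog p \<Longrightarrow> momentum_generated v \<Longrightarrow> momentum_generated (affine_act (momentum x n) v)"
| kappa: "momentum_generated v \<Longrightarrow> momentum_generated (affine_act kappa v)"

text \<open>The currents annihilate the vacuum and move past momenta at the cost of further momenta and \<open>\<kappa>\<close>, so
  the momenta and \<open>\<kappa>\<close> alone generate from the vacuum. A current is treated as a whole power series here, as
  it need not be a finite sum of the \<open>x u\<^sup>n\<close>.\<close>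

lemma momentum_generated_all: "momentum_generated (v :: 'g::lie_superalgebra_form vuniv)"
proof -
  let ?R = "momentum_generated :: 'g vuniv \<Rightarrow> bool"
  note Ri = momentum_generated.intros
  have R0: "?R 0" using Ri(3)[OF Ri(1), of 0] by simp
  have Rsum: "?R (sum f A)" if "\<And>i. i \<in> A \<Longrightarrow> ?R (f i)" for f and A :: "nat set"
    using that by (induction A rule: infinite_finite_induct) (auto intro: R0 Ri)
  have Rmom: "?R (affine_act (momentum x n) v)" if "?R v" for x n v
  proof -
    have "affine_act (momentum x n) v = affine_act (momentum (parity_part 0 x) n) v + affine_act (momentum (parity_part 1 x) n) v"
      by (simp flip: affine_act_add_left momentum_add add: parity_part_sum)
    thus ?thesis using Ri(2,4) that parity_part_props(1) by metis
  qed
  have Rneg: "?R (affine_act X v)" if "cur X = (\<lambda>n. 0)" "?R v" for X v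
  proof -
    have "affine_act X v = affine_act (Affine (cur X) 0 0) v + (\<Sum>n\<in>Poly_Mapping.keys (mom X). affine_act (momentum (Poly_Mapping.lookup (mom X) n) n) v) + cen X *\<^sub>C affine_act kappa v"
      by (subst (1) affine_decompose) (simp only: affine_act_add_left affine_act_scale_left affine_act_sum_left)
    moreover have "affine_act (Affine (cur X) 0 0) v = 0"
      using affine_act_zero_left[of v] that(1) by (simp add: zero_affine_def)
    ultimately show ?thesis using that by (auto intro!: Ri Rsum Rmom)
  qed
  have Rcur: "?R (affine_act (Affine f 0 0) v)" if f: "\<And>n. f n \<in> homog q" and v: "?R v" for f q v
  proof -
    note fh = current_part_homog[OF f]
    have "?R (affine_act (Affine f 0 0) v) \<and> ?R v"
      using v
    proof (induction rule: momentum_generated.induct)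
      case vac thus ?case by (simp add: affine_act_vac R0 Ri)
    next
      case (momentum x p w n)
      have "cur (bracket (Affine f 0 0) (momentum x n)) = (\<lambda>n. 0)"
        by (simp add: bracket_affine_def momentum_def)
      thus ?case using momentum by (simp add: affine_act_bracket[OF fh momentum_homog[OF momentum(1)]] Ri Rneg)
    next
      case (kappa w)
      thus ?case by (simp add: affine_act_bracket[OF fh kappa_homog] bracket_kappa affine_act_zero_left Ri)
    qed (auto simp: affine_act_add_right affine_act_scale_right intro: Ri)
    thus ?thesis ..
  qed
  have "?R (affine_act X v)" if "?R v" for X v
  proof -
    let ?C = "\<lambda>p. Affine (\<lambda>n. parity_part p (cur X n)) 0 0" and ?N = "Affine (\<lambda>n. 0) (mom X) (cen X)"
    have "X = ?C 0 + ?C 1 + ?N" by (cases X) (simp add: plus_affine_def parity_part_sum)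
    hence "affine_act X v = affine_act (?C 0) v + affine_act (?C 1) v + affine_act ?N v"
      by (metis affine_act_add_left)
    thus ?thesis using that by (auto intro!: Ri Rneg Rcur[OF parity_part_props(1)])
  qed
  thus ?thesis by (induction v rule: vuniv_induct) (auto intro: Ri)
qed

lemmas vuniv_momentum_induct [case_names vac add scale momentum kappa] =
  momentum_generated.induct[OF momentum_generated_all]

section \<open>Automorphisms and the translation operator\<close>

lemma bracket_uminus: "bracket (- x) y = - bracket x y" "bracket x (- y) = - bracket x (y::'g::lie_superalgebra)"
  using bracket_scale_left[of "-1" x y] bracket_scale_right[of x "-1" y] by simp_all

definition parity_sign :: "'g::lie_superalgebra \<Rightarrow> 'g" where
  "parity_sign x = parity_part 0 x - parity_part 1 x"

lemma parity_sign_homog: "x \<in> homog p \<Longrightarrow> parity_sign x = koszul 1 p *\<^sub>C x"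
  by (cases p) (simp_all add: parity_sign_def parity_part_homog scaleC_one)

lemma clinear_parity_sign: "clinear parity_sign"
  by (rule clinearI) (simp_all add: parity_sign_def parity_part_add parity_part_scale cvs.scale_right_diff_distrib)

lemma parity_sign_in_homog: "x \<in> homog p \<Longrightarrow> parity_sign x \<in> homog p"
  by (simp add: parity_sign_homog homog_scale)

lemma parity_induct:
  assumes "\<And>p x. x \<in> homog p \<Longrightarrow> P x" "\<And>x y. P x \<Longrightarrow> P y \<Longrightarrow> P (x + y)"
  shows "P (x :: 'g::lie_superalgebra)"
  using assms homog_total by metis

lemma parity_sign_bracket: "parity_sign (bracket x y) = bracket (parity_sign x) (parity_sign y)"
proof (induction x rule: parity_induct)
  case x: (1 p x)
  show ?case
  proof (induction y rule: parity_induct)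
    case y: (1 q y)
    thus ?case by (simp add: parity_sign_homog[OF x] parity_sign_homog[OF y] parity_sign_homog[OF bracket_homog[OF x y]]
       bracket_scale_left bracket_scale_right scaleC_scaleC) (cases p; cases q; simp)
  qed (simp add: bracket_add_right clinear_add[OF clinear_parity_sign])
qed (simp add: bracket_add_left clinear_add[OF clinear_parity_sign])

lemma form_parity_sign: "form (parity_sign x) (parity_sign y) = form x y"
proof (induction x rule: parity_induct)
  case x: (1 p x)
  show ?case
  proof (induction y rule: parity_induct)
    case y: (1 q y)
    thus ?case using form_even[OF x y]
      by (simp add: parity_sign_homog[OF x] parity_sign_homog[OF y] form_scale_left form_scale_right)
        (cases p; cases q; simp)
  qed (simp add: form_add_right clinear_add[OF clinear_parity_sign])
qed (simp add: form_add_left clinear_add[OF clinear_parity_sign])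

text \<open>The automorphism that multiplies \<open>J\<^bsub>x,n\<^esub>\<close> by \<open>\<plusminus> s\<^sup>-\<^sup>n\<close>, \<open>\<mu>\<^bsub>x,n\<^esub>\<close> by \<open>\<plusminus> t s\<^bsup>n+1\<^esup>\<close> and \<open>\<kappa>\<close> by \<open>t\<close>, where the sign is
  the super parity of \<open>x\<close>: it acts on vectors of cohomological degree \<open>d\<close> and spin \<open>k\<close> by \<open>\<plusminus> t\<^sup>d s\<^sup>k\<close>.\<close>

definition twist :: "complex \<Rightarrow> complex \<Rightarrow> 'g::lie_superalgebra_form affine \<Rightarrow> 'g affine" where
  "twist t s X = Affine (\<lambda>n. (1 / s ^ n) *\<^sub>C parity_sign (cur X n))
     (Poly_Mapping.mapp (\<lambda>n y. (t * s ^ (n + 1)) *\<^sub>C parity_sign y) (mom X)) (t * cen X)"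

lemma parity_sign_zero [simp]: "parity_sign 0 = 0"
  by (rule clinear_zero[OF clinear_parity_sign])

lemma cur_twist: "cur (twist t s X) n = (1 / s ^ n) *\<^sub>C parity_sign (cur X n)"
  and mom_twist: "Poly_Mapping.lookup (mom (twist t s X)) n = (t * s ^ (n + 1)) *\<^sub>C parity_sign (Poly_Mapping.lookup (mom X) n)"
  and cen_twist: "cen (twist t s X) = t * cen X"
  by (auto simp: twist_def lookup_mapp when_def in_keys_iff)

lemma affine_eqI:
  "(\<And>n. cur X n = cur Y n) \<Longrightarrow> (\<And>n. Poly_Mapping.lookup (mom X) n = Poly_Mapping.lookup (mom Y) n) \<Longrightarrow> cen X = cen Y \<Longrightarrow> X = Y"
  by (cases X; cases Y) (auto simp: poly_mapping_eq_iff fun_eq_iff)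

lemma affine_simps:
  "cur (X + Y) n = cur X n + cur Y n" "Poly_Mapping.lookup (mom (X + Y)) n = Poly_Mapping.lookup (mom X) n + Poly_Mapping.lookup (mom Y) n"
  "cen (X + Y) = cen X + cen Y"
  "cur (c *\<^sub>C X) n = c *\<^sub>C cur X n" "Poly_Mapping.lookup (mom (c *\<^sub>C X)) n = c *\<^sub>C Poly_Mapping.lookup (mom X) n"
  "cen (c *\<^sub>C X) = c * cen X"
  by (simp_all add: plus_affine_def scaleC_affine_def lookup_add)

lemma clinear_twist: "clinear (twist t s)"
  by (rule clinearI)
    (auto intro!: affine_eqI simp: affine_simps cur_twist mom_twist cen_twist clinear_add[OF clinear_parity_sign]
      clinear_scale[OF clinear_parity_sign] scaleC_add_right scaleC_scaleC algebra_simps)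

lemma twist_homog: "X \<in> homog p \<Longrightarrow> twist t s X \<in> homog p"
  unfolding homog_affine_def mem_Collect_eq cur_twist mom_twist cen_twist
  by (metis homog_scale parity_sign_in_homog mult_zero_right)

lemma twist_bracket:
  assumes s: "s \<noteq> 0" and X: "X \<in> homog p" and Y: "Y \<in> homog q"
  shows "twist t s (bracket X Y) = bracket (twist t s X) (twist t s Y)"
proof -
  note ps = clinear_add[OF clinear_parity_sign] clinear_scale[OF clinear_parity_sign] clinear_sum[OF clinear_parity_sign]
     clinear_diff[OF clinear_parity_sign]
  have keys: "Poly_Mapping.keys (mom (twist t s X)) \<subseteq> Poly_Mapping.keys (mom X)" for X :: "'a affine"
    by (auto simp: in_keys_iff mom_twist)
  have c1: "Poly_Mapping.lookup (cur_mom (cur (twist t s X)) (mom (twist t s Y))) k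
     = (t * s ^ (k + 1)) *\<^sub>C parity_sign (Poly_Mapping.lookup (cur_mom (cur X) (mom Y)) k)" for X Y :: "'a affine" and k
  proof -
    have e: "1 / s ^ (n - k) * (t * s ^ (n + 1)) = t * s ^ (k + 1)" if "k \<le> n" for n
    proof -
      have "n + 1 = (n - k) + (k + 1)" using that by simp
      hence "s ^ (n + 1) = s ^ (n - k) * s ^ (k + 1)" by (metis power_add)
      thus ?thesis using s by simp
    qed
    have "Poly_Mapping.lookup (cur_mom (cur (twist t s X)) (mom (twist t s Y))) k
      = (\<Sum>n\<in>Poly_Mapping.keys (mom Y). if k \<le> n then bracket (cur (twist t s X) (n - k)) (Poly_Mapping.lookup (mom (twist t s Y)) n) else 0)"
      by (rule lookup_cur_mom[OF finite_keys keys])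
    also have "\<dots> = (\<Sum>n\<in>Poly_Mapping.keys (mom Y). (t * s ^ (k + 1)) *\<^sub>C
        parity_sign (if k \<le> n then bracket (cur X (n - k)) (Poly_Mapping.lookup (mom Y) n) else 0))"
    proof (intro sum.cong refl)
      fix n
      show "(if k \<le> n then bracket (cur (twist t s X) (n - k)) (Poly_Mapping.lookup (mom (twist t s Y)) n) else 0)
        = (t * s ^ (k + 1)) *\<^sub>C parity_sign (if k \<le> n then bracket (cur X (n - k)) (Poly_Mapping.lookup (mom Y) n) else 0)"
      proof (cases "k \<le> n")
        case True
        have "bracket (cur (twist t s X) (n - k)) (Poly_Mapping.lookup (mom (twist t s Y)) n)
          = (1 / s ^ (n - k) * (t * s ^ (n + 1))) *\<^sub>C parity_sign (bracket (cur X (n - k)) (Poly_Mapping.lookup (mom Y) n))"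
          by (simp only: cur_twist mom_twist bracket_scale_left bracket_scale_right scaleC_scaleC parity_sign_bracket mult.commute[of "t * s ^ (n + 1)"])
        thus ?thesis using True by (simp only: e[OF True] if_True)
      qed simp
    qed
    finally show ?thesis
      by (simp only: lookup_cur_mom[OF finite_keys order_refl] ps cvs.scale_sum_right)
  qed
  have c2: "cur_mom_central (cur (twist t s X)) (mom (twist t s Y)) = t * cur_mom_central (cur X) (mom Y)" for X Y :: "'a affine"
  proof -
    have "cur_mom_central (cur (twist t s X)) (mom (twist t s Y))
      = (\<Sum>n\<in>Poly_Mapping.keys (mom Y). of_nat (n + 1) * form (cur (twist t s X) (n + 1)) (Poly_Mapping.lookup (mom (twist t s Y)) n))"
      by (rule cur_mom_central_superset[OF finite_keys keys])
    also have "\<dots> = (\<Sum>n\<in>Poly_Mapping.keys (mom Y). t * (of_nat (n + 1) * form (cur X (n + 1)) (Poly_Mapping.lookup (mom Y) n)))"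
      using s by (intro sum.cong refl) (simp add: cur_twist mom_twist form_scale_left form_scale_right form_parity_sign)
    finally show ?thesis by (simp only: cur_mom_central_def sum_distrib_left)
  qed
  show ?thesis
  proof (rule affine_eqI)
    fix n
    have e: "1 / s ^ n = 1 / s ^ i * (1 / s ^ (n - i))" if "i \<le> n" for i
      using that by (simp add: power_add[symmetric])
    show "cur (twist t s (bracket X Y)) n = cur (bracket (twist t s X) (twist t s Y)) n"
      by (auto simp: bracket_affine_def cur_twist ps cvs.scale_sum_right bracket_scale_left bracket_scale_right
          parity_sign_bracket scaleC_scaleC e intro!: sum.cong)
    show "Poly_Mapping.lookup (mom (twist t s (bracket X Y))) n = Poly_Mapping.lookup (mom (bracket (twist t s X) (twist t s Y))) n"
      unfolding mom_twist bracket_affine_homog[OF X Y] bracket_affine_homog[OF twist_homog[OF X] twist_homog[OF Y]]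
      by (simp add: lookup_minus c1 ps cvs.scale_right_diff_distrib scaleC_scaleC mult.commute)
    show "cen (twist t s (bracket X Y)) = cen (bracket (twist t s X) (twist t s Y))"
      unfolding cen_twist bracket_affine_homog[OF X Y] bracket_affine_homog[OF twist_homog[OF X] twist_homog[OF Y]]
      by (simp add: c2 algebra_simps)
  qed
qed

lemma twist_map_exists:
  assumes "s \<noteq> 0"
  shows "\<exists>\<phi> :: 'g::lie_superalgebra_form vuniv \<Rightarrow> 'g vuniv. clinear \<phi> \<and> \<phi> vac = vac \<and>
    (\<forall>X v. \<phi> (affine_act X v) = affine_act (twist t s X) (\<phi> v))"
proof -
  interpret affine_rep "\<lambda>X. affine_act (twist t s X)" "vac :: 'g vuniv"
  proof
    fix X Y :: "'g affine" and p q w and c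
    show "clinear (affine_act (twist t s X))" by (rule clinear_affine_act)
    show "affine_act (twist t s (X + Y)) w = affine_act (twist t s X) w + affine_act (twist t s Y) w"
      by (simp add: clinear_add[OF clinear_twist] affine_act_add_left)
    show "affine_act (twist t s (c *\<^sub>C X)) w = c *\<^sub>C affine_act (twist t s X) w"
      by (simp add: clinear_scale[OF clinear_twist] affine_act_scale_left)
    show "affine_act (twist t s X) (affine_act (twist t s Y) w)
        = koszul p q *\<^sub>C affine_act (twist t s Y) (affine_act (twist t s X) w) + affine_act (twist t s (bracket X Y)) w"
      if "X \<in> homog p" "Y \<in> homog q"
      unfolding twist_bracket[OF assms that] by (intro affine_act_bracket twist_homog that)
    show "affine_act (twist t s X) vac = 0" if "mom X = 0" "cen X = 0"
    proof (rule affine_act_vac)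
      show "mom (twist t s X) = 0" by (rule poly_mapping_eqI) (simp add: mom_twist that)
    qed (simp add: cen_twist that)
  qed
  show ?thesis by (rule universal_map)
qed

definition twist_map :: "complex \<Rightarrow> complex \<Rightarrow> 'g::lie_superalgebra_form vuniv \<Rightarrow> 'g vuniv" where
  "twist_map t s = (SOME \<phi>. clinear \<phi> \<and> \<phi> vac = vac \<and>
    (\<forall>X v. \<phi> (affine_act X v) = affine_act (twist t s X) (\<phi> v)))"

lemma twist_map:
  assumes "s \<noteq> 0"
  shows clinear_twist_map: "clinear (twist_map t s)"
    and twist_map_vac: "twist_map t s vac = vac"
    and twist_map_act: "twist_map t s (affine_act X v) = affine_act (twist t s X) (twist_map t s v)"
  using someI_ex[OF twist_map_exists[OF assms, of t], folded twist_map_def] by blast+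

lemma twist_momentum: "x \<in> homog p \<Longrightarrow> twist t s (momentum x n) = (koszul 1 p * t * s ^ (n + 1)) *\<^sub>C momentum x n"
  and twist_current: "x \<in> homog p \<Longrightarrow> twist t s (current x n) = (koszul 1 p / s ^ n) *\<^sub>C current x n"
  and twist_kappa: "twist t s kappa = t *\<^sub>C kappa"
  by (auto intro!: affine_eqI simp: cur_twist mom_twist cen_twist affine_simps parity_sign_homog scaleC_scaleC lookup_single when_def)
    (auto simp: momentum_def current_def kappa_def lookup_single when_def parity_sign_homog scaleC_scaleC mult_ac)

subsection \<open>Translation\<close>

instantiation prod :: (complex_space, complex_space) complex_space
begin
definition scaleC_prod :: "complex \<Rightarrow> 'a \<times> 'b \<Rightarrow> 'a \<times> 'b" where
  "scaleC_prod c v = (c *\<^sub>C fst v, c *\<^sub>C snd v)"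
instance
  by standard (simp_all add: scaleC_prod_def scaleC_add_right scaleC_add_left scaleC_scaleC scaleC_one prod_eq_iff)
end

lemma cur_deriv: "cur (affine_deriv X) n = - (of_nat (n + 1) *\<^sub>C cur X (n + 1))"
  and mom_deriv: "Poly_Mapping.lookup (mom (affine_deriv X)) n = of_nat n *\<^sub>C Poly_Mapping.lookup (mom X) (n - 1)"
  and cen_deriv: "cen (affine_deriv X) = 0"
proof -
  show "Poly_Mapping.lookup (mom (affine_deriv X)) n = of_nat n *\<^sub>C Poly_Mapping.lookup (mom X) (n - 1)"
  proof (cases n)
    case (Suc m)
    have "Poly_Mapping.lookup (mom (affine_deriv X)) n
      = (\<Sum>k\<in>Poly_Mapping.keys (mom X). if k = m then of_nat (k + 1) *\<^sub>C Poly_Mapping.lookup (mom X) k else 0)"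
      by (auto simp: affine_deriv_def lookup_sum lookup_single when_def Suc intro!: sum.cong)
    thus ?thesis by (auto simp: Suc sum.delta in_keys_iff)
  qed (auto simp: affine_deriv_def lookup_sum lookup_single when_def)
qed (simp_all add: affine_deriv_def)

lemma clinear_affine_deriv: "clinear affine_deriv"
  by (rule clinearI) (auto intro!: affine_eqI simp: affine_simps cur_deriv mom_deriv cen_deriv scaleC_add_right scaleC_scaleC mult.commute)

lemma affine_deriv_homog: "X \<in> homog p \<Longrightarrow> affine_deriv X \<in> homog p"
  by (auto simp: homog_affine_def cur_deriv mom_deriv cen_deriv intro: homog_scale homog_uminus)

lemma cur_mom_deriv:
  fixes X Y :: "'g::lie_superalgebra_form affine"
  shows "Poly_Mapping.lookup (cur_mom (cur (affine_deriv X)) (mom Y)) k + Poly_Mapping.lookup (cur_mom (cur X) (mom (affine_deriv Y))) k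
     = of_nat k *\<^sub>C Poly_Mapping.lookup (cur_mom (cur X) (mom Y)) (k - 1)"
    and "cur_mom_central (cur (affine_deriv X)) (mom Y) + cur_mom_central (cur X) (mom (affine_deriv Y)) = 0"
proof -
  define N where "N = Suc (Max (insert 0 (Poly_Mapping.keys (mom Y))))"
  have kN: "Poly_Mapping.keys (mom Y) \<subseteq> {..<N}"
    by (auto simp: N_def less_Suc_eq_le)
  have kS: "Poly_Mapping.keys (mom (affine_deriv Y)) \<subseteq> {..<Suc N}"
  proof
    fix n assume "n \<in> Poly_Mapping.keys (mom (affine_deriv Y))"
    hence "n - 1 \<in> Poly_Mapping.keys (mom Y)" by (auto simp: in_keys_iff mom_deriv)
    thus "n \<in> {..<Suc N}" using kN by auto
  qed
  let ?x = "cur X" and ?y = "Poly_Mapping.lookup (mom Y)"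
  have a: "Poly_Mapping.lookup (cur_mom ?x (mom (affine_deriv Y))) k
     = (\<Sum>m<N. if k \<le> Suc m then of_nat (Suc m) *\<^sub>C bracket (?x (Suc m - k)) (?y m) else 0)"
    unfolding lookup_cur_mom[OF finite_lessThan kS] sum.lessThan_Suc_shift
    by (auto simp: mom_deriv bracket_scale_right simp del: of_nat_Suc intro!: sum.cong)
  have b: "Poly_Mapping.lookup (cur_mom (cur (affine_deriv X)) (mom Y)) k
     = (\<Sum>m<N. if k \<le> m then - (of_nat (m - k + 1) *\<^sub>C bracket (?x (m - k + 1)) (?y m)) else 0)"
    unfolding lookup_cur_mom[OF finite_lessThan kN]
    by (auto simp: cur_deriv bracket_uminus bracket_scale_left simp del: of_nat_Suc of_nat_add intro!: sum.cong)
  have l: "Poly_Mapping.lookup (cur_mom ?x (mom Y)) (k - 1) = (\<Sum>m<N. if k - 1 \<le> m then bracket (?x (m - (k - 1))) (?y m) else 0)"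
    by (rule lookup_cur_mom[OF finite_lessThan kN])
  have "(if k \<le> m then - (of_nat (m - k + 1) *\<^sub>C bracket (?x (m - k + 1)) (?y m)) else 0)
     + (if k \<le> Suc m then of_nat (Suc m) *\<^sub>C bracket (?x (Suc m - k)) (?y m) else 0)
     = of_nat k *\<^sub>C (if k - 1 \<le> m then bracket (?x (m - (k - 1))) (?y m) else 0)" for m
  proof (cases k "Suc m" rule: linorder_cases)
    case less
    have "of_nat (Suc m) = (of_nat (m - k + 1) + of_nat k :: complex)"
      using less by (simp add: of_nat_diff)
    moreover have "Suc m - k = m - k + 1" using less by simp
    ultimately show ?thesis using less by (cases k) (simp_all add: scaleC_add_left Suc_diff_le cvs.scale_left_diff_distrib)
  qed auto
  thus "Poly_Mapping.lookup (cur_mom (cur (affine_deriv X)) (mom Y)) k + Poly_Mapping.lookup (cur_mom (cur X) (mom (affine_deriv Y))) k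
     = of_nat k *\<^sub>C Poly_Mapping.lookup (cur_mom (cur X) (mom Y)) (k - 1)"
    unfolding a b l cvs.scale_sum_right sum.distrib[symmetric]
    by (intro sum.cong refl) blast
  have c: "cur_mom_central ?x (mom (affine_deriv Y)) = (\<Sum>m<N. of_nat (m + 2) * (of_nat (m + 1) * form (?x (m + 2)) (?y m)))"
    unfolding cur_mom_central_superset[OF finite_lessThan kS] sum.lessThan_Suc_shift
    by (auto simp: mom_deriv form_scale_right simp del: of_nat_Suc of_nat_add intro!: sum.cong)
  have u: "form (- x) y = - form x y" for x y :: 'g using form_scale_left[of "-1" x y] by simp
  have d: "cur_mom_central (cur (affine_deriv X)) (mom Y) = - (\<Sum>m<N. of_nat (m + 2) * (of_nat (m + 1) * form (?x (m + 2)) (?y m)))"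
    unfolding cur_mom_central_superset[OF finite_lessThan kN] sum_negf[symmetric]
    by (intro sum.cong refl) (simp add: cur_deriv u form_scale_left mult_ac)
  show "cur_mom_central (cur (affine_deriv X)) (mom Y) + cur_mom_central (cur X) (mom (affine_deriv Y)) = 0"
    unfolding c d by simp
qed

text \<open>In the central component both sides vanish, since the two contributions
  \<open>\<plusminus> (n+1)(n+2) h(x\<^bsub>n+2\<^esub>, y\<^sub>n)\<close> cancel.\<close>

lemma affine_deriv_bracket:
  assumes X: "X \<in> homog p" and Y: "Y \<in> homog q"
  shows "affine_deriv (bracket X Y) = bracket (affine_deriv X) Y + bracket X (affine_deriv Y)"
proof -
  note b = bracket_affine_homog[OF X Y] bracket_affine_homog[OF affine_deriv_homog[OF X] Y] bracket_affine_homog[OF X affine_deriv_homog[OF Y]]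
  show ?thesis
  proof (rule affine_eqI)
    fix n
    let ?t = "\<lambda>i. bracket (cur X i) (cur Y (Suc n - i))"
    have 1: "cur (bracket (affine_deriv X) Y) n = - (\<Sum>i\<le>Suc n. of_nat i *\<^sub>C ?t i)"
      unfolding sum.atMost_Suc_shift
      by (simp add: bracket_affine_def cur_deriv bracket_uminus bracket_scale_left sum_negf del: of_nat_Suc)
    have 2: "cur (bracket X (affine_deriv Y)) n = - (\<Sum>i\<le>Suc n. of_nat (Suc n - i) *\<^sub>C ?t i)"
    proof -
      have "bracket (cur X i) (cur (affine_deriv Y) (n - i)) = - (of_nat (Suc n - i) *\<^sub>C ?t i)" if "i \<le> n" for i
        using that by (simp only: cur_deriv bracket_uminus bracket_scale_right Suc_diff_le Suc_eq_plus1[symmetric])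
      hence "cur (bracket X (affine_deriv Y)) n = (\<Sum>i\<le>n. - (of_nat (Suc n - i) *\<^sub>C ?t i))"
        unfolding bracket_affine_def affine.sel by (intro sum.cong refl) simp
      thus ?thesis by (simp add: sum_negf)
    qed
    have 3: "(\<Sum>i\<le>Suc n. of_nat i *\<^sub>C ?t i) + (\<Sum>i\<le>Suc n. of_nat (Suc n - i) *\<^sub>C ?t i) = of_nat (Suc n) *\<^sub>C (\<Sum>i\<le>Suc n. ?t i)"
      unfolding sum.distrib[symmetric] scaleC_add_left[symmetric] of_nat_add[symmetric] cvs.scale_sum_right
      by (intro sum.cong refl) (simp only: atMost_iff le_add_diff_inverse)
    have "cur (affine_deriv (bracket X Y)) n = - (of_nat (Suc n) *\<^sub>C (\<Sum>i\<le>Suc n. ?t i))"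
      by (simp add: bracket_affine_def cur_deriv del: sum.atMost_Suc of_nat_Suc)
    thus "cur (affine_deriv (bracket X Y)) n = cur (bracket (affine_deriv X) Y + bracket X (affine_deriv Y)) n"
      unfolding affine_simps 1 2 3[symmetric] by simp
    show "Poly_Mapping.lookup (mom (affine_deriv (bracket X Y))) n
        = Poly_Mapping.lookup (mom (bracket (affine_deriv X) Y + bracket X (affine_deriv Y))) n"
    proof -
      have k: "of_nat n *\<^sub>C koszul p q *\<^sub>C z = koszul p q *\<^sub>C of_nat n *\<^sub>C z" for z :: 'a
        by (simp only: scaleC_scaleC mult.commute)
      show ?thesis
        unfolding affine_simps mom_deriv b affine.sel lookup_minus lookup_scaleC cvs.scale_right_diff_distrib
          k cur_mom_deriv(1)[symmetric] scaleC_add_right by simp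
    qed
    show "cen (affine_deriv (bracket X Y)) = cen (bracket (affine_deriv X) Y + bracket X (affine_deriv Y))"
      unfolding affine_simps cen_deriv b affine.sel
      using cur_mom_deriv(2)[of X Y] cur_mom_deriv(2)[of Y X] by (simp add: add_eq_0_iff2)
  qed
qed

text \<open>A derivation of \<open>V\<close> over the derivation of the Lie algebra is a homomorphism to \<open>V \<oplus> V\<close>, on which \<open>X\<close> acts by the
  block matrix with diagonal \<open>X\<close> and \<open>\<partial>X\<close> below it, whose first component is the identity.\<close>

lemma translation_exists: "\<exists>D :: 'g::lie_superalgebra_form vuniv \<Rightarrow> 'g vuniv. is_translation D"
proof -
  let ?r = "\<lambda>X (v :: 'g vuniv \<times> 'g vuniv). (affine_act X (fst v), affine_act X (snd v) + affine_act (affine_deriv X) (fst v))"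
  interpret affine_rep ?r "(vac, 0)"
  proof
    fix X Y :: "'g affine" and p q w and c
    show "clinear (?r X)"
      by (rule clinearI) (simp_all add: scaleC_prod_def affine_act_add_right affine_act_scale_right scaleC_add_right)
    show "?r (X + Y) w = ?r X w + ?r Y w" "?r (c *\<^sub>C X) w = c *\<^sub>C ?r X w"
      by (simp_all add: scaleC_prod_def clinear_add[OF clinear_affine_deriv] clinear_scale[OF clinear_affine_deriv]
          affine_act_add_left affine_act_scale_left scaleC_add_right)
    show "?r X (?r Y w) = koszul p q *\<^sub>C ?r Y (?r X w) + ?r (bracket X Y) w"
      if X: "X \<in> homog p" and Y: "Y \<in> homog q"
      by (simp add: scaleC_prod_def affine_deriv_bracket[OF X Y] affine_act_add_right affine_act_add_left scaleC_add_right
          affine_act_bracket[OF X Y] affine_act_bracket[OF affine_deriv_homog[OF X] Y] affine_act_bracket[OF X affine_deriv_homog[OF Y]])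
    show "?r X (vac, 0) = 0" if "mom X = 0" "cen X = 0"
    proof -
      have "mom (affine_deriv X) = 0" by (rule poly_mapping_eqI) (simp add: mom_deriv that)
      thus ?thesis by (simp add: affine_act_vac that cen_deriv clinear_zero[OF clinear_affine_act] zero_prod_def)
    qed
  qed
  obtain \<phi> where \<phi>: "clinear \<phi>" "\<phi> vac = (vac, 0)" "\<And>X v. \<phi> (affine_act X v) = ?r X (\<phi> v)"
    using universal_map by blast
  have f: "fst (\<phi> v) = v" for v
    by (induction v rule: vuniv_induct) (simp_all add: \<phi>(2,3) clinear_add[OF \<phi>(1)] clinear_scale[OF \<phi>(1)] scaleC_prod_def)
  have "is_translation (\<lambda>v. snd (\<phi> v))"
    unfolding is_translation_def
    by (simp add: \<phi>(2,3) clinear_add[OF \<phi>(1)] clinear_scale[OF \<phi>(1)] scaleC_prod_def f add.commute)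
  thus ?thesis by blast
qed

definition translation :: "'g::lie_superalgebra_form vuniv \<Rightarrow> 'g vuniv" where
  "translation = (SOME D. is_translation D)"

lemma is_translation_translation: "is_translation translation"
  unfolding translation_def by (rule someI_ex[OF translation_exists])

lemma clinear_translation: "clinear translation"
  and translation_vac: "translation vac = 0"
  and translation_act: "translation (affine_act X v) = affine_act (affine_deriv X) v + affine_act X (translation v)"
  using is_translation_translation by (auto simp: is_translation_def clinear_def)

lemma deriv_momentum: "affine_deriv (momentum x n) = of_nat (n + 1) *\<^sub>C momentum x (n + 1)"
  and deriv_current: "affine_deriv (current x n) = - (of_nat n *\<^sub>C current x (n - 1))"
  and deriv_kappa: "affine_deriv kappa = 0"
  by (auto intro!: affine_eqI simp: cur_deriv mom_deriv cen_deriv affine_simps bracket_uminus)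
    (auto simp: momentum_def current_def kappa_def lookup_single when_def zero_affine_def uminus_affine_def scaleC_affine_def simp del: of_nat_Suc)

section \<open>The induced module as a commutative differential superalgebra\<close>

text \<open>For \<open>t = -1\<close>, \<open>s = 1\<close> the twist is the sign of the total parity.\<close>

definition vparity :: "'g::lie_superalgebra_form vuniv \<Rightarrow> 'g vuniv" where
  "vparity = twist_map (-1) 1"

lemma clinear_vparity: "clinear vparity"
  and vparity_vac: "vparity vac = vac"
  unfolding vparity_def by (simp_all add: clinear_twist_map twist_map_vac)

lemma vparity_act: "X \<in> homog p \<Longrightarrow> vparity (affine_act X v) = koszul 1 p *\<^sub>C affine_act X (vparity v)"
proof -
  assume X: "X \<in> homog p"
  have "twist (-1) 1 X = koszul 1 p *\<^sub>C X"
  proof (rule affine_eqI)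
    fix n
    have "cur X n \<in> homog p" "Poly_Mapping.lookup (mom X) n \<in> homog (p + 1)" using X by (auto simp: homog_affine_def)
    moreover have "- koszul 1 (p + 1) = koszul 1 p" by (cases p) simp_all
    ultimately show "cur (twist (-1) 1 X) n = cur (koszul 1 p *\<^sub>C X) n"
      "Poly_Mapping.lookup (mom (twist (-1) 1 X)) n = Poly_Mapping.lookup (mom (koszul 1 p *\<^sub>C X)) n"
      by (simp_all add: cur_twist mom_twist affine_simps parity_sign_homog scaleC_scaleC del: cvs.scale_minus_left)
  next
    have "cen X \<noteq> 0 \<Longrightarrow> p = 1" using X by (auto simp: homog_affine_def)
    thus "cen (twist (-1) 1 X) = cen (koszul 1 p *\<^sub>C X)"
      by (cases "cen X = 0") (simp_all add: cen_twist affine_simps del: cvs.scale_minus_left)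
  qed
  thus ?thesis by (simp add: vparity_def twist_map_act affine_act_scale_left)
qed

lemma vparity_vparity: "vparity (vparity v) = v"
proof (induction v rule: vuniv_momentum_induct)
  case (momentum x p v n)
  thus ?case by (simp add: vparity_act[OF momentum_homog[OF momentum(1)]] clinear_scale[OF clinear_vparity] scaleC_scaleC)
next
  case (kappa v)
  thus ?case by (simp add: vparity_act[OF kappa_homog] clinear_scale[OF clinear_vparity] clinear_uminus[OF clinear_vparity])
qed (simp_all add: vparity_vac clinear_add[OF clinear_vparity] clinear_scale[OF clinear_vparity])

text \<open>The twist by the parity operator that accompanies passing an element of parity \<open>p\<close>.\<close>

definition vpar :: "bit \<Rightarrow> 'g::lie_superalgebra_form vuniv \<Rightarrow> 'g vuniv" where
  "vpar p v = (if p = 1 then vparity v else v)"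

lemma clinear_vpar: "clinear (vpar p)"
  using clinear_vparity by (cases p) (simp_all add: vpar_def clinear_def)

lemma vpar_vac [simp]: "vpar p vac = vac" by (simp add: vpar_def vparity_vac)

lemma vpar_act: "X \<in> homog q \<Longrightarrow> vpar p (affine_act X v) = koszul p q *\<^sub>C affine_act X (vpar p v)"
  by (cases p) (simp_all add: vpar_def vparity_act scaleC_one)

definition vuniv_parity :: "bit \<Rightarrow> 'g::lie_superalgebra_form vuniv set" where
  "vuniv_parity p = {v. vparity v = koszul 1 p *\<^sub>C v}"

lemma vpar_parity: "v \<in> vuniv_parity q \<Longrightarrow> vpar p v = koszul p q *\<^sub>C v"
  by (cases p) (simp_all add: vpar_def vuniv_parity_def scaleC_one)

lemma act_parity: "X \<in> homog p \<Longrightarrow> v \<in> vuniv_parity q \<Longrightarrow> affine_act X v \<in> vuniv_parity (p + q)"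
  by (simp add: vuniv_parity_def vparity_act affine_act_scale_right scaleC_scaleC)
    (cases p; cases q; simp)

text \<open>The negative part, which consists of momenta and the central element, acts by supercommuting operators.\<close>

definition negative :: "bit \<Rightarrow> 'g::lie_superalgebra_form affine \<Rightarrow> bool" where
  "negative p X \<longleftrightarrow> X \<in> homog p \<and> cur X = (\<lambda>n. 0)"

lemma negative_homog: "negative p X \<Longrightarrow> X \<in> homog p" by (simp add: negative_def)

lemma negative_momentum: "x \<in> homog p \<Longrightarrow> negative (p + 1) (momentum x n)"
  unfolding negative_def by (intro conjI momentum_homog) (simp_all add: momentum_def)

lemma negative_kappa: "negative 1 kappa"
  unfolding negative_def by (intro conjI kappa_homog) (simp_all add: kappa_def)

lemma negative_commute:
  assumes "negative p X" "negative q Y"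
  shows "affine_act X (affine_act Y v) = koszul p q *\<^sub>C affine_act Y (affine_act X v)"
proof -
  have "bracket X Y = 0" using assms by (simp add: negative_def bracket_affine_def zero_affine_def)
  thus ?thesis using affine_act_bracket[of X p Y q v] assms by (simp add: negative_def affine_act_zero_left)
qed

lemma negative_induct [case_names vac add scale act]:
  assumes "P vac" "\<And>v w. P v \<Longrightarrow> P w \<Longrightarrow> P (v + w)" "\<And>c v. P v \<Longrightarrow> P (c *\<^sub>C v)"
    and "\<And>p X v. negative p X \<Longrightarrow> P v \<Longrightarrow> P (affine_act X v)"
  shows "P (v :: 'g::lie_superalgebra_form vuniv)"
  by (induction v rule: vuniv_momentum_induct) (use assms negative_momentum negative_kappa in blast)+

text \<open>Right multiplications commute with left multiplications without a sign, whatever the parities are.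
  This makes them the linear objects from which to construct the product.\<close>

definition is_rmul :: "('g::lie_superalgebra_form vuniv \<Rightarrow> 'g vuniv) \<Rightarrow> bool" where
  "is_rmul r \<longleftrightarrow> clinear r \<and> (\<forall>p X v. negative p X \<longrightarrow> r (affine_act X v) = affine_act X (r v))"

lemma is_rmul_clinear: "is_rmul r \<Longrightarrow> clinear r"
  and is_rmul_act: "is_rmul r \<Longrightarrow> negative p X \<Longrightarrow> r (affine_act X v) = affine_act X (r v)"
  by (auto simp: is_rmul_def)

lemma is_rmul_unique:
  assumes "is_rmul r" "is_rmul r'" "r vac = r' vac" shows "r = r'"
proof
  fix v show "r v = r' v"
  proof (induction v rule: negative_induct)
    case (act p X v) thus ?case using assms by (simp add: is_rmul_act)
  qed (use assms in \<open>auto simp: clinear_add[OF is_rmul_clinear] clinear_scale[OF is_rmul_clinear]\<close>)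
qed

text \<open>Right multiplication by \<open>X b\<close>: move \<open>X\<close> to the left past the argument, which costs the parity operator, then
  multiply by \<open>b\<close>.\<close>

lemma is_rmul_step:
  fixes r :: "'g::lie_superalgebra_form vuniv \<Rightarrow> 'g vuniv"
  assumes r: "is_rmul r" and X: "negative p X"
  shows "is_rmul (\<lambda>v. r (affine_act X (vpar p v)))"
  unfolding is_rmul_def
proof (intro conjI allI impI)
  show "clinear (\<lambda>v. r (affine_act X (vpar p v)))"
    by (intro clinear_compose[OF is_rmul_clinear[OF r]] clinear_compose[OF clinear_affine_act] clinear_vpar)
  fix q and Y :: "'g affine" and v :: "'g vuniv" assume Y: "negative q Y"
  have kk: "koszul p q * koszul p q = 1" by (simp add: koszul_def)
  have "affine_act X (vpar p (affine_act Y v)) = affine_act Y (affine_act X (vpar p v))"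
    by (simp add: vpar_act[OF negative_homog[OF Y]] affine_act_scale_right negative_commute[OF X Y] scaleC_scaleC kk scaleC_one)
  thus "r (affine_act X (vpar p (affine_act Y v))) = affine_act Y (r (affine_act X (vpar p v)))"
    by (simp add: is_rmul_act[OF r Y])
qed

lemma is_rmul_exists: "\<exists>r. is_rmul r \<and> r vac = b"
proof (induction b rule: negative_induct)
  case vac
  show ?case by (rule exI[of _ "\<lambda>v. v"]) (simp add: is_rmul_def clinear_def)
next
  case (add b c)
  then obtain r r' where "is_rmul r" "r vac = b" "is_rmul r'" "r' vac = c" by blast
  thus ?case
    by (intro exI[of _ "\<lambda>v. r v + r' v"]) (auto simp: is_rmul_def clinear_def affine_act_add_right scaleC_add_right)
next
  case (scale t b)
  then obtain r where "is_rmul r" "r vac = b" by blast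
  thus ?case
    by (intro exI[of _ "\<lambda>v. t *\<^sub>C r v"]) (auto simp: is_rmul_def clinear_def affine_act_scale_right scaleC_add_right scaleC_scaleC mult.commute)
next
  case (act p X b)
  then obtain r where r: "is_rmul r" "r vac = b" by blast
  have "r (affine_act X (vpar p vac)) = affine_act X b"
    by (simp add: r(2) is_rmul_act[OF r(1) act(1)])
  thus ?case using is_rmul_step[OF r(1) act(1)] by blast
qed

definition vmul :: "'g::lie_superalgebra_form vuniv \<Rightarrow> 'g vuniv \<Rightarrow> 'g vuniv" where
  "vmul a b = (THE r. is_rmul r \<and> r vac = b) a"

lemma vmul_rmul: "is_rmul (\<lambda>a. vmul a b)" and vmul_vac: "vmul vac b = b"
proof -
  have "\<exists>!r. is_rmul r \<and> r vac = b" using is_rmul_exists is_rmul_unique by metis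
  from theI'[OF this] show "is_rmul (\<lambda>a. vmul a b)" "vmul vac b = b" by (simp_all add: vmul_def[abs_def])
qed

lemma vmul_eqI: "is_rmul r \<Longrightarrow> r vac = b \<Longrightarrow> vmul a b = r a"
  using is_rmul_unique[OF vmul_rmul[of b]] vmul_vac by metis

lemmas vmul_add_left = clinear_add[OF is_rmul_clinear[OF vmul_rmul]]
  and vmul_scale_left = clinear_scale[OF is_rmul_clinear[OF vmul_rmul]]

lemma vmul_act: "negative p X \<Longrightarrow> vmul (affine_act X a) b = affine_act X (vmul a b)"
  using is_rmul_act[OF vmul_rmul] .

lemma vmul_vac_right: "vmul a vac = a"
  by (rule vmul_eqI) (auto simp: is_rmul_def clinear_def)

lemma vmul_add_right: "vmul a (b + c) = vmul a b + vmul a c"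
  using vmul_rmul[of b] vmul_rmul[of c]
  by (intro vmul_eqI) (auto simp: is_rmul_def clinear_def affine_act_add_right scaleC_add_right vmul_vac)

lemma vmul_scale_right: "vmul a (t *\<^sub>C b) = t *\<^sub>C vmul a b"
  using vmul_rmul[of b]
  by (intro vmul_eqI) (auto simp: is_rmul_def clinear_def affine_act_scale_right scaleC_add_right scaleC_scaleC mult.commute vmul_vac)

lemma vmul_act_right: "negative p X \<Longrightarrow> vmul a (affine_act X b) = affine_act X (vmul (vpar p a) b)"
proof -
  assume X: "negative p X"
  have "vmul a (affine_act X b) = vmul (affine_act X (vpar p a)) b"
    by (rule vmul_eqI[OF is_rmul_step[OF vmul_rmul X]]) (simp add: vmul_act[OF X] vmul_vac)
  thus ?thesis by (simp add: vmul_act[OF X])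
qed

lemma vmul_assoc: "vmul (vmul a b) c = vmul a (vmul b c)"
proof (induction a rule: negative_induct)
  case (act p X v) thus ?case by (simp add: vmul_act[OF act(1)])
qed (simp_all add: vmul_vac vmul_add_left vmul_scale_left)

lemma vpar_vmul: "vpar p (vmul a b) = vmul (vpar p a) (vpar p b)"
proof (induction a rule: negative_induct)
  case (act q X v)
  thus ?case by (simp add: vmul_act[OF act(1)] vpar_act[OF negative_homog[OF act(1)]] vmul_scale_left)
qed (simp_all add: vmul_vac vmul_add_left vmul_scale_left clinear_add[OF clinear_vpar] clinear_scale[OF clinear_vpar])

text \<open>Supercommutativity in the form in which it is linear in \<open>b\<close>, as the induction requires.\<close>

lemma vmul_swap: "a \<in> vuniv_parity p \<Longrightarrow> vmul a b = vmul (vpar p b) a"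
proof (induction b rule: negative_induct)
  case (act q X b)
  have "koszul q p = koszul p q" by (auto simp: koszul_def)
  thus ?case using act
    by (simp add: vmul_act_right[OF act(1)] vpar_parity vpar_act[OF negative_homog[OF act(1)]] vmul_scale_left affine_act_scale_right vmul_act[OF act(1)])
qed (simp_all add: vmul_vac vmul_vac_right vmul_add_left vmul_scale_left vmul_add_right vmul_scale_right
      clinear_add[OF clinear_vpar] clinear_scale[OF clinear_vpar])

lemma translation_vmul: "translation (vmul a b) = vmul (translation a) b + vmul a (translation b)"
proof (induction a rule: negative_induct)
  case (act p X a)
  have "negative p (affine_deriv X)"
    using act(1) by (auto simp: negative_def affine_deriv_homog fun_eq_iff cur_deriv)
  thus ?case
    by (simp add: vmul_act[OF act(1)] translation_act act(2) vmul_add_left vmul_act affine_act_add_right)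
qed (simp_all add: vmul_vac vmul_add_left vmul_scale_left translation_vac clinear_add[OF clinear_translation]
    clinear_scale[OF clinear_translation] scaleC_add_right clinear_zero[OF is_rmul_clinear[OF vmul_rmul]] vmul_vac)

lemma vparity_translation: "vparity (translation v) = translation (vparity v)"
proof (induction v rule: negative_induct)
  case (act p X v)
  thus ?case
    by (simp add: translation_act vparity_act[OF negative_homog[OF act(1)]] vparity_act[OF affine_deriv_homog[OF negative_homog[OF act(1)]]]
        clinear_add[OF clinear_vparity] clinear_scale[OF clinear_translation] scaleC_add_right)
qed (simp_all add: vparity_vac translation_vac clinear_add[OF clinear_vparity] clinear_scale[OF clinear_vparity]
    clinear_add[OF clinear_translation] clinear_scale[OF clinear_translation] clinear_zero[OF clinear_vparity])

text \<open>By induction on the first factor: the commutator of a current with a negative element is again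
  negative, hence acts on a product through its first factor.\<close>

lemma current_vmul:
  assumes C: "C \<in> homog q" "mom C = 0" "cen C = 0"
  shows "affine_act C (vmul a b) = vmul (affine_act C a) b + vmul (vpar q a) (affine_act C b)"
proof (induction a rule: negative_induct)
  case (act p X a)
  have n: "negative (q + p) (bracket C X)"
    using bracket_homog[OF C(1) negative_homog[OF act(1)]] act(1) by (simp add: negative_def bracket_affine_def)
  show ?case
    by (simp add: vmul_act[OF act(1)] affine_act_bracket[OF C(1) negative_homog[OF act(1)]] act(2) vmul_add_left vmul_scale_left
        vmul_act[OF n] vpar_act[OF negative_homog[OF act(1)]] affine_act_add_right scaleC_add_right)
qed (simp_all add: vmul_vac affine_act_vac[OF C(2,3)] vmul_add_left vmul_scale_left affine_act_add_right affine_act_scale_right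
    clinear_add[OF clinear_vpar] clinear_scale[OF clinear_vpar] clinear_zero[OF is_rmul_clinear[OF vmul_rmul]] scaleC_add_right)

global_interpretation V: comm_diff_superalgebra vmul vac translation vuniv_parity
proof
  fix a b c v :: "'a vuniv" and p q :: bit and t :: complex
  show "vmul (a + b) c = vmul a c + vmul b c" "vmul a (b + c) = vmul a b + vmul a c"
    "vmul (t *\<^sub>C a) b = t *\<^sub>C vmul a b" "vmul a (t *\<^sub>C b) = t *\<^sub>C vmul a b"
    "vmul (vmul a b) c = vmul a (vmul b c)" "vmul vac a = a" "vmul a vac = a"
    "translation (a + b) = translation a + translation b" "translation (t *\<^sub>C a) = t *\<^sub>C translation a"
    "translation (vmul a b) = vmul (translation a) b + vmul a (translation b)"
    by (fact vmul_add_left vmul_add_right vmul_scale_left vmul_scale_right vmul_assoc vmul_vac vmul_vac_right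
        clinear_add[OF clinear_translation] clinear_scale[OF clinear_translation] translation_vmul)+
  show "a + b \<in> vuniv_parity p" if "a \<in> vuniv_parity p" "b \<in> vuniv_parity p"
    using that by (simp add: vuniv_parity_def clinear_add[OF clinear_vparity] scaleC_add_right)
  show "t *\<^sub>C a \<in> vuniv_parity p" if "a \<in> vuniv_parity p"
    using that by (simp add: vuniv_parity_def clinear_scale[OF clinear_vparity] scaleC_scaleC mult.commute)
  show "0 \<in> vuniv_parity p" by (simp add: vuniv_parity_def clinear_zero[OF clinear_vparity])
  show "vac \<in> vuniv_parity 0" by (simp add: vuniv_parity_def vparity_vac scaleC_one)
  show "vmul a b \<in> vuniv_parity (p + q)" if "a \<in> vuniv_parity p" "b \<in> vuniv_parity q"
  proof -
    have "koszul 1 q * koszul 1 p = koszul 1 (p + q)" by (cases p; cases q; simp)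
    moreover have "vparity (vmul a b) = vmul (koszul 1 p *\<^sub>C a) (koszul 1 q *\<^sub>C b)"
      using that vpar_vmul[of 1 a b] by (simp only: vuniv_parity_def mem_Collect_eq vpar_def if_True simp_thms)
    ultimately show ?thesis
      by (simp only: vuniv_parity_def mem_Collect_eq vmul_scale_left vmul_scale_right scaleC_scaleC)
  qed
  show "a = 0" if "a \<in> vuniv_parity 0" "a \<in> vuniv_parity 1"
  proof -
    have "a = - a" using that by (simp add: vuniv_parity_def scaleC_one)
    hence "2 *\<^sub>C a = 0" by (metis one_add_one scaleC_add_left scaleC_one add.right_inverse)
    thus ?thesis by simp
  qed
  show "\<exists>a\<in>vuniv_parity 0. \<exists>b\<in>vuniv_parity 1. v = a + b"
  proof (intro bexI)
    show "(1 / 2) *\<^sub>C (v + vparity v) \<in> vuniv_parity 0" "(1 / 2) *\<^sub>C (v - vparity v) \<in> vuniv_parity 1"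
      by (simp_all add: vuniv_parity_def clinear_scale[OF clinear_vparity] clinear_add[OF clinear_vparity] clinear_diff[OF clinear_vparity]
          vparity_vparity scaleC_one cvs.scale_right_diff_distrib scaleC_add_right)
    show "v = (1 / 2) *\<^sub>C (v + vparity v) + (1 / 2) *\<^sub>C (v - vparity v)"
      by (simp add: scaleC_add_right cvs.scale_right_diff_distrib flip: scaleC_add_left)
  qed
  show "vmul a b = koszul p q *\<^sub>C vmul b a" if "a \<in> vuniv_parity p" "b \<in> vuniv_parity q"
    by (simp add: vmul_swap[OF that(1)] vpar_parity[OF that(2)] vmul_scale_left)
  show "translation a \<in> vuniv_parity p" if "a \<in> vuniv_parity p"
    using that by (simp add: vuniv_parity_def vparity_translation clinear_scale[OF clinear_translation])
qed

section \<open>The bracket on the induced module\<close>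

definition vuniv_gens :: "bit \<Rightarrow> 'g::lie_superalgebra_form vuniv \<Rightarrow> (nat \<Rightarrow> 'g vuniv \<Rightarrow> 'g vuniv) \<Rightarrow> bool" where
  "vuniv_gens p a A \<longleftrightarrow>
     (\<exists>x q. x \<in> homog q \<and> p = q + 1 \<and> a = affine_act (momentum x 0) vac \<and> A = (\<lambda>n. affine_act (current x n))) \<or>
     (p = 1 \<and> a = affine_act kappa vac \<and> A = (\<lambda>n v. 0))"

lemma vuniv_gens_cases [consumes 1, case_names momentum kappa]:
  assumes "vuniv_gens p a A"
  obtains x q where "x \<in> homog q" "p = q + 1" "a = affine_act (momentum x 0) vac" "A = (\<lambda>n. affine_act (current x n))"
  | "p = 1" "a = affine_act kappa vac" "A = (\<lambda>n v. 0)"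
  using assms unfolding vuniv_gens_def by blast

lemma affine_act_uminus_left: "affine_act (- X) v = - affine_act X v"
  using affine_act_scale_left[of "-1" X v] by simp

lemma mom_current [simp]: "mom (current x n) = 0" "cen (current x n) = 0"
  by (simp_all add: current_def)

lemma vac_parity: "vac \<in> vuniv_parity 0" by (rule V.pv_one)

lemma bit_cancel [simp]: "(q::bit) + 1 + 1 = q" by (cases q) simp_all

lemma current_vanishing:
  assumes x: "x \<in> homog q"
  shows "vanishing (\<lambda>n. affine_act (current x n) v)"
proof (induction v rule: vuniv_momentum_induct)
  case vac
  show ?case by (rule vanishingI[of 0]) (simp add: affine_act_vac)
next
  case (add v w) thus ?case by (simp add: affine_act_add_right vanishing_add)
next
  case (scale v c) thus ?case by (simp add: affine_act_scale_right vanishing_scale)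
next
  case (momentum y p v m)
  then obtain M where M: "\<And>n. n \<ge> M \<Longrightarrow> affine_act (current x n) v = 0" unfolding vanishing_def by blast
  show ?case
  proof (rule vanishingI[of "max M (m + 2)"])
    fix n assume "n \<ge> max M (m + 2)"
    thus "affine_act (current x n) (affine_act (momentum y m) v) = 0"
      by (simp add: affine_act_bracket[OF current_homog[OF x] momentum_homog[OF momentum(1)]] M
          clinear_zero[OF clinear_affine_act] bracket_current_momentum affine_act_zero_left)
  qed
next
  case (kappa v)
  then obtain M where M: "\<And>n. n \<ge> M \<Longrightarrow> affine_act (current x n) v = 0" unfolding vanishing_def by blast
  show ?case
    by (rule vanishingI[of M])
      (simp add: affine_act_bracket[OF current_homog[OF x] kappa_homog] M bracket_kappa
        clinear_zero[OF clinear_affine_act] affine_act_zero_left)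
qed

lemma conf_der_current:
  assumes x: "x \<in> homog q"
  shows "V.conf_der (q + 1) (\<lambda>n. affine_act (current x n))"
  unfolding V.conf_der_def
proof (intro conjI allI impI)
  fix n r and v a b :: "'a vuniv"
  show "clinear (affine_act (current x n))" by (rule clinear_affine_act)
  show "v \<in> vuniv_parity r \<Longrightarrow> affine_act (current x n) v \<in> vuniv_parity (q + 1 + 1 + r)"
    using act_parity[OF current_homog[OF x]] by simp
  show "a \<in> vuniv_parity r \<Longrightarrow> affine_act (current x n) (vmul a b)
      = vmul (affine_act (current x n) a) b + koszul (q + 1 + 1) r *\<^sub>C vmul a (affine_act (current x n) b)"
    by (simp add: current_vmul[OF current_homog[OF x]] vpar_parity vmul_scale_left)
  show "affine_act (current x n) (translation v) = translation (affine_act (current x n) v) + of_nat n *\<^sub>C affine_act (current x (n - 1)) v"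
    by (simp add: translation_act deriv_current affine_act_uminus_left affine_act_scale_left)
  show "vanishing (\<lambda>n. affine_act (current x n) v)" by (rule current_vanishing[OF x])
qed

lemma current_momentum_vac:
  assumes x: "x \<in> homog p" and y: "y \<in> homog q"
  shows "affine_act (current x n) (affine_act (momentum y 0) vac) =
    (if n = 0 then affine_act (momentum (bracket x y) 0) vac else if n = 1 then form x y *\<^sub>C affine_act kappa vac else 0)"
  by (simp add: affine_act_bracket[OF current_homog[OF x] momentum_homog[OF y]] affine_act_vac bracket_current_momentum
      clinear_zero[OF clinear_affine_act] affine_act_scale_left affine_act_zero_left)

lemma current_kappa_vac: "x \<in> homog p \<Longrightarrow> affine_act (current x n) (affine_act kappa vac) = 0"
  by (simp add: affine_act_bracket[OF current_homog kappa_homog] affine_act_vac bracket_kappa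
      clinear_zero[OF clinear_affine_act] affine_act_zero_left)

lemma translation_kappa: "translation (affine_act kappa v) = affine_act kappa (translation v)"
  by (simp add: translation_act deriv_kappa affine_act_zero_left)

text \<open>Only \<open>J\<^sub>0\<close> and \<open>J\<^sub>1\<close> act nontrivially on the generators. At \<open>n = 0\<close> the claim is skew-symmetry of the Lie bracket,
  at \<open>n = 1\<close> symmetry of the form; the correction at \<open>n = 0\<close> vanishes as \<open>\<partial>\<kappa> = 0\<close>.\<close>

lemma skew_momentum:
  assumes x: "x \<in> homog p" and y: "y \<in> homog q"
  shows "V.skew (p + 1) (affine_act (momentum x 0) vac) (\<lambda>n. affine_act (current x n))
    (q + 1) (affine_act (momentum y 0) vac) (\<lambda>n. affine_act (current y n))"
  unfolding V.skew_def
proof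
  fix n
  let ?T = "\<lambda>n. affine_act (current y n) (affine_act (momentum x 0) vac)"
  let ?f = "\<lambda>s. (-1) ^ (n + s) *\<^sub>C V.dp (int s) (?T (n + s))"
  note T = current_momentum_vac[OF y x]
  have "bracket x y = (- koszul p q) *\<^sub>C bracket y x" using bracket_skew[OF x y] by simp
  hence b: "affine_act (momentum (bracket x y) 0) vac = - (koszul p q *\<^sub>C affine_act (momentum (bracket y x) 0) vac)"
    by (simp only: momentum_scale affine_act_scale_left) simp
  have f: "form x y = koszul p q * form y x" using form_symmetric[OF x y] .
  have d: "V.dp 1 (affine_act kappa vac) = 0"
    by (simp add: V.dp_def translation_kappa translation_vac clinear_zero[OF clinear_affine_act])
  have "fsum ?f = (\<Sum>s<2. ?f s)"
    by (rule fsum_eq) (simp add: T)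
  also have "\<dots> = (-1) ^ n *\<^sub>C ?T n"
    by (auto simp: T numeral_2_eq_2 clinear_scale[OF V.clinear_dp] d)
  finally show "affine_act (current x n) (affine_act (momentum y 0) vac)
    = - (koszul (p + 1 + 1) (q + 1 + 1) *\<^sub>C fsum ?f)"
    by (auto simp: current_momentum_vac[OF x y] T b f scaleC_scaleC)
qed

lemma mode_local_current:
  assumes x: "x \<in> homog p" and y: "y \<in> homog q"
  shows "V.mode_local (p + 1) (\<lambda>n. affine_act (current x n)) (q + 1) (\<lambda>n. affine_act (current y n))"
proof -
  have "(V.cdiff ^^ 1) (V.scomm (p + 1) (\<lambda>n. affine_act (current x n)) (q + 1) (\<lambda>n. affine_act (current y n)) v) = (\<lambda>m n. 0)" for v
    by (simp add: fun_eq_iff V.cdiff_def V.scomm_def affine_act_bracket[OF current_homog[OF x] current_homog[OF y]] bracket_current_current)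
  thus ?thesis unfolding V.mode_local_def by blast
qed

global_interpretation V: bracket_generators vmul vac translation vuniv_parity vuniv_gens
proof
  fix p q and a b :: "'a vuniv" and A B
  assume A: "vuniv_gens p a A"
  show "a \<in> vuniv_parity p"
    using A
  proof (cases rule: vuniv_gens_cases)
    case (momentum x q)
    thus ?thesis using act_parity[OF momentum_homog vac_parity, of x q 0] by simp
  next
    case kappa thus ?thesis using act_parity[OF kappa_homog vac_parity] by simp
  qed
  show cA: "V.conf_der p A"
    using A by (cases rule: vuniv_gens_cases) (simp_all only: conf_der_current V.conf_der_zero)
  assume B: "vuniv_gens q b B"
  have cB: "V.conf_der q B"
    using B by (cases rule: vuniv_gens_cases) (simp_all only: conf_der_current V.conf_der_zero)
  show "V.skew p a A q b B"
    using A
  proof (cases rule: vuniv_gens_cases)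
    case x: (momentum x q')
    show ?thesis using B
    proof (cases rule: vuniv_gens_cases)
      case y: (momentum y q'')
      show ?thesis unfolding x y by (rule skew_momentum[OF x(1) y(1)])
    next
      case kappa
      show ?thesis unfolding kappa x V.skew_def by (simp add: current_kappa_vac[OF x(1)])
    qed
  next
    case k: kappa
    show ?thesis using B
      by (cases rule: vuniv_gens_cases) (simp_all add: k V.skew_def current_kappa_vac)
  qed
  show "V.mode_local p A q B"
    using A
  proof (cases rule: vuniv_gens_cases)
    case x: (momentum x q')
    show ?thesis using B
    proof (cases rule: vuniv_gens_cases)
      case y: (momentum y q'')
      show ?thesis unfolding x y by (rule mode_local_current[OF x(1) y(1)])
    next
      case kappa
      show ?thesis unfolding kappa by (rule V.mode_local_sym) (intro V.mode_local_zero V.conf_der_clinear[OF cA])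
    qed
  next
    case k: kappa
    show ?thesis unfolding k by (intro V.mode_local_zero V.conf_der_clinear[OF cB])
  qed
qed

lemma dp_momentum: "V.dp (int n) (affine_act (momentum x 0) vac) = affine_act (momentum x n) vac"
proof (induction n)
  case (Suc n)
  have "of_nat (Suc n) *\<^sub>C V.dp (int (Suc n)) (affine_act (momentum x 0) vac) = of_nat (Suc n) *\<^sub>C affine_act (momentum x (Suc n)) vac"
    unfolding V.dp_Suc Suc by (simp add: translation_act translation_vac deriv_momentum affine_act_scale_left
       clinear_zero[OF clinear_affine_act])
  thus ?case by (rule V.of_nat_Suc_cancel)
qed simp

lemma state_bracket_momentum:
  assumes x: "x \<in> homog q"
  shows "\<exists>A. V.state_bracket (q + 1) (affine_act (momentum x n) vac) A"
proof -
  have d: "\<exists>A. V.state_bracket (q + 1) ((translation ^^ n) (affine_act (momentum x 0) vac)) A" for n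
  proof (induction n)
    case 0
    have "vuniv_gens (q + 1) (affine_act (momentum x 0) vac) (\<lambda>n. affine_act (current x n))"
      unfolding vuniv_gens_def using x by blast
    thus ?case unfolding funpow_0 by (blast intro: V.state_bracket.gen)
  next
    case (Suc n)
    then obtain A where "V.state_bracket (q + 1) ((translation ^^ n) (affine_act (momentum x 0) vac)) A" by blast
    from V.state_bracket.deriv[OF this] show ?case unfolding funpow.simps comp_apply by blast
  qed
  from d[of n] obtain A where "V.state_bracket (q + 1) ((translation ^^ n) (affine_act (momentum x 0) vac)) A" ..
  from V.state_bracket.scale[OF this, of "1 / fact n"] show ?thesis
    unfolding dp_momentum[of n x, symmetric] by (simp only: V.dp_def nat_int of_nat_less_0_iff if_False) (rule exI)
qed

lemma negative_vmul: "negative p X \<Longrightarrow> affine_act X v = vmul (affine_act X vac) v"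
  by (simp add: vmul_act vmul_vac)

lemma state_bracket_kappa: "V.state_bracket 1 (affine_act kappa vac) (\<lambda>n v. 0)"
  by (rule V.state_bracket.gen) (simp add: vuniv_gens_def)

lemma component_negative:
  assumes X: "negative q X"
  shows "V.component p (affine_act X v) = affine_act X (V.component (p + q) v)"
proof (rule V.component_unique)
  have e: "q + (p + q) = p" "q + (p + q + 1) = p + 1" by (cases p; cases q; simp)+
  show "affine_act X (V.component (p + q) v) \<in> vuniv_parity p"
    using act_parity[OF negative_homog[OF X] V.component(1), of "p + q" v] unfolding e .
  show "affine_act X v - affine_act X (V.component (p + q) v) \<in> vuniv_parity (p + 1)"
    using act_parity[OF negative_homog[OF X] V.component(2), of v "p + q"] unfolding e clinear_diff[OF clinear_affine_act] .
qed

text \<open>Stated for the even and the odd part of an arbitrary vector, so that the induction may run over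
  sums of vectors of mixed parity.\<close>

lemma state_bracket_total: "\<exists>A. V.state_bracket p (V.component p v) A"
proof (induction v arbitrary: p rule: vuniv_momentum_induct)
  case vac
  have sb: "V.state_bracket p ((if p = 0 then 1 else 0) *\<^sub>C vac) (\<lambda>n v. (if p = 0 then 1 else 0) *\<^sub>C 0)"
  proof (cases "p = 0")
    case True thus ?thesis using V.state_bracket.scale[OF V.state_bracket.one, of 1] by simp
  next
    case False
    have "V.state_bracket 1 (0 *\<^sub>C affine_act kappa vac) (\<lambda>n v. 0 *\<^sub>C 0)"
      by (rule V.state_bracket.scale[OF state_bracket_kappa])
    thus ?thesis using False by simp
  qed
  have ce: "V.component p vac = (if p = 0 then 1 else 0) *\<^sub>C vac"
    by (cases "p = 0") (simp_all add: V.component_pv[OF vac_parity] scaleC_one)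
  show ?case unfolding ce by (rule exI) (rule sb)
next
  case (add v w) thus ?case unfolding V.component_add by (blast intro: V.state_bracket.add)
next
  case (scale v c) thus ?case unfolding V.component_scale by (blast intro: V.state_bracket.scale)
next
  case (momentum x q v n)
  have e: "q + 1 + (p + (q + 1)) = p" by (cases p; cases q; simp)
  from state_bracket_momentum[OF momentum(1), of n] obtain A where A: "V.state_bracket (q + 1) (affine_act (momentum x n) vac) A" ..
  from momentum.IH[of "p + (q + 1)"] obtain B where B: "V.state_bracket (p + (q + 1)) (V.component (p + (q + 1)) v) B" ..
  from V.state_bracket.mul[OF A B] show ?case
    unfolding e component_negative[OF negative_momentum[OF momentum(1)]] negative_vmul[OF negative_momentum[OF momentum(1)], of n "V.component _ _"]
    by blast
next
  case (kappa v)
  have e: "1 + (p + 1) = p" by (cases p; simp)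
  from kappa.IH[of "p + 1"] obtain B where B: "V.state_bracket (p + 1) (V.component (p + 1) v) B" ..
  from V.state_bracket.mul[OF state_bracket_kappa B] show ?case
    unfolding e component_negative[OF negative_kappa] negative_vmul[OF negative_kappa, of "V.component _ _"] by blast
qed

global_interpretation V: generated_bracket vmul vac translation vuniv_parity vuniv_gens
proof
  fix a :: "'a vuniv" and p
  show "a \<in> vuniv_parity p \<Longrightarrow> \<exists>A. V.state_bracket p a A"
    using state_bracket_total[of p a] by (simp add: V.component_pv)
qed

section \<open>The gradings of the induced module\<close>

lemma is_gradingI:
  fixes G :: "'i \<Rightarrow> 'a::complex_space set"
  assumes sub: "\<And>i. cvs.subspace (G i)" and total: "\<And>v. v \<in> cvs.span (\<Union>i. G i)"
    and indep: "\<And>c :: 'i \<Rightarrow>\<^sub>0 'a. (\<forall>i. Poly_Mapping.lookup c i \<in> G i) \<Longrightarrow>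
      (\<Sum>i\<in>Poly_Mapping.keys c. Poly_Mapping.lookup c i) = 0 \<Longrightarrow> c = 0"
  shows "is_grading G"
  unfolding is_grading_def
proof (intro conjI allI)
  let ?S = "\<lambda>c :: 'i \<Rightarrow>\<^sub>0 'a. (\<Sum>i\<in>Poly_Mapping.keys c. Poly_Mapping.lookup c i)"
  have sup: "finite A \<Longrightarrow> Poly_Mapping.keys c \<subseteq> A \<Longrightarrow> ?S c = (\<Sum>i\<in>A. Poly_Mapping.lookup c i)" for A c
    by (rule sum.mono_neutral_left) (auto simp: in_keys_iff)
  have S_add: "?S (c + c') = ?S c + ?S c'" for c c'
  proof -
    let ?A = "Poly_Mapping.keys c \<union> Poly_Mapping.keys c'"
    have "?S (c + c') = (\<Sum>i\<in>?A. Poly_Mapping.lookup (c + c') i)"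
      by (rule sup) (simp_all add: Poly_Mapping.keys_add)
    moreover have "?S c = (\<Sum>i\<in>?A. Poly_Mapping.lookup c i)" "?S c' = (\<Sum>i\<in>?A. Poly_Mapping.lookup c' i)"
      by (rule sup; simp)+
    ultimately show ?thesis by (simp only: lookup_add sum.distrib)
  qed
  fix v
  have "\<exists>c. (\<forall>i. Poly_Mapping.lookup c i \<in> G i) \<and> ?S c = v"
    using total[of v]
  proof (induction rule: cvs.span_induct_alt)
    case base
    show ?case by (rule exI[of _ 0]) (simp add: cvs.subspace_0[OF sub])
  next
    case (step t x y)
    then obtain c j where c: "\<forall>i. Poly_Mapping.lookup c i \<in> G i" "?S c = y" and j: "x \<in> G j" by blast
    let ?e = "Poly_Mapping.single j (t *\<^sub>C x)"
    have "?S ?e = t *\<^sub>C x" by (simp add: sup[of "{j}"])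
    moreover have "Poly_Mapping.lookup ?e i \<in> G i" for i
      using j by (auto simp: lookup_single when_def cvs.subspace_0[OF sub] intro: cvs.subspace_scale[OF sub])
    moreover have "?S (?e + c) = ?S ?e + ?S c" by (rule S_add)
    ultimately have "?S (?e + c) = t *\<^sub>C x + y" "\<forall>i. Poly_Mapping.lookup (?e + c) i \<in> G i"
      using c by (simp_all only: lookup_add cvs.subspace_add[OF sub] simp_thms)
    thus ?case by blast
  qed
  thus "\<exists>!c. (\<forall>i. Poly_Mapping.lookup c i \<in> G i) \<and> ?S c = v"
  proof (rule ex_ex1I, goal_cases)
    case (1 c c')
    have "?S c = ?S (c - c') + ?S c'" using S_add[of "c - c'" c'] by simp
    hence "?S (c - c') = 0" using 1 by simp
    moreover have "\<forall>i. Poly_Mapping.lookup (c - c') i \<in> G i"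
      using 1 by (simp add: lookup_minus cvs.subspace_diff[OF sub])
    ultimately have "c - c' = 0" using indep by blast
    thus ?case by simp
  qed
qed (rule sub)

lemma eigenvectors_independent:
  assumes T: "clinear T" and "finite I" and "inj_on ev I"
    and "\<And>i. i \<in> I \<Longrightarrow> T (v i) = ev i *\<^sub>C v i" and "(\<Sum>i\<in>I. v i) = 0"
  shows "\<forall>i\<in>I. v i = (0 :: 'a::complex_space)"
  using assms(2-)
proof (induction I arbitrary: v rule: finite_induct)
  case (insert j I)
  have "0 = T (\<Sum>i\<in>insert j I. v i) - ev j *\<^sub>C (\<Sum>i\<in>insert j I. v i)"
    unfolding insert.prems(3) by (simp add: clinear_zero[OF T])
  also have "\<dots> = (\<Sum>i\<in>insert j I. (ev i - ev j) *\<^sub>C v i)"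
    unfolding clinear_sum[OF T] cvs.scale_sum_right sum_subtractf[symmetric]
    by (intro sum.cong refl) (simp add: insert.prems(2) cvs.scale_left_diff_distrib)
  also have "\<dots> = (\<Sum>i\<in>I. (ev i - ev j) *\<^sub>C v i)" using insert.hyps by simp
  finally have "\<forall>i\<in>I. (ev i - ev j) *\<^sub>C v i = 0"
    using insert.prems(1,2) by (intro insert.IH) (simp_all add: clinear_scale[OF T] scaleC_scaleC mult.commute)
  moreover have "ev i \<noteq> ev j" if "i \<in> I" for i
    using insert.prems(1) insert.hyps(2) that by (auto simp: inj_on_def)
  ultimately have "\<forall>i\<in>I. v i = 0" by simp
  thus ?case using insert.prems(3) insert.hyps by simp
qed simp

text \<open>Eigenvectors with different eigenvalues are linearly independent.\<close>

lemma is_grading_eigenspaces: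
  assumes "\<And>i. cvs.subspace (G i)" "\<And>v. v \<in> cvs.span (\<Union>i. G i)"
    and T: "clinear T" and "inj ev" and ev: "\<And>i v. v \<in> G i \<Longrightarrow> T v = ev i *\<^sub>C v"
  shows "is_grading G"
proof (rule is_gradingI[OF assms(1,2)])
  fix c :: "'a \<Rightarrow>\<^sub>0 'b"
  assume c: "\<forall>i. Poly_Mapping.lookup c i \<in> G i" "(\<Sum>i\<in>Poly_Mapping.keys c. Poly_Mapping.lookup c i) = 0"
  have "\<forall>i\<in>Poly_Mapping.keys c. Poly_Mapping.lookup c i = 0"
    by (rule eigenvectors_independent[OF T finite_keys inj_on_subset[OF \<open>inj ev\<close> subset_UNIV] _ c(2)])
      (use ev c(1) in blast)
  thus "c = 0" by (auto simp: in_keys_iff poly_mapping_eq_iff fun_eq_iff)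
qed

lemma monomial_eigenvector:
  assumes "t \<noteq> 0" "z \<noteq> 0"
  shows "monomial d p s v \<Longrightarrow> twist_map t z v = (koszul 1 p * t powi d * z powi s) *\<^sub>C v"
proof (induction rule: monomial.induct)
  case 1
  show ?case using assms by (simp add: twist_map_vac scaleC_one)
next
  case (2 x q d p s v n)
  have "koszul 1 (q + p) = koszul 1 q * koszul 1 p" by (cases p; cases q; simp)
  thus ?case using assms 2
    by (simp add: twist_map_act twist_current affine_act_scale_left affine_act_scale_right scaleC_scaleC power_int_diff)
next
  case (3 x q d p s v n)
  have "koszul 1 (q + p) = koszul 1 q * koszul 1 p" by (cases p; cases q; simp)
  thus ?case using assms 3
    by (simp add: twist_map_act twist_momentum affine_act_scale_left affine_act_scale_right scaleC_scaleC power_int_add mult_ac)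
next
  case (4 d p s v)
  thus ?case using assms
    by (simp add: twist_map_act twist_kappa affine_act_scale_left affine_act_scale_right scaleC_scaleC power_int_add mult_ac)
qed

lemma span_eigenvector:
  assumes "clinear T" "\<And>v. v \<in> X \<Longrightarrow> T v = e *\<^sub>C v" "v \<in> cvs.span X"
  shows "T v = e *\<^sub>C v"
  using assms(3)
  by (induction rule: cvs.span_induct_alt)
    (auto simp: clinear_zero[OF assms(1)] clinear_add[OF assms(1)] clinear_scale[OF assms(1)] assms(2)
      scaleC_add_right scaleC_scaleC mult.commute)

lemma deg_eigenvector: "v \<in> vuniv_deg d p \<Longrightarrow> twist_map 2 1 v = (koszul 1 p * 2 powi d) *\<^sub>C v"
  unfolding vuniv_deg_def
proof (erule span_eigenvector[rotated 2])
  fix v :: "'a vuniv" assume "v \<in> {v. \<exists>s. monomial d p s v}"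
  then obtain s where "monomial d p s v" by blast
  from monomial_eigenvector[OF _ _ this, of 2 1]
  show "twist_map 2 1 v = (koszul 1 p * 2 powi d) *\<^sub>C v" by simp
qed (simp add: clinear_twist_map)

text \<open>Squaring removes the sign of the super parity, on which the spin grading does not depend.\<close>

lemma spin_eigenvector: "v \<in> vuniv_spin s \<Longrightarrow> twist_map 1 3 (twist_map 1 3 v) = (9 powi s) *\<^sub>C v"
  unfolding vuniv_spin_def
proof (erule span_eigenvector[rotated 2])
  show "clinear (\<lambda>v. twist_map 1 3 (twist_map 1 3 v))"
    by (rule clinear_compose) (simp_all add: clinear_twist_map)
  fix v :: "'a vuniv" assume "v \<in> {v. \<exists>d p. monomial d p s v}"
  then obtain d p where "monomial d p s v" by blast
  from monomial_eigenvector[OF _ _ this, of 1 3]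
  have "twist_map 1 3 v = (koszul 1 p * 3 powi s) *\<^sub>C v" by simp
  moreover have "koszul 1 p * 3 powi s * (koszul 1 p * 3 powi s) = (9 powi s :: complex)"
  proof -
    have "koszul 1 p * koszul 1 p = 1" by (simp add: koszul_def)
    moreover have "(3 powi s * 3 powi s :: complex) = 9 powi s" by (simp flip: power_int_mult_distrib)
    ultimately show ?thesis by (metis mult.assoc mult.left_commute mult_1)
  qed
  ultimately show "twist_map 1 3 (twist_map 1 3 v) = (9 powi s) *\<^sub>C v"
    by (simp add: clinear_scale[OF clinear_twist_map] scaleC_scaleC)
qed

lemma span_image:
  assumes "clinear f" "\<And>v. v \<in> X \<Longrightarrow> f v \<in> cvs.span Y" "v \<in> cvs.span X"
  shows "f v \<in> cvs.span Y"
  using assms(3)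
  by (induction rule: cvs.span_induct_alt)
    (auto simp: clinear_zero[OF assms(1)] clinear_add[OF assms(1)] clinear_scale[OF assms(1)]
      intro: cvs.span_add cvs.span_scale cvs.span_zero assms(2))

lemma monomial_span: "v \<in> cvs.span {v. \<exists>d p s. monomial d p s (v :: 'g::lie_superalgebra_form vuniv)}"
proof (induction v rule: vuniv_momentum_induct)
  case vac
  show ?case by (rule cvs.span_base) (blast intro: monomial.intros)
next
  case (momentum x q v n)
  show ?case
    by (rule span_image[OF clinear_affine_act _ momentum.IH])
      (use monomial.intros(3)[OF momentum.hyps(1)] in \<open>blast intro: cvs.span_base\<close>)
next
  case (kappa v)
  show ?case
    by (rule span_image[OF clinear_affine_act _ kappa.IH])
      (use monomial.intros(4) in \<open>blast intro: cvs.span_base\<close>)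
qed (auto intro: cvs.span_add cvs.span_scale)

lemma two_nine_independent:
  assumes "(2::real) powi a * 9 powi b = 2 powi a' * 9 powi b'"
  shows "a = a' \<and> b = b'"
proof -
  have nat: "m = 0 \<and> n = 0" if "(2::real) ^ m = 9 ^ n" for m n
  proof -
    have "real (2 ^ m) = real (9 ^ n)" using that by simp
    hence e: "(2::nat) ^ m = 9 ^ n" by (simp only: of_nat_eq_iff)
    have "m = 0"
    proof (rule ccontr)
      assume "m \<noteq> 0"
      hence "even ((9::nat) ^ n)" unfolding e[symmetric] by simp
      thus False by simp
    qed
    thus ?thesis using e by (cases n) simp_all
  qed
  have nat1: "m = 0 \<and> n = 0" if "(2::real) ^ m * 9 ^ n = 1" for m n
  proof -
    have "real (2 ^ m * 9 ^ n) = real 1" using that by simp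
    hence "(2::nat) ^ m * 9 ^ n = 1" by (simp only: of_nat_eq_iff)
    thus ?thesis by simp
  qed
  have cancel: "u = w" if "u * c = w * c" "c \<noteq> 0" for u w c :: real using that by simp
  define x y where "x = a - a'" and "y = b' - b"
  have "(2::real) powi a = 2 powi x * 2 powi a'" "(9::real) powi b' = 9 powi y * 9 powi b"
    using power_int_add[of "2::real" x a'] power_int_add[of "9::real" y b] by (simp_all add: x_def y_def)
  hence "(2::real) powi x * (2 powi a' * 9 powi b) = 9 powi y * (2 powi a' * 9 powi b)"
    using assms by (simp only: mult_ac)
  moreover have "(2::real) powi a' * 9 powi b \<noteq> 0"
    by (intro no_zero_divisors power_int_not_zero disjI1) (rule zero_neq_numeral[symmetric])+
  ultimately have e: "(2::real) powi x = 9 powi y" by (rule cancel)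
  have pos: "u powi k = u ^ nat k" if "k \<ge> 0" for u :: real and k
    using that by (simp add: power_int_def)
  have neg: "u powi k = inverse (u ^ nat (- k))" if "\<not> k \<ge> 0" for u :: real and k
    using that by (simp add: power_int_def power_inverse)
  have inv: "u * w = 1" if "u = inverse w \<or> inverse u = w" "u \<noteq> 0" "w \<noteq> 0" for u w :: real
    using that by auto
  have nz: "(2::real) ^ k \<noteq> 0" "(9::real) ^ k \<noteq> 0" for k by simp_all
  have "x = 0 \<and> y = 0"
  proof (cases "x \<ge> 0"; cases "y \<ge> 0")
    assume xy: "x \<ge> 0" "y \<ge> 0"
    have "(2::real) ^ nat x = 9 ^ nat y" using e unfolding pos[OF xy(1)] pos[OF xy(2)] .
    from nat[OF this] xy show ?thesis by linarith
  next
    assume xy: "x \<ge> 0" "\<not> y \<ge> 0"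
    have "(2::real) ^ nat x = inverse (9 ^ nat (- y))" using e unfolding pos[OF xy(1)] neg[OF xy(2)] .
    from nat1[OF inv[OF disjI1[OF this] nz]] xy show ?thesis by linarith
  next
    assume xy: "\<not> x \<ge> 0" "y \<ge> 0"
    have "inverse ((2::real) ^ nat (- x)) = 9 ^ nat y" using e unfolding neg[OF xy(1)] pos[OF xy(2)] .
    from nat1[OF inv[OF disjI2[OF this] nz]] xy show ?thesis by linarith
  next
    assume xy: "\<not> x \<ge> 0" "\<not> y \<ge> 0"
    have "inverse ((2::real) ^ nat (- x)) = inverse (9 ^ nat (- y))" using e unfolding neg[OF xy(1)] neg[OF xy(2)] .
    hence "(2::real) ^ nat (- x) = 9 ^ nat (- y)" by (rule inverse_eq_imp_eq)
    from nat[OF this] xy show ?thesis by linarith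
  qed
  thus ?thesis by (simp add: x_def y_def)
qed

text \<open>The eigenvalues separate all degrees because 2 and 9 are multiplicatively independent, and the sign
  gives the super parity.\<close>

lemma eigenvalue_inj:
  assumes "koszul 1 p * 2 powi d * 9 powi s = koszul 1 p' * 2 powi d' * (9 powi s' :: complex)"
  shows "d = d' \<and> p = p' \<and> s = s'"
proof -
  have k: "norm (koszul 1 p) = 1" for p by (simp add: koszul_def)
  have "norm (koszul 1 p * 2 powi d * 9 powi s :: complex) = 2 powi d * 9 powi s" for p d s
    by (simp add: norm_mult norm_power_int k)
  hence ds: "d = d' \<and> s = s'" using assms two_nine_independent by metis
  hence "koszul 1 p = koszul 1 p'" using assms by simp
  thus ?thesis using ds by (cases p; cases p'; simp)
qed

lemma monomial_in_deg: "monomial d p s v \<Longrightarrow> v \<in> vuniv_deg d p"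
  and monomial_in_spin: "monomial d p s v \<Longrightarrow> v \<in> vuniv_spin s"
  unfolding vuniv_deg_def vuniv_spin_def by (rule cvs.span_base, blast)+

lemma vuniv_spanned:
  fixes G :: "'i \<Rightarrow> 'g::lie_superalgebra_form vuniv set"
  assumes "\<And>d p s v. monomial d p s v \<Longrightarrow> \<exists>i. v \<in> G i"
  shows "v \<in> cvs.span (\<Union>i. G i)"
proof -
  have "{v. \<exists>d p s. monomial d p s v} \<subseteq> (\<Union>i. G i)"
  proof
    fix w :: "'g vuniv" assume "w \<in> {v. \<exists>d p s. monomial d p s v}"
    then obtain d p s where "monomial d p s w" by blast
    from assms[OF this] show "w \<in> (\<Union>i. G i)" by blast
  qed
  from cvs.span_mono[OF this] monomial_span show ?thesis by (rule subsetD)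
qed

lemma vuniv_deg_grading: "is_grading (\<lambda>(d, p). vuniv_deg d p :: 'g::lie_superalgebra_form vuniv set)"
proof (rule is_grading_eigenspaces[where T = "twist_map 2 1" and ev = "\<lambda>(d, p). koszul 1 p * 2 powi d"])
  show "inj (\<lambda>(d, p). koszul 1 p * 2 powi d :: complex)"
    by (rule injI) (use eigenvalue_inj[of _ _ 0 _ _ 0] in auto)
  show "cvs.subspace (case i of (d, p) \<Rightarrow> vuniv_deg d p)" for i
    by (simp add: vuniv_deg_def split: prod.split)
  show "v \<in> cvs.span (\<Union>i. case i of (d, p) \<Rightarrow> vuniv_deg d p)" for v :: "'g vuniv"
    by (rule vuniv_spanned) (use monomial_in_deg in fastforce)
qed (auto simp: clinear_twist_map deg_eigenvector)

lemma vuniv_spin_grading: "is_grading (vuniv_spin :: int \<Rightarrow> 'g::lie_superalgebra_form vuniv set)"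
proof (rule is_grading_eigenspaces[where T = "\<lambda>v. twist_map 1 3 (twist_map 1 3 v)" and ev = "\<lambda>s. 9 powi s"])
  show "inj (\<lambda>s. 9 powi s :: complex)"
    by (rule injI) (use eigenvalue_inj[of 0 0 _ 0 0] in auto)
  show "clinear (\<lambda>v :: 'g vuniv. twist_map 1 3 (twist_map 1 3 v))"
    by (rule clinear_compose) (simp_all add: clinear_twist_map)
  show "cvs.subspace (vuniv_spin s)" for s by (simp add: vuniv_spin_def)
  show "v \<in> cvs.span (\<Union>s. vuniv_spin s)" for v :: "'g vuniv"
    by (rule vuniv_spanned) (use monomial_in_spin in blast)
qed (rule spin_eigenvector)

lemma vuniv_deg_spin_grading:
  "is_grading (\<lambda>(d, p, s). vuniv_deg d p \<inter> vuniv_spin s :: 'g::lie_superalgebra_form vuniv set)"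
proof (rule is_grading_eigenspaces[where T = "\<lambda>v. twist_map 2 1 (twist_map 1 3 (twist_map 1 3 v))"
      and ev = "\<lambda>(d, p, s). koszul 1 p * 2 powi d * 9 powi s"])
  show "inj (\<lambda>(d, p, s). koszul 1 p * 2 powi d * 9 powi s :: complex)"
  proof (rule injI)
    fix i j :: "int \<times> bit \<times> int"
    assume e: "(case i of (d, p, s) \<Rightarrow> koszul 1 p * 2 powi d * 9 powi s) = (case j of (d, p, s) \<Rightarrow> koszul 1 p * 2 powi d * (9 powi s :: complex))"
    obtain d p s d' p' s' where ij: "i = (d, p, s)" "j = (d', p', s')" by (metis prod.collapse)
    from eigenvalue_inj[OF e[unfolded ij prod.case]] show "i = j" by (simp add: ij)
  qed
  show "clinear (\<lambda>v :: 'g vuniv. twist_map 2 1 (twist_map 1 3 (twist_map 1 3 v)))"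
    by (rule clinear_compose[OF clinear_twist_map clinear_compose[OF clinear_twist_map clinear_twist_map]]) simp_all
  show "cvs.subspace (case i of (d, p, s) \<Rightarrow> vuniv_deg d p \<inter> vuniv_spin s)" for i
    by (auto simp: vuniv_deg_def vuniv_spin_def intro: cvs.subspace_inter split: prod.splits)
  fix i and v :: "'g vuniv"
  assume "v \<in> (case i of (d, p, s) \<Rightarrow> vuniv_deg d p \<inter> vuniv_spin s)"
  thus "twist_map 2 1 (twist_map 1 3 (twist_map 1 3 v)) = (case i of (d, p, s) \<Rightarrow> koszul 1 p * 2 powi d * 9 powi s) *\<^sub>C v"
    by (auto simp: spin_eigenvector deg_eigenvector clinear_scale[OF clinear_twist_map] scaleC_scaleC mult.commute split: prod.splits)
next
  show "v \<in> cvs.span (\<Union>i. case i of (d, p, s) \<Rightarrow> vuniv_deg d p \<inter> vuniv_spin s)" for v :: "'g vuniv"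
    by (rule vuniv_spanned) (use monomial_in_spin monomial_in_deg in fastforce)
qed

section \<open>Compatibility of the fields with the gradings\<close>

text \<open>The span of the monomials of given degrees, generated without currents: this is the same space by
  \<open>monomial_graded\<close> and \<open>graded_span\<close>, but gives a stronger induction rule.\<close>

inductive graded :: "int \<Rightarrow> bit \<Rightarrow> int \<Rightarrow> 'g::lie_superalgebra_form vuniv \<Rightarrow> bool" where
  zero: "graded d p s 0"
| vac: "graded 0 0 0 vac"
| add: "graded d p s v \<Longrightarrow> graded d p s w \<Longrightarrow> graded d p s (v + w)"
| scale: "graded d p s v \<Longrightarrow> graded d p s (c *\<^sub>C v)"
| momentum: "x \<in> homog q \<Longrightarrow> graded d p s v \<Longrightarrow> graded (d + 1) (q + p) (s + int n + 1) (affine_act (momentum x n) v)"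
| kappa: "graded d p s v \<Longrightarrow> graded (d + 1) p s (affine_act kappa v)"

lemma graded_cong: "graded d p s v \<Longrightarrow> d = d' \<Longrightarrow> p = p' \<Longrightarrow> s = s' \<Longrightarrow> graded d' p' s' v"
  by simp

text \<open>In the commutator with a momentum, the term \<open>n h(x,y) \<kappa>\<close> has the right super parity because \<open>h\<close> is even.\<close>

lemma graded_current:
  assumes x: "x \<in> homog r"
  shows "graded d p s v \<Longrightarrow> graded d (r + p) (s - int n) (affine_act (current x n) v)"
proof (induction rule: graded.induct)
  case (zero d p s)
  show ?case by (simp add: clinear_zero[OF clinear_affine_act] graded.zero)
next
  case vac
  show ?case by (simp add: affine_act_vac graded.zero)
next
  case (add d p s v w)
  thus ?case by (simp only: affine_act_add_right graded.add)
next
  case (scale d p s v c)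
  thus ?case by (simp only: affine_act_scale_right graded.scale)
next
  case (momentum y q d p s v m)
  have 1: "graded (d + 1) (r + (q + p)) (s + int m + 1 - int n) (affine_act (momentum y m) (affine_act (current x n) v))"
    by (rule graded_cong[OF graded.momentum[OF momentum.hyps(1) momentum.IH, of m]]) (simp, simp only: ac_simps, simp)
  have 2: "graded (d + 1) (r + (q + p)) (s + int m + 1 - int n) (affine_act (bracket (current x n) (momentum y m)) v)"
  proof -
    consider "n \<le> m" | "n = m + 1" "q = r" | "n = m + 1" "q \<noteq> r" | "n > m + 1" by linarith
    thus ?thesis
    proof cases
      case 1
      show ?thesis
        unfolding bracket_current_momentum if_P[OF 1]
        by (rule graded_cong[OF graded.momentum[OF bracket_homog[OF x momentum.hyps(1)] momentum.hyps(2), of "m - n"]])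
          (simp, simp only: ac_simps, simp add: of_nat_diff 1)
    next
      case 2
      have "r + (q + p) = p" using 2 by (cases r; cases p; simp)
      thus ?thesis
        using graded.scale[OF graded.kappa[OF momentum.hyps(2)]] 2
        by (simp add: bracket_current_momentum affine_act_scale_left)
    next
      case 3
      hence "form x y = 0" using form_even[OF x momentum.hyps(1)] by auto
      hence e: "bracket (current x n) (momentum y m) = 0" using 3 by (simp add: bracket_current_momentum)
      show ?thesis unfolding e affine_act_zero_left by (rule graded.zero)
    next
      case 4
      hence e: "bracket (current x n) (momentum y m) = 0" by (simp add: bracket_current_momentum)
      show ?thesis unfolding e affine_act_zero_left by (rule graded.zero)
    qed
  qed
  show ?case
    unfolding affine_act_bracket[OF current_homog[OF x] momentum_homog[OF momentum.hyps(1)]]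
    by (intro graded.add graded.scale 1 2)
next
  case (kappa d p s v)
  show ?case
    unfolding affine_act_bracket[OF current_homog[OF x] kappa_homog] bracket_kappa affine_act_zero_left add_0_right
    by (intro graded.scale graded.kappa kappa.IH)
qed

lemma monomial_graded: "monomial d p s v \<Longrightarrow> graded d p s v"
  by (induction rule: monomial.induct) (blast intro: graded.intros graded_current)+

lemma graded_span: "graded d p s v \<Longrightarrow> v \<in> cvs.span {v. monomial d p s v}"
proof (induction rule: graded.induct)
  case (momentum x q d p s v n)
  show ?case
    by (rule span_image[OF clinear_affine_act _ momentum.IH])
      (drule CollectD, intro cvs.span_base CollectI, erule monomial.intros(3)[OF momentum.hyps(1)])
next
  case (kappa d p s v)
  show ?case
    by (rule span_image[OF clinear_affine_act _ kappa.IH]) (drule CollectD, intro cvs.span_base CollectI, erule monomial.intros(4))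
qed (auto intro: cvs.span_zero cvs.span_add cvs.span_scale cvs.span_base monomial.intros)

lemma graded_deg: "graded d p s v \<Longrightarrow> v \<in> vuniv_deg d p"
  and graded_spin: "graded d p s v \<Longrightarrow> v \<in> vuniv_spin s"
proof -
  assume "graded d p s v"
  hence v: "v \<in> cvs.span {v. monomial d p s v}" by (rule graded_span)
  have "{v. monomial d p s v} \<subseteq> {v. \<exists>s. monomial d p s v}" "{v. monomial d p s v} \<subseteq> {v. \<exists>d p. monomial d p s v}"
    by (intro Collect_mono impI exI, assumption)+
  from this[THEN cvs.span_mono, THEN subsetD, OF v]
  show "v \<in> vuniv_deg d p" "v \<in> vuniv_spin s" by (simp_all only: vuniv_deg_def vuniv_spin_def)
qed

lemma vuniv_deg_image:
  assumes "clinear f" and f: "\<And>s v. graded d p s v \<Longrightarrow> f v \<in> vuniv_deg e q" and v: "v \<in> vuniv_deg d p"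
  shows "f v \<in> vuniv_deg e q"
  unfolding vuniv_deg_def
proof (rule span_image[OF assms(1) _ v[unfolded vuniv_deg_def]])
  fix w :: "'a vuniv" assume "w \<in> {v. \<exists>s. monomial d p s v}"
  then obtain s where "monomial d p s w" by blast
  from f[OF monomial_graded[OF this]] show "f w \<in> cvs.span {v. \<exists>s. monomial e q s v}"
    unfolding vuniv_deg_def .
qed

lemma vuniv_spin_image:
  assumes "clinear f" and f: "\<And>d p v. graded d p s v \<Longrightarrow> f v \<in> vuniv_spin t" and v: "v \<in> vuniv_spin s"
  shows "f v \<in> vuniv_spin t"
  unfolding vuniv_spin_def
proof (rule span_image[OF assms(1) _ v[unfolded vuniv_spin_def]])
  fix w :: "'a vuniv" assume "w \<in> {v. \<exists>d p. monomial d p s v}"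
  then obtain d p where "monomial d p s w" by blast
  from f[OF monomial_graded[OF this]] show "f w \<in> cvs.span {v. \<exists>d p. monomial d p t v}"
    unfolding vuniv_spin_def .
qed

lemma vuniv_deg_scale: "v \<in> vuniv_deg d p \<Longrightarrow> c *\<^sub>C v \<in> vuniv_deg d p"
  and vuniv_deg_zero: "0 \<in> vuniv_deg d p"
  and vuniv_spin_add: "v \<in> vuniv_spin s \<Longrightarrow> w \<in> vuniv_spin s \<Longrightarrow> v + w \<in> vuniv_spin s"
  and vuniv_spin_scale: "v \<in> vuniv_spin s \<Longrightarrow> c *\<^sub>C v \<in> vuniv_spin s"
  by (simp_all add: vuniv_deg_def vuniv_spin_def cvs.span_add cvs.span_scale cvs.span_zero)

lemma graded_parity: "graded d p s v \<Longrightarrow> v \<in> vuniv_parity (total_parity d p)"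
proof (induction rule: graded.induct)
  case vac
  show ?case using vac_parity by (simp add: total_parity_def)
next
  case (momentum x q d p s v n)
  have "q + 1 + total_parity d p = total_parity (d + 1) (q + p)"
    unfolding total_parity_def of_int_add of_int_1 by (simp only: ac_simps)
  with act_parity[OF momentum_homog[OF momentum.hyps(1), of n] momentum.IH] show ?case by (simp only:)
next
  case (kappa d p s v)
  have "1 + total_parity d p = total_parity (d + 1) p"
    unfolding total_parity_def of_int_add of_int_1 by (simp only: ac_simps)
  with act_parity[OF kappa_homog kappa.IH] show ?case by (simp only:)
qed (simp_all only: V.pv_zero V.pv_add V.pv_scale)

lemma vuniv_deg_parity:
  assumes "v \<in> vuniv_deg d p"
  shows "v \<in> vuniv_parity (total_parity d p)"
  unfolding vuniv_parity_def
proof (rule CollectI, rule span_eigenvector[OF clinear_vparity _ assms[unfolded vuniv_deg_def]])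
  fix w :: "'a vuniv" assume "w \<in> {v. \<exists>s. monomial d p s v}"
  then obtain s where "monomial d p s w" by blast
  from graded_parity[OF monomial_graded[OF this]]
  show "vparity w = koszul 1 (total_parity d p) *\<^sub>C w" by (simp add: vuniv_parity_def)
qed

lemma graded_vmul:
  assumes b: "graded e q t b"
  shows "graded d p s a \<Longrightarrow> graded (d + e) (p + q) (s + t) (vmul a b)"
proof (induction rule: graded.induct)
  case (zero d p s) show ?case by (simp add: graded.zero)
next
  case vac show ?case using b by (simp only: vmul_vac add_0)
next
  case (add d p s v w) thus ?case by (simp only: vmul_add_left graded.add)
next
  case (scale d p s v c) thus ?case by (simp only: vmul_scale_left graded.scale)
next
  case (momentum x r d p s v n)
  show ?case
    unfolding vmul_act[OF negative_momentum[OF momentum.hyps(1)]]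
    by (rule graded_cong[OF graded.momentum[OF momentum.hyps(1) momentum.IH, of n]]) (simp_all only: ac_simps)
next
  case (kappa d p s v)
  show ?case
    unfolding vmul_act[OF negative_kappa]
    by (rule graded_cong[OF graded.kappa[OF kappa.IH]]) (simp_all only: ac_simps)
qed

lemma graded_translation: "graded d p s v \<Longrightarrow> graded d p (s + 1) (translation v)"
proof (induction rule: graded.induct)
  case (zero d p s) show ?case by (simp add: graded.zero)
next
  case vac show ?case by (simp add: translation_vac graded.zero)
next
  case (add d p s v w) thus ?case by (simp only: V.D_add graded.add)
next
  case (scale d p s v c) thus ?case by (simp only: V.D_scale graded.scale)
next
  case (momentum x q d p s v n)
  have 1: "graded (d + 1) (q + p) (s + int n + 1 + 1) (affine_act (momentum x (n + 1)) v)"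
    by (rule graded_cong[OF graded.momentum[OF momentum.hyps, of "n + 1"]]) simp_all
  have 2: "graded (d + 1) (q + p) (s + int n + 1 + 1) (affine_act (momentum x n) (translation v))"
    by (rule graded_cong[OF graded.momentum[OF momentum.hyps(1) momentum.IH, of n]]) simp_all
  show ?case
    unfolding translation_act deriv_momentum affine_act_scale_left by (intro graded.add graded.scale 1 2)
next
  case (kappa d p s v)
  show ?case unfolding translation_kappa by (rule graded.kappa[OF kappa.IH])
qed

lemma graded_dp:
  assumes "graded d p s v"
  shows "graded d p (s + k) (V.dp k v)"
proof (cases "k < 0")
  case True thus ?thesis by (simp add: V.dp_neg graded.zero)
next
  case False
  have "graded d p (s + int n) ((translation ^^ n) v)" for n
  proof (induction n)
    case (Suc n)
    show ?case unfolding funpow.simps comp_apply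
      by (rule graded_cong[OF graded_translation[OF Suc]]) simp_all
  qed (simp add: assms)
  from graded.scale[OF this[of "nat k"]] show ?thesis using False by (simp add: V.dp_def)
qed

text \<open>The nonnegative modes of a field of cohomological degree \<open>d\<close>, super parity \<open>p\<close> and spin \<open>s\<close>.\<close>

definition graded_family :: "int \<Rightarrow> bit \<Rightarrow> int \<Rightarrow> (nat \<Rightarrow> 'g::lie_superalgebra_form vuniv \<Rightarrow> 'g vuniv) \<Rightarrow> bool" where
  "graded_family d p s A \<longleftrightarrow>
     (\<forall>n e q t v. graded e q t v \<longrightarrow> graded (d + e - 1) (p + q) (s + t - int n - 1) (A n v))"

lemma graded_familyD:
  "graded_family d p s A \<Longrightarrow> graded e q t v \<Longrightarrow> graded (d + e - 1) (p + q) (s + t - int n - 1) (A n v)"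
  unfolding graded_family_def by blast

lemma graded_sum: "(\<And>i. i \<in> S \<Longrightarrow> graded d p s (f i)) \<Longrightarrow> graded d p s (sum f S)"
  by (induction S rule: infinite_finite_induct) (simp_all add: graded.zero graded.add)

lemma graded_family_mul_family:
  fixes a :: "'g::lie_superalgebra_form vuniv"
  assumes a: "graded d p s a" and B: "graded_family d' p' s' B"
  shows "graded_family (d + d') (p + p') (s + s') (V.mul_family a B)"
  unfolding graded_family_def V.mul_family_def fsum_def
proof (intro allI impI graded_sum)
  fix n e q t j and v :: "'g vuniv" assume v: "graded e q t v"
  show "graded (d + d' + e - 1) (p + p' + q) (s + s' + t - int n - 1) (vmul (V.dp (int j) a) (B (n + j) v))"
    by (rule graded_cong[OF graded_vmul[OF graded_familyD[OF B v, of "n + j"] graded_dp[OF a, of "int j"]]])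
      (simp, simp only: ac_simps, simp)
qed

lemma graded_family_add:
  fixes A B :: "nat \<Rightarrow> 'g::lie_superalgebra_form vuniv \<Rightarrow> 'g vuniv"
  assumes "graded_family d p s A" "graded_family d p s B"
  shows "graded_family d p s (\<lambda>n v. A n v + B n v)"
  unfolding graded_family_def
proof (intro allI impI)
  fix n e q t and v :: "'g vuniv" assume v: "graded e q t v"
  show "graded (d + e - 1) (p + q) (s + t - int n - 1) (A n v + B n v)"
    by (rule graded.add[OF graded_familyD[OF assms(1) v] graded_familyD[OF assms(2) v]])
qed

lemma graded_family_scale:
  fixes A :: "nat \<Rightarrow> 'g::lie_superalgebra_form vuniv \<Rightarrow> 'g vuniv"
  assumes "graded_family d p s A"
  shows "graded_family d p s (\<lambda>n v. c *\<^sub>C A n v)"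
  unfolding graded_family_def
proof (intro allI impI)
  fix n e q t and v :: "'g vuniv" assume v: "graded e q t v"
  show "graded (d + e - 1) (p + q) (s + t - int n - 1) (c *\<^sub>C A n v)"
    by (rule graded.scale[OF graded_familyD[OF assms v]])
qed

lemma graded_family_deriv_family:
  fixes A :: "nat \<Rightarrow> 'g::lie_superalgebra_form vuniv \<Rightarrow> 'g vuniv"
  assumes "graded_family d p s A" shows "graded_family d p (s + 1) (V.deriv_family A)"
  unfolding graded_family_def
proof (intro allI impI)
  fix n e q t and v :: "'g vuniv" assume v: "graded e q t v"
  show "graded (d + e - 1) (p + q) (s + 1 + t - int n - 1) (V.deriv_family A n v)"
  proof (cases n)
    case 0
    hence e: "V.deriv_family A n v = 0" by (simp add: V.deriv_family_def)
    show ?thesis unfolding e by (rule graded.zero)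
  next
    case (Suc m)
    have "graded (d + e - 1) (p + q) (s + 1 + t - int n - 1) (A m v)"
      by (rule graded_cong[OF graded_familyD[OF assms v, of m]]) (simp_all add: Suc)
    moreover have "V.deriv_family A n v = (- of_nat n) *\<^sub>C A m v" by (simp add: V.deriv_family_def Suc del: of_nat_Suc)
    ultimately show ?thesis by (simp only: graded.scale)
  qed
qed

lemma vbracket_momentum: "x \<in> homog q \<Longrightarrow> V.vbracket (affine_act (momentum x 0) vac) = (\<lambda>n. affine_act (current x n))"
proof -
  assume "x \<in> homog q"
  hence "vuniv_gens (q + 1) (affine_act (momentum x 0) vac) (\<lambda>n. affine_act (current x n))"
    unfolding vuniv_gens_def by blast
  thus ?thesis by (rule V.vbracket_eq[OF V.state_bracket.gen])
qed

lemma momentum_vac_parity: "x \<in> homog q \<Longrightarrow> affine_act (momentum x n) vac \<in> vuniv_parity (q + 1)"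
  using act_parity[OF momentum_homog vac_parity, of x q n] by (simp only: add_0_right)

lemma graded_family_momentum:
  assumes x: "x \<in> homog q"
  shows "graded_family 1 q (int n + 1) (V.vbracket (affine_act (momentum x n) vac))"
proof (induction n)
  case 0
  show ?case unfolding vbracket_momentum[OF x] graded_family_def
    by (auto intro!: graded_cong[OF graded_current[OF x]])
next
  case (Suc n)
  let ?a = "affine_act (momentum x n) vac"
  have "translation ?a = of_nat (Suc n) *\<^sub>C affine_act (momentum x (Suc n)) vac"
    by (simp add: translation_act translation_vac deriv_momentum affine_act_scale_left clinear_zero[OF clinear_affine_act])
  hence "affine_act (momentum x (Suc n)) vac = (1 / of_nat (Suc n)) *\<^sub>C translation ?a"
    by (simp add: scaleC_scaleC del: of_nat_Suc)
  moreover have "V.vbracket (translation ?a) = V.deriv_family (V.vbracket ?a)"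
    by (rule V.vbracket_eq[OF V.state_bracket.deriv[OF V.vbracket[OF momentum_vac_parity[OF x]]]])
  ultimately have "V.vbracket (affine_act (momentum x (Suc n)) vac) = (\<lambda>m v. (1 / of_nat (Suc n)) *\<^sub>C V.deriv_family (V.vbracket ?a) m v)"
    by (simp only: fun_eq_iff V.vbracket_scale) simp
  moreover have "int (Suc n) + 1 = int n + 1 + 1" by simp
  ultimately show ?case using graded_family_scale[OF graded_family_deriv_family[OF Suc]] by (simp only:)
qed

lemma vbracket_zero: "V.vbracket 0 n v = 0"
  using V.vbracket_scale[of 0 0 n v] by simp

text \<open>Uniqueness of the bracket allows computing it along any expression of \<open>a\<close>, here a monomial.\<close>

lemma graded_family_vbracket:
  fixes a :: "'g::lie_superalgebra_form vuniv"
  shows "graded d p s a \<Longrightarrow> graded_family d p s (V.vbracket a)"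
proof (induction rule: graded.induct)
  case (zero d p s)
  have "V.vbracket (0 :: 'g vuniv) = (\<lambda>n v. 0)" by (simp add: fun_eq_iff vbracket_zero)
  thus ?case unfolding graded_family_def by (simp only: graded.zero simp_thms)
next
  case vac
  show ?case unfolding V.vbracket_eq[OF V.state_bracket.one] graded_family_def by (blast intro: graded.zero)
next
  case (add d p s v w)
  have "V.vbracket (v + w) = (\<lambda>n u. V.vbracket v n u + V.vbracket w n u)" by (simp add: fun_eq_iff V.vbracket_add)
  thus ?case using add by (simp only: graded_family_add)
next
  case (scale d p s v c)
  have "V.vbracket (c *\<^sub>C v) = (\<lambda>n u. c *\<^sub>C V.vbracket v n u)" by (simp add: fun_eq_iff V.vbracket_scale)
  thus ?case using scale by (simp only: graded_family_scale)
next
  case (momentum x q d p s v n)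
  let ?m = "affine_act (momentum x n) vac"
  have "V.vbracket (affine_act (momentum x n) v)
     = V.product_family (q + 1) ?m (V.vbracket ?m) (total_parity d p) v (V.vbracket v)"
    unfolding negative_vmul[OF negative_momentum[OF momentum.hyps(1)], of n v]
    by (rule V.vbracket_eq[OF V.state_bracket.mul[OF V.vbracket[OF momentum_vac_parity[OF momentum.hyps(1)]]
          V.vbracket[OF graded_parity[OF momentum.hyps(2)]]]])
  moreover have "graded 1 q (int n + 1) ?m"
    by (rule graded_cong[OF graded.momentum[OF momentum.hyps(1) graded.vac, of n]]) simp_all
  from graded_family_mul_family[OF this momentum.IH]
  have "graded_family (d + 1) (q + p) (s + int n + 1) (V.mul_family ?m (V.vbracket v))"
    by (simp only: ac_simps)
  moreover from graded_family_mul_family[OF momentum.hyps(2) graded_family_momentum[OF momentum.hyps(1), of n]]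
  have "graded_family (d + 1) (q + p) (s + int n + 1) (V.mul_family v (V.vbracket ?m))"
    by (simp only: ac_simps)
  ultimately show ?case
    by (simp only: V.product_family_def graded_family_add graded_family_scale)
next
  case (kappa d p s v)
  have "V.vbracket (affine_act kappa v) n w = affine_act kappa (V.vbracket v n w)" for n w
    unfolding negative_vmul[OF negative_kappa, of v] negative_vmul[OF negative_kappa, of "V.vbracket v n w"]
    by (rule V.vbracket_central_mul[OF state_bracket_kappa])
      (simp add: translation_kappa translation_vac clinear_zero[OF clinear_affine_act])
  thus ?case
    unfolding graded_family_def by (auto intro!: graded_cong[OF graded.kappa[OF graded_familyD[OF kappa.IH]]])
qed

lemma graded_vertex:
  assumes a: "graded d p s a" and v: "graded e q t v"
  shows "graded (d + e - (if n \<ge> 0 then 1 else 0)) (p + q) (t + (s - n - 1)) (V.vertex a n v)"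
proof (cases "n \<ge> 0")
  case True
  show ?thesis unfolding V.vertex_nonneg[OF True]
    by (rule graded_cong[OF graded_familyD[OF graded_family_vbracket[OF a] v, of "nat n"]]) (use True in simp_all)
next
  case False
  hence "n < 0" by simp
  show ?thesis unfolding V.vertex_neg[OF \<open>n < 0\<close>]
    by (rule graded_cong[OF graded_vmul[OF v graded_dp[OF a, of "- n - 1"]]]) (use False in simp_all)
qed

lemma clinear_vertex_state: "clinear (\<lambda>a. V.vertex a n v)"
  by (rule clinearI) (rule V.vertex_add V.vertex_scale)+

lemma vertex_deg:
  assumes a: "a \<in> vuniv_deg d p" and v: "v \<in> vuniv_deg e q"
  shows "V.vertex a n v \<in> vuniv_deg (d + e - (if n \<ge> 0 then 1 else 0)) (p + q)"
proof (rule vuniv_deg_image[OF clinear_vertex_state _ a])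
  fix s and b :: "'a vuniv" assume b: "graded d p s b"
  show "V.vertex b n v \<in> vuniv_deg (d + e - (if n \<ge> 0 then 1 else 0)) (p + q)"
    by (rule vuniv_deg_image[OF V.vertex_clinear _ v]) (rule graded_deg[OF graded_vertex[OF b]])
qed

lemma vertex_spin:
  assumes a: "a \<in> vuniv_spin s" and v: "v \<in> vuniv_spin t"
  shows "V.vertex a n v \<in> vuniv_spin (t + (s - n - 1))"
proof (rule vuniv_spin_image[OF clinear_vertex_state _ a])
  fix d p and b :: "'a vuniv" assume b: "graded d p s b"
  show "V.vertex b n v \<in> vuniv_spin (t + (s - n - 1))"
    by (rule vuniv_spin_image[OF V.vertex_clinear _ v]) (rule graded_spin[OF graded_vertex[OF b]])
qed

section \<open>The raviolo vertex algebra\<close>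

lemma ckappa_deg_cases:
  assumes "s \<in> ckappa_deg e q"
  obtains a where "e = 0" "q = 0" "s = CK a 0" | b where "e = 1" "q = 0" "s = CK 0 b" | "s = 0"
  using assms by (auto simp: ckappa_deg_def split: if_splits)

text \<open>The eigenspaces of \<open>a + b \<kappa> \<mapsto> a + 2 b \<kappa>\<close>.\<close>

lemma ckappa_grading: "is_grading (\<lambda>(d, p). ckappa_deg d p)"
proof (rule is_grading_eigenspaces[where T = "\<lambda>s. CK (ck0 s) (2 * ck1 s)" and ev = "\<lambda>(d, p). koszul 1 p * 2 powi d"])
  show "inj (\<lambda>(d, p). koszul 1 p * 2 powi d :: complex)"
    by (rule injI) (use eigenvalue_inj[of _ _ 0 _ _ 0] in auto)
  show "clinear (\<lambda>s. CK (ck0 s) (2 * ck1 s))"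
    by (rule clinearI) (simp_all add: plus_ckappa_def scaleC_ckappa_def algebra_simps)
  show "cvs.subspace (case i of (d, p) \<Rightarrow> ckappa_deg d p)" for i
    by (auto simp: cvs.subspace_def ckappa_deg_def plus_ckappa_def zero_ckappa_def scaleC_ckappa_def split: prod.splits)
  show "v \<in> cvs.span (\<Union>i. case i of (d, p) \<Rightarrow> ckappa_deg d p)" for v
  proof -
    have "CK (ck0 v) 0 \<in> (case (0, 0) of (d, p) \<Rightarrow> ckappa_deg d p)" "CK 0 (ck1 v) \<in> (case (1, 0) of (d, p) \<Rightarrow> ckappa_deg d p)"
      by (simp_all add: ckappa_deg_def)
    hence "CK (ck0 v) 0 + CK 0 (ck1 v) \<in> cvs.span (\<Union>i. case i of (d, p) \<Rightarrow> ckappa_deg d p)"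
      by (intro cvs.span_add cvs.span_base) blast+
    thus ?thesis by (simp add: plus_ckappa_def)
  qed
  show "CK (ck0 v) (2 * ck1 v) = (case i of (d, p) \<Rightarrow> koszul 1 p * 2 powi d) *\<^sub>C v"
    if "v \<in> (case i of (d, p) \<Rightarrow> ckappa_deg d p)" for i v
    using that by (auto simp: ckappa_deg_def scaleC_ckappa_def zero_ckappa_def split: prod.splits if_splits)
qed

lemma affine_act_kappa_kappa: "affine_act kappa (affine_act kappa v) = 0"
  by (rule affine_rep.rho_kappa[OF affine_act_is_rep])

lemma ckappa_act_simps: "ckappa_act (CK a b) v = a *\<^sub>C v + b *\<^sub>C affine_act kappa v"
  "ckappa_act 0 v = 0" "ckappa_act 1 v = v"
  by (simp_all add: ckappa_act_def zero_ckappa_def one_ckappa_def scaleC_one)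

lemma clinear_ckappa_act: "clinear (ckappa_act s)"
  by (rule clinearI)
    (simp_all add: ckappa_act_def affine_act_add_right affine_act_scale_right scaleC_add_right scaleC_scaleC mult.commute)

lemma ckappa_act_mult: "ckappa_act (s * t) v = ckappa_act s (ckappa_act t v)"
  by (cases s; cases t)
    (simp add: ckappa_act_simps times_ckappa_def affine_act_add_right affine_act_scale_right affine_act_kappa_kappa
      scaleC_add_right scaleC_add_left scaleC_scaleC mult_ac)

lemma kappa_deg: "v \<in> vuniv_deg d p \<Longrightarrow> affine_act kappa v \<in> vuniv_deg (d + 1) p"
  by (rule vuniv_deg_image[OF clinear_affine_act graded_deg[OF graded.kappa]])

lemma kappa_spin: "v \<in> vuniv_spin s \<Longrightarrow> affine_act kappa v \<in> vuniv_spin s"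
  by (rule vuniv_spin_image[OF clinear_affine_act graded_spin[OF graded.kappa]])

lemma ckappa_act_deg:
  assumes "s \<in> ckappa_deg d p" "v \<in> vuniv_deg e q"
  shows "ckappa_act s v \<in> vuniv_deg (d + e) (p + q)"
  using assms(1)
proof (cases rule: ckappa_deg_cases)
  case (1 a)
  thus ?thesis using assms(2) by (simp only: ckappa_act_simps cvs.scale_zero_left add_0 add_0_right vuniv_deg_scale)
next
  case (2 b)
  thus ?thesis using vuniv_deg_scale[OF kappa_deg[OF assms(2)], of b]
    by (simp only: ckappa_act_simps cvs.scale_zero_left add_0 add.commute[of 1 e])
next
  case 3 thus ?thesis by (simp only: ckappa_act_simps vuniv_deg_zero)
qed

global_interpretation M: graded_module ckappa_deg ckappa_act "vuniv_deg :: int \<Rightarrow> bit \<Rightarrow> 'g::lie_superalgebra_form vuniv set"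
proof
  fix s t :: ckappa and d e p q and v w :: "'g vuniv" and c
  show "is_grading (\<lambda>(d, p). ckappa_deg d p)" by (rule ckappa_grading)
  show "1 \<in> ckappa_deg 0 0" by (simp add: ckappa_deg_def one_ckappa_def)
  show "s * t \<in> ckappa_deg (d + e) (p + q)" if "s \<in> ckappa_deg d p" "t \<in> ckappa_deg e q"
    using that by (elim ckappa_deg_cases) (auto simp: ckappa_deg_def times_ckappa_def zero_ckappa_def)
  show "s * t = koszul (total_parity d p) (total_parity e q) *\<^sub>C (t * s)" if "s \<in> ckappa_deg d p" "t \<in> ckappa_deg e q"
    using that by (elim ckappa_deg_cases) (auto simp: total_parity_def times_ckappa_def zero_ckappa_def scaleC_ckappa_def)
  show "is_grading (\<lambda>(d, p). vuniv_deg d p :: 'g vuniv set)" by (rule vuniv_deg_grading)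
  show "ckappa_act (s + t) v = ckappa_act s v + ckappa_act t v"
    by (simp add: ckappa_act_def plus_ckappa_def scaleC_add_left)
  show "ckappa_act s (v + w) = ckappa_act s v + ckappa_act s w" by (rule clinear_add[OF clinear_ckappa_act])
  show "ckappa_act (s * t) v = ckappa_act s (ckappa_act t v)" by (rule ckappa_act_mult)
  show "ckappa_act 1 v = v" by (rule ckappa_act_simps)
  show "ckappa_act (c *\<^sub>C s) v = c *\<^sub>C ckappa_act s v"
    by (simp add: ckappa_act_def scaleC_ckappa_def scaleC_add_right scaleC_scaleC)
  show "ckappa_act s v \<in> vuniv_deg (d + e) (p + q)" if "s \<in> ckappa_deg d p" "v \<in> vuniv_deg e q"
    by (rule ckappa_act_deg[OF that])
qed

text \<open>An operator is linear over \<open>\<complex>[\<kappa>]\<close> as soon as it commutes with \<open>\<kappa>\<close>.\<close>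

lemma endoI:
  fixes A :: "'g::lie_superalgebra_form vuniv \<Rightarrow> 'g vuniv"
  assumes A: "clinear A" and k: "\<And>v. A (affine_act kappa v) = koszul (total_parity r p) 1 *\<^sub>C affine_act kappa (A v)"
    and d: "\<And>e q v. v \<in> vuniv_deg e q \<Longrightarrow> A v \<in> vuniv_deg (r + e) (p + q)"
  shows "M.endo r p A"
  unfolding M.endo_def
proof (intro conjI allI impI)
  fix e q s v assume "s \<in> ckappa_deg e q"
  thus "A (ckappa_act s v) = koszul (total_parity r p) (total_parity e q) *\<^sub>C ckappa_act s (A v)"
    by (cases rule: ckappa_deg_cases)
      (simp_all add: ckappa_act_simps clinear_scale[OF A] clinear_zero[OF A] k scaleC_scaleC total_parity_def mult.commute scaleC_one)
qed (simp_all only: clinear_add[OF A] d)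

lemma total_parity_pred: "total_parity (r - 1) p = total_parity r p + 1"
  by (cases p) (simp_all add: total_parity_def)

lemma vbracket_kappa:
  assumes a: "a \<in> vuniv_parity p"
  shows "V.vbracket a n (affine_act kappa v) = koszul (p + 1) 1 *\<^sub>C affine_act kappa (V.vbracket a n v)"
proof -
  note c = V.state_bracket_conf_der[OF V.vbracket[OF a]]
  have "V.vbracket a n (affine_act kappa vac) = 0"
    using V.state_bracket_skew[OF V.vbracket[OF a] state_bracket_kappa] by (simp add: V.skew_def)
  thus ?thesis
    using V.conf_der_mul[OF c V.state_bracket_pv[OF state_bracket_kappa], of n v]
    by (simp add: negative_vmul[OF negative_kappa, symmetric])
qed

lemma vertex_endo:
  assumes a: "a \<in> vuniv_deg r p"
  shows "m < 0 \<Longrightarrow> M.endo r p (V.vertex a m)" "m \<ge> 0 \<Longrightarrow> M.endo (r - 1) p (V.vertex a m)"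
proof -
  note par = vuniv_deg_parity[OF a]
  show "M.endo r p (V.vertex a m)" if m: "m < 0"
  proof (rule endoI[OF V.vertex_clinear])
    show "V.vertex a m (affine_act kappa v) = koszul (total_parity r p) 1 *\<^sub>C affine_act kappa (V.vertex a m v)" for v
      by (simp add: V.vertex_neg[OF m] vmul_act_right[OF negative_kappa] vmul_scale_left affine_act_scale_right
          vpar_parity[OF V.dp_pv[OF par]]) (simp add: koszul_def)
    show "V.vertex a m v \<in> vuniv_deg (r + e) (p + q)" if "v \<in> vuniv_deg e q" for e q v
      using vertex_deg[OF a that, of m] m by simp
  qed
  show "M.endo (r - 1) p (V.vertex a m)" if m: "m \<ge> 0"
  proof (rule endoI[OF V.vertex_clinear])
    show "V.vertex a m (affine_act kappa v) = koszul (total_parity (r - 1) p) 1 *\<^sub>C affine_act kappa (V.vertex a m v)" for v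
      by (simp only: V.vertex_nonneg[OF m] vbracket_kappa[OF par] total_parity_pred)
    show "V.vertex a m v \<in> vuniv_deg (r - 1 + e) (p + q)" if v: "v \<in> vuniv_deg e q" for e q v
    proof -
      have "r + e - (if m \<ge> 0 then 1 else 0) = r - 1 + e" using m by simp
      thus ?thesis using vertex_deg[OF a v, of m] by (simp only:)
    qed
  qed
qed

lemma translation_deg: "v \<in> vuniv_deg d p \<Longrightarrow> translation v \<in> vuniv_deg d p"
  by (rule vuniv_deg_image[OF clinear_translation graded_deg[OF graded_translation]])

lemma translation_spin: "v \<in> vuniv_spin s \<Longrightarrow> translation v \<in> vuniv_spin (s + 1)"
  by (rule vuniv_spin_image[OF clinear_translation graded_spin[OF graded_translation]])

lemma vertex_ckappa_act: "V.vertex (ckappa_act s a) m v = ckappa_act s (V.vertex a m v)"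
proof -
  have "translation (affine_act kappa vac) = 0"
    by (simp add: translation_kappa translation_vac clinear_zero[OF clinear_affine_act])
  from V.vertex_central_mul[OF state_bracket_kappa this]
  have "V.vertex (affine_act kappa a) m v = affine_act kappa (V.vertex a m v)"
    by (simp only: negative_vmul[OF negative_kappa, symmetric])
  thus ?thesis by (simp add: ckappa_act_def V.vertex_add V.vertex_scale)
qed

theorem vuniv_spin_graded_raviolo_vertex_algebra:
  "spin_graded_raviolo_vertex_algebra ckappa_deg ckappa_act vuniv_deg vac translation V.vertex
     (vuniv_spin :: int \<Rightarrow> 'g::lie_superalgebra_form vuniv set)"
proof
  fix a b v :: "'g vuniv" and s t r e :: int and p q :: bit and m n d :: int and k f
  show "vac \<in> vuniv_deg 0 0" by (rule graded_deg[OF graded.vac])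
  show "vac \<in> vuniv_spin 0" by (rule graded_spin[OF graded.vac])
  show "M.endo 0 0 (translation :: 'g vuniv \<Rightarrow> _)"
  proof (rule endoI[OF clinear_translation])
    show "translation (affine_act kappa v) = koszul (total_parity 0 0) 1 *\<^sub>C affine_act kappa (translation v)" for v :: "'g vuniv"
      by (simp add: translation_kappa total_parity_def scaleC_one)
    show "translation v \<in> vuniv_deg (0 + e) (0 + q)" if "v \<in> vuniv_deg e q" for e q and v :: "'g vuniv"
      unfolding add_0 by (rule translation_deg[OF that])
  qed
  show "V.vertex (a + b) m v = V.vertex a m v + V.vertex b m v" by (rule V.vertex_add)
  show "V.vertex (ckappa_act f a) m v = ckappa_act f (V.vertex a m v)" by (rule vertex_ckappa_act)
  show "M.raviolo_field r p (V.vertex a)" if a: "a \<in> vuniv_deg r p"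
    unfolding M.raviolo_field_def
  proof (intro conjI allI impI)
    fix v :: "'g vuniv"
    obtain N where N: "\<forall>n\<ge>N. V.vbracket a n v = 0" using V.vbracket_vanishing[of a v] by (auto simp: vanishing_def)
    have "V.vertex a m v = 0" if "m \<ge> int N" for m
      using that N by (simp add: V.vertex_nonneg)
    thus "\<exists>N. \<forall>m\<ge>N. V.vertex a m v = 0" by blast
  qed (use vertex_endo[OF a] in simp_all)
  show "translation (coefficient (V.vertex a) k v) - coefficient (V.vertex a) k (translation v)
      = raviolo_deriv (\<lambda>k. coefficient (V.vertex a) k v) k" by (rule V.vertex_translation)
  show "translation vac = (0 :: 'g vuniv)" by (rule translation_vac)
  show "V.vertex vac m v = (if m = - 1 then v else 0)" by (rule V.vertex_one)
  show "V.vertex a m vac = 0" if "m \<ge> 0" by (rule V.vertex_creation(1)[OF that])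
  show "V.vertex a (- 1) vac = a" by (rule V.vertex_creation(2))
  show "mutually_local (total_parity d p) (total_parity e q) (V.vertex a) (V.vertex b)"
    if "a \<in> vuniv_deg d p" "b \<in> vuniv_deg e q"
    by (intro V.vertex_local vuniv_deg_parity that)
  show "is_grading (vuniv_spin :: int \<Rightarrow> 'g vuniv set)" by (rule vuniv_spin_grading)
  show "is_grading (\<lambda>(d, p, s). vuniv_deg d p \<inter> vuniv_spin s :: 'g vuniv set)" by (rule vuniv_deg_spin_grading)
  show "ckappa_act f v \<in> vuniv_spin s" if "v \<in> vuniv_spin s"
    unfolding ckappa_act_def by (intro vuniv_spin_add vuniv_spin_scale kappa_spin that)
  show "translation v \<in> vuniv_spin (s + 1)" if "v \<in> vuniv_spin s" by (rule translation_spin[OF that])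
  show "V.vertex a n v \<in> vuniv_spin (t + (s - n - 1))" if "a \<in> vuniv_spin s" "v \<in> vuniv_spin t"
    by (rule vertex_spin[OF that])
qed

lemma vertex_momentum:
  assumes x: "x \<in> homog q"
  shows "V.vertex (affine_act (momentum x 0) vac) = mu_field x"
proof (rule ext, rule ext)
  fix m v
  show "V.vertex (affine_act (momentum x 0) vac) m v = mu_field x m v"
  proof (cases "m < 0")
    case True
    have "V.dp (- m - 1) (affine_act (momentum x 0) vac) = affine_act (momentum x (nat (- m - 1))) vac"
      using dp_momentum[of "nat (- m - 1)" x] True by simp
    thus ?thesis using True
      by (simp add: V.vertex_neg mu_field_def negative_vmul[OF negative_momentum[OF x], symmetric])
  next
    case False
    thus ?thesis by (simp add: V.vertex_nonneg mu_field_def vbracket_momentum[OF x])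
  qed
qed

text \<open>The negative modes of \<open>\<mu>\<^sub>x(z)\<close> are the momenta \<open>\<mu>\<^bsub>x,n\<^esub>\<close>, which together with \<open>\<kappa>\<close> generate from the vacuum; a
  scalar \<open>\<kappa>\<close> can be moved to the front with a sign.\<close>

lemma vuniv_strongly_generated:
  fixes T :: "'g::lie_superalgebra_form set"
  assumes T: "homogeneous_basis T"
  shows "strongly_generated ckappa_act vac V.vertex ((\<lambda>x. affine_act (momentum x 0) vac) ` T)"
proof -
  let ?N = "negative_mode_monomials V.vertex vac ((\<lambda>x. affine_act (momentum x 0) vac) ` T)"
  let ?M = "module_span ckappa_act ?N"
  have act: "ckappa_act s v \<in> ?M" if "v \<in> ?M" for s v
    using that
  proof (induction rule: module_span.induct)
    case 1 show ?case by (simp add: clinear_zero[OF clinear_ckappa_act] module_span.intros(1))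
  next
    case (2 x t) thus ?case by (simp add: ckappa_act_mult[symmetric] module_span.intros(2))
  next
    case (3 v w) thus ?case by (simp add: clinear_add[OF clinear_ckappa_act] module_span.intros(3))
  qed
  have scale: "c *\<^sub>C v \<in> ?M" if "v \<in> ?M" for c v
    using act[OF that, of "CK c 0"] by (simp add: ckappa_act_simps)
  have mT: "affine_act (momentum x n) v \<in> ?M" if x: "x \<in> T" and v: "v \<in> ?M" for x n v
    using v
  proof (induction rule: module_span.induct)
    case 1 show ?case by (simp add: clinear_zero[OF clinear_affine_act] module_span.intros(1))
  next
    case (2 w s)
    obtain q where q: "x \<in> homog q" using T x by (auto simp: homogeneous_basis_def)
    have "mu_field x (- int n - 1) w \<in> ?N"
      using negative_mode_monomials.intros(2)[of "affine_act (momentum x 0) vac" "(\<lambda>x. affine_act (momentum x 0) vac) ` T" "- int n - 1" w V.vertex vac]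
        x 2 by (simp add: vertex_momentum[OF q])
    hence "affine_act (momentum x n) w \<in> ?N" by (simp add: mu_field_def)
    hence "ckappa_act (CK (ck0 s) (koszul (q + 1) 1 * ck1 s)) (affine_act (momentum x n) w) \<in> ?M"
      by (rule module_span.intros(2))
    moreover have "affine_act (momentum x n) (ckappa_act s w)
      = ckappa_act (CK (ck0 s) (koszul (q + 1) 1 * ck1 s)) (affine_act (momentum x n) w)"
      unfolding ckappa_act_def affine_act_add_right affine_act_scale_right scaleC_scaleC
        negative_commute[OF negative_momentum[OF q] negative_kappa]
      by (simp add: mult.commute)
    ultimately show ?case by (simp only:)
  next
    case (3 v w) thus ?case by (simp add: affine_act_add_right module_span.intros(3))
  qed
  have mom: "affine_act (momentum x n) v \<in> ?M" if v: "v \<in> ?M" for x n v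
  proof -
    have "x \<in> cvs.span T" using T by (simp add: homogeneous_basis_def)
    thus ?thesis
    proof (induction rule: cvs.span_induct_alt)
      case base
      have "momentum (0 :: 'g) n = 0" using momentum_scale[of 0 "0 :: 'g" n] by simp
      hence "affine_act (momentum 0 n) v = 0" by (simp add: affine_act_zero_left)
      thus ?case by (simp add: module_span.intros(1))
    next
      case (step c x y)
      thus ?case
        by (simp add: momentum_add momentum_scale affine_act_add_left affine_act_scale_left module_span.intros(3) scale mT[OF _ v])
    qed
  qed
  have "v \<in> ?M" for v
  proof (induction v rule: vuniv_momentum_induct)
    case vac
    show ?case using module_span.intros(2)[OF negative_mode_monomials.intros(1), of ckappa_act 1]
      by (simp add: ckappa_act_simps)
  next
    case (kappa v) thus ?case using act[of v "CK 0 1"] by (simp add: ckappa_act_simps scaleC_one)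
  qed (simp_all add: module_span.intros(3) scale mom)
  thus ?thesis by (auto simp: strongly_generated_def)
qed

theorem proposition4p3p1:
  fixes T :: "'g::lie_superalgebra_form set"
  assumes "homogeneous_basis T"
  shows "\<exists>D Y.
    is_translation D \<and>
    (\<forall>x\<in>T. Y (affine_act (momentum x 0) vac) = mu_field x) \<and>
    spin_graded_raviolo_vertex_algebra ckappa_deg ckappa_act vuniv_deg vac D Y vuniv_spin \<and>
    strongly_generated ckappa_act vac Y ((\<lambda>x. affine_act (momentum x 0) vac) ` T)"
proof (intro exI conjI)
  show "is_translation translation" by (rule is_translation_translation)
  show "\<forall>x\<in>T. V.vertex (affine_act (momentum x 0) vac) = mu_field x"
    using assms vertex_momentum unfolding homogeneous_basis_def by blast
  show "spin_graded_raviolo_vertex_algebra ckappa_deg ckappa_act vuniv_deg vac translation V.vertex vuniv_spin"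
    by (rule vuniv_spin_graded_raviolo_vertex_algebra)
  show "strongly_generated ckappa_act vac V.vertex ((\<lambda>x. affine_act (momentum x 0) vac) ` T)"
    by (rule vuniv_strongly_generated[OF assms])
qed

end
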